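(* Let $r>0$, let $k\in\mathbb N$ with $k>1$, and let $\varrho:\mathbb R\to\mathbb R$ be Lipschitz continuous and non-polynomial. The class of IWNs of order up to $k$ with nonlinearity $\varrho$ is at least as expressive as the $k$-WL test at distinguishing graphon-signals: whenever $(W,f),(V,g)\in\mathcal{WS}_r$ satisfy $\nu^{k\text{-WL}}_{(W,f)}\ne\nu^{k\text{-WL}}_{(V,g)}$, there exists an IWN $\mathcal N$ of order at most $k$ with nonlinearity $\varrho$ such that $\mathcal N(W,f)\neq\mathcal N(V,g)$.
   Context: $\lambda^m$ is $m$-dimensional Lebesgue measure. $\mathcal{WS}_r$ is the set of graphon-signals $(W,f)$: $W:[0,1]^2\to[0,1]$ symmetric measurable, $f\in L^\infty[0,1]$ with $\|f\|_\infty\le r$. $\mathsf{LE}_{k\to\ell}$ is the space of bounded linear operators $T:L^2([0,1]^k)\to L^2([0,1]^\ell)$ ($L^2([0,1]^0)=\mathbb R$) with $T(U^\varphi)=T(U)^\varphi$ a.e. for all $U$ and all measure preserving $\varphi:[0,1]\to[0,1]$, where $U^\varphi(x_1,\dots,x_k)=U(\varphi(x_1),\dots,\varphi(x_k))$. (The elements of $\mathsf{LE}_{0\to k}$ correspond to constant functions on $[0,1]^k$.) An Invariant Graphon Network (IWN) with nonlinearity $\varrho$ is a map $\mathcal N=\mathfrak T^{(S)}\circ\varrho\circ\cdots\circ\varrho\circ\mathfrak T^{(1)}$ on $\mathcal{WS}_r$, where $S\in\mathbb N$, $k_s\in\mathbb N_0$, $d_s\in\mathbb N$ for $0\le s\le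 S$, $(d_0,k_0)=(2,2)$, $(d_S,k_S)=(1,0)$, and $\mathfrak T^{(s)}:(L^2([0,1]^{k_{s-1}}))^{d_{s-1}}\to(L^2([0,1]^{k_s}))^{d_s}$ is given by $\mathfrak T^{(s)}(\boldsymbol U)_i=\sum_{j=1}^{d_{s-1}}T^{(s)}_{ij}(\boldsymbol U_j)+b^{(s)}_i$ with $T^{(s)}_{ij}\in\mathsf{LE}_{k_{s-1}\to k_s}$ and $b_i^{(s)}\in\mathsf{LE}_{0\to k_s}$; $\varrho$ is applied pointwise. The input $(W,f)$ is identified with $(x,y)\mapsto(W(x,y),f(x))$. The order of the IWN is $\max_{s\in[S]}k_s$. $k$-WL color space: let $P_0^k=[0,1]^{\binom{[k]}{2}}\times[-r,r]^k$ with its standard topology, and inductively for $s\in\mathbb N_0$ let $\mathbb M_s^k=\prod_{i\le s}P_i^k$ and $P_{s+1}^k=\mathcal P(\mathbb M_s^k)^k$, where $\mathcal P(\cdot)$ denotes the Borel probability measures with the weak topology. Let $\mathbb M^k=\prod_{s\in\mathbb N_0}P_s^k$ with the product topology. All spaces carry their Borel $\sigma$-algebras. $k$-WL test for $(W,f)$: $\mathfrak C^{(0)}(\boldsymbol x)=\big((W(x_i,x_j))_{\{i,j\}\in\binom{[k]}{2}},(f(x_j))_{j\in[k]}\big)\in\mathbb M_0^k$ for $\boldsymbol x\in[0,1]^k$ and, for $s\ge1$, $\mathfrak C^{(s)}(\boldsymbol x)=\big(\mathfrak C^{(s-1)}(\boldsymbol x),\big((\mathfrak C^{(s-1)}\circ\boldsymbol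 x[\cdot/j])_*\lambda\big)_{j\in[k]}\big)\in\mathbb M_s^k$, where $\boldsymbol x[\cdot/j]:[0,1]\to[0,1]^k$, $y\mapsto(x_1,\dots,x_{j-1},y,x_{j+1},\dots,x_k)$, and $(\cdot)_*$ is the pushforward. Let $\mathfrak C^{k\text{-WL}}_{(W,f)}:[0,1]^k\to\mathbb M^k$ be the map whose $s$-th coordinate is the $s$-th coordinate of $\mathfrak C^{(s)}$ for all $s\in\mathbb N_0$. The $k$-WL distribution is $\nu^{k\text{-WL}}_{(W,f)}=(\mathfrak C^{k\text{-WL}}_{(W,f)})_*\lambda^k\in\mathcal P(\mathbb M^k)$; the $k$-WL test distinguishes two graphon-signals iff these distributions differ. *)

theory Defs
  imports "HOL-Probability.Probability" "HOL-Computational_Algebra.Polynomial"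
begin

section \<open>Graphon-signals\<close>

definition I01 :: "real measure" where
  "I01 = restrict_space lborel {0..1}"

text \<open>
  Points of \<open>[0,1]\<^sup>k\<close> are functions on the index set \<open>{..<k}\<close>, equal to \<^const>\<open>undefined\<close> elsewhere;
  coordinates are numbered from 0.
\<close>

definition cube :: "nat \<Rightarrow> (nat \<Rightarrow> real) measure" where
  "cube k = PiM {..<k} (\<lambda>_. I01)"

text \<open>
  The elements of \<open>L\<^sup>\<infinity>\<close> are given by representatives: the kernel \<open>W\<close> and the signal \<open>f\<close> are Borel
  measurable, and \<open>f\<close> takes its values in \<open>[-r,r]\<close> everywhere, as the colouring needs.
\<close>

definition graphon_signal :: "real \<Rightarrow> (real \<Rightarrow> real \<Rightarrow> real) \<Rightarrow> (real \<Rightarrow> real) \<Rightarrow> bool" where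
  "graphon_signal r W f \<longleftrightarrow>
     (\<lambda>(x, y). W x y) \<in> borel_measurable (I01 \<Otimes>\<^sub>M I01) \<and>
     (\<forall>x\<in>{0..1}. \<forall>y\<in>{0..1}. W x y \<in> {0..1} \<and> W x y = W y x) \<and>
     f \<in> borel_measurable I01 \<and>
     (\<forall>x\<in>{0..1}. f x \<in> {-r..r})"


section \<open>Invariant graphon networks\<close>

text \<open>
  \<open>L\<^sup>2([0,1]\<^sup>k)\<close> is handled through representatives. \<^term>\<open>cube 0\<close> is a point mass, so that
  \<open>L\<^sup>2([0,1]\<^sup>0)\<close> is the real line.
\<close>

type_synonym tensor = "(nat \<Rightarrow> real) \<Rightarrow> real"

definition sq_integrable :: "nat \<Rightarrow> tensor set" where
  "sq_integrable k = {U \<in> borel_measurable (cube k). integrable (cube k) (\<lambda>x. (U x)\<^sup>2)}"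

definition norm2 :: "nat \<Rightarrow> tensor \<Rightarrow> real" where
  "norm2 k U = sqrt (\<integral>x. (U x)\<^sup>2 \<partial>cube k)"

definition relabel :: "nat \<Rightarrow> (real \<Rightarrow> real) \<Rightarrow> tensor \<Rightarrow> tensor" where
  "relabel k \<phi> U = (\<lambda>x. U (\<lambda>i\<in>{..<k}. \<phi> (x i)))"

definition measure_preserving01 :: "(real \<Rightarrow> real) \<Rightarrow> bool" where
  "measure_preserving01 \<phi> \<longleftrightarrow> \<phi> \<in> measurable I01 I01 \<and> distr I01 I01 \<phi> = I01"

text \<open>The first two conditions say that \<open>T\<close> induces a map between the spaces of classes.\<close>

definition LE :: "nat \<Rightarrow> nat \<Rightarrow> (tensor \<Rightarrow> tensor) set" where
  "LE k l = {T.
     (\<forall>U\<in>sq_integrable k. T U \<in> sq_integrable l) \<and>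
     (\<forall>U\<in>sq_integrable k. \<forall>V\<in>sq_integrable k.
        (AE x in cube k. U x = V x) \<longrightarrow> (AE x in cube l. T U x = T V x)) \<and>
     (\<forall>U\<in>sq_integrable k. \<forall>V\<in>sq_integrable k.
        AE x in cube l. T (\<lambda>z. U z + V z) x = T U x + T V x) \<and>
     (\<forall>c. \<forall>U\<in>sq_integrable k. AE x in cube l. T (\<lambda>z. c * U z) x = c * T U x) \<and>
     (\<exists>C. \<forall>U\<in>sq_integrable k. norm2 l (T U) \<le> C * norm2 k U) \<and>
     (\<forall>\<phi>. measure_preserving01 \<phi> \<longrightarrow> (\<forall>U\<in>sq_integrable k.
        AE x in cube l. T (relabel k \<phi> U) x = relabel l \<phi> (T U) x))}"

text \<open>Layers are numbered from 1 to \<open>depth\<close>, channels within a layer from 0.\<close>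

record iwn =
  depth :: nat
  tdim :: "nat \<Rightarrow> nat"
  width :: "nat \<Rightarrow> nat"
  weight :: "nat \<Rightarrow> nat \<Rightarrow> nat \<Rightarrow> tensor \<Rightarrow> tensor"
  bias :: "nat \<Rightarrow> nat \<Rightarrow> tensor \<Rightarrow> tensor"

definition is_iwn :: "iwn \<Rightarrow> bool" where
  "is_iwn N \<longleftrightarrow>
     1 \<le> depth N \<and>
     tdim N 0 = 2 \<and> width N 0 = 2 \<and>
     tdim N (depth N) = 0 \<and> width N (depth N) = 1 \<and>
     (\<forall>s\<le>depth N. 1 \<le> width N s) \<and>
     (\<forall>s\<in>{1..depth N}. \<forall>i<width N s.
        (\<forall>j<width N (s - 1). weight N s i j \<in> LE (tdim N (s - 1)) (tdim N s)) \<and>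
        bias N s i \<in> LE 0 (tdim N s))"

definition iwn_order :: "iwn \<Rightarrow> nat" where
  "iwn_order N = Max (tdim N ` {1..depth N})"

text \<open>
  An operator \<open>B \<in> LE\<^bsub>0\<rightarrow>k\<^esub>\<close> is identified with the function \<open>B(1)\<close>, which is how it acts as a bias.
\<close>

definition layer :: "iwn \<Rightarrow> nat \<Rightarrow> (nat \<Rightarrow> tensor) \<Rightarrow> nat \<Rightarrow> tensor" where
  "layer N s U i = (\<lambda>x. (\<Sum>j<width N (s - 1). weight N s i j (U j) x) + bias N s i (\<lambda>_. 1) x)"

primrec iwn_features ::
    "(real \<Rightarrow> real) \<Rightarrow> iwn \<Rightarrow> (nat \<Rightarrow> tensor) \<Rightarrow> nat \<Rightarrow> nat \<Rightarrow> tensor" where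
  "iwn_features \<rho> N U 0 = U"
| "iwn_features \<rho> N U (Suc s) =
     layer N (Suc s) (if s = 0 then U else (\<lambda>j. \<rho> \<circ> iwn_features \<rho> N U s j))"

definition iwn_input :: "(real \<Rightarrow> real \<Rightarrow> real) \<Rightarrow> (real \<Rightarrow> real) \<Rightarrow> nat \<Rightarrow> tensor" where
  "iwn_input W f j = (if j = 0 then (\<lambda>x. W (x 0) (x 1)) else (\<lambda>x. f (x 0)))"

text \<open>The output is a function on the one-point space underlying \<^term>\<open>cube 0\<close>.\<close>

definition iwn_eval ::
    "(real \<Rightarrow> real) \<Rightarrow> iwn \<Rightarrow> (real \<Rightarrow> real \<Rightarrow> real) \<Rightarrow> (real \<Rightarrow> real) \<Rightarrow> real" where
  "iwn_eval \<rho> N W f = iwn_features \<rho> N (iwn_input W f) (depth N) 0 (\<lambda>_. undefined)"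


section \<open>Borel probability measures with the weak topology\<close>

definition borel_of :: "'a topology \<Rightarrow> 'a measure" where
  "borel_of X = sigma (topspace X) {U. openin X U}"

definition borel_probs :: "'a topology \<Rightarrow> 'a measure set" where
  "borel_probs X = {\<mu>. prob_space \<mu> \<and> sets \<mu> = sets (borel_of X)}"

definition weak_topology :: "'a topology \<Rightarrow> 'a measure topology" where
  "weak_topology X = topology_generated_by
     {{\<mu> \<in> borel_probs X. (\<integral>x. h x \<partial>\<mu>) \<in> A} | h A.
        continuous_map X euclideanreal h \<and> bounded (h ` topspace X) \<and> open A}"


section \<open>The \<open>k\<close>-WL colour space\<close>

text \<open>
  The spaces \<open>P\<^sub>s\<close> are iterated spaces of measures, which have no common HOL type. All of them are
  second countable and metrizable, so the Borel probability measures on each \<open>M\<^sub>s\<close> are determined by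
  their values on a countable generator and inject into the reals. We fix such an injection for
  each space and carry the weak topology over to its image. Different injections give homeomorphic
  spaces, so whether two \<open>k\<close>-WL distributions differ does not depend on the choice.

  A point of \<open>P\<^sub>s\<close> is a family of reals indexed by \<open>coord\<close>: for \<open>s = 0\<close> the edge and the vertex
  coordinates, for \<open>s > 0\<close> only vertex coordinates, with the codes of measures as values.
\<close>

datatype coord = Edge "nat set" | Vertex nat

type_synonym color = "nat \<Rightarrow> coord \<Rightarrow> real"

definition code_of :: "color topology \<Rightarrow> color measure \<Rightarrow> real" where
  "code_of X = (SOME e. inj_on e (borel_probs X))"

definition prob_topology :: "color topology \<Rightarrow> real topology" where
  "prob_topology X = pullback_topology
     (code_of X ` borel_probs X) (the_inv_into (borel_probs X) (code_of X)) (weak_topology X)"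

definition edge_coords :: "nat \<Rightarrow> coord set" where
  "edge_coords k = Edge ` {e. e \<subseteq> {..<k} \<and> card e = 2}"

definition vertex_coords :: "nat \<Rightarrow> coord set" where
  "vertex_coords k = Vertex ` {..<k}"

lemma product_topology_fundef_cong [fundef_cong]:
  assumes "I = J" "\<And>i. i \<in> J \<Longrightarrow> X i = Y i"
  shows "product_topology X I = product_topology Y J"
proof -
  have t: "(\<Pi>\<^sub>E i\<in>I. topspace (X i)) = (\<Pi>\<^sub>E i\<in>J. topspace (Y i))"
    using assms by (auto intro!: PiE_cong)
  have "openin (product_topology X I) = openin (product_topology Y J)"
    unfolding openin_product_topology using assms by (simp add: t[unfolded assms(1)] cong: conj_cong)
  then show ?thesis
    by (simp add: topology_eq)
qed

fun P_space :: "nat \<Rightarrow> real \<Rightarrow> nat \<Rightarrow> (coord \<Rightarrow> real) topology" where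
  "P_space k r 0 = product_topology
     (case_coord (\<lambda>_. top_of_set {0..1}) (\<lambda>_. top_of_set {-r..r}))
     (edge_coords k \<union> vertex_coords k)"
| "P_space k r (Suc s) = product_topology
     (\<lambda>_. prob_topology (product_topology (\<lambda>i. P_space k r i) {..s})) (vertex_coords k)"

definition M_space :: "nat \<Rightarrow> real \<Rightarrow> nat \<Rightarrow> color topology" where
  "M_space k r s = product_topology (P_space k r) {..s}"

definition M_space_inf :: "nat \<Rightarrow> real \<Rightarrow> color topology" where
  "M_space_inf k r = product_topology (P_space k r) UNIV"


section \<open>The \<open>k\<close>-WL test\<close>

text \<open>Since \<open>W\<close> is symmetric, its value at an edge does not depend on the orientation chosen.\<close>

primrec wl_color ::
    "nat \<Rightarrow> real \<Rightarrow> (real \<Rightarrow> real \<Rightarrow> real) \<Rightarrow> (real \<Rightarrow> real) \<Rightarrow> nat \<Rightarrow> (nat \<Rightarrow> real) \<Rightarrow> color" where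
  "wl_color k r W f 0 = (\<lambda>x. \<lambda>i\<in>{..0}. \<lambda>c\<in>edge_coords k \<union> vertex_coords k.
     case c of Edge e \<Rightarrow> W (x (Min e)) (x (Max e)) | Vertex j \<Rightarrow> f (x j))"
| "wl_color k r W f (Suc s) = (\<lambda>x. (wl_color k r W f s x)(Suc s := (\<lambda>c\<in>vertex_coords k.
     case c of Edge e \<Rightarrow> undefined | Vertex j \<Rightarrow> code_of (M_space k r s)
       (distr I01 (borel_of (M_space k r s)) (\<lambda>y. wl_color k r W f s (x(j := y)))))))"

definition wl_color_inf ::
    "nat \<Rightarrow> real \<Rightarrow> (real \<Rightarrow> real \<Rightarrow> real) \<Rightarrow> (real \<Rightarrow> real) \<Rightarrow> (nat \<Rightarrow> real) \<Rightarrow> color" where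
  "wl_color_inf k r W f x = (\<lambda>s. wl_color k r W f s x s)"

definition wl_distribution ::
    "nat \<Rightarrow> real \<Rightarrow> (real \<Rightarrow> real \<Rightarrow> real) \<Rightarrow> (real \<Rightarrow> real) \<Rightarrow> color measure" where
  "wl_distribution k r W f = distr (cube k) (borel_of (M_space_inf k r)) (wl_color_inf k r W f)"

end

theory Submission
  imports Defs
begin

text \<open>
  Suppose that no network of order at most \<open>k\<close> separates the two graphon-signals, and consider the pairs
  of tensors of dimension \<open>k\<close> that a single network computes on the two inputs. Their \<open>L\<^sup>2\<close> limits form
  a space closed under averaging in one coordinate. A Lipschitz function that is not affine yields \<open>t\<^sup>2\<close>
  as a locally uniform limit of sums of \<open>c * \<rho> (a * t + b)\<close>; as depth is free, the bounded features form
  an algebra, and their \<open>L\<^sup>2\<close> limits a vector lattice closed under bounded pointwise limits. Such a lattice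
  consists, up to boundedness, of the measurable functions of a \<open>\<sigma>\<close>-algebra on two disjoint copies of the
  cube, and the two copies of each of its sets have the same measure. By induction on the round, the
  colouring is measurable for this \<open>\<sigma>\<close>-algebra: the weak topology on measures is generated by integrals of
  countably many continuous functions, and the integral of such a function against a conditional colour
  distribution is an average in one coordinate. Hence the two colour distributions agree.
\<close>

section \<open>Averaging operators\<close>

text \<open>A pair of tensors stands for one network run on two inputs, so every approximation has
  to succeed on both components with the same network. The networks built here end with the
  nonlinearity followed by averaging; non-separation therefore equates only the means of
  \<open>\<rho> \<circ> U\<close>, and passing to the means of \<open>U\<close> needs an argument of
  its own. Since \<open>\<rho>\<close> may lack derivatives, differentiation of ridge functions is
  replaced by averaging \<open>\<rho>\<close> twice, after which the second derivative is a second
  difference quotient. The Lipschitz bound makes each layer continuous on L2, which is why closures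
  can be taken layer by layer; but \<open>t^2\<close> is approximated only on bounded intervals, so
  products are formed for bounded tensors, and a second closure restores the limits. No colour is
  approximated by an explicit network: passing to measurability avoids approximation on nested
  spaces of measures.\<close>

lemma space_I01 [simp]: "space I01 = {0..1}"
  by (simp add: I01_def space_restrict_space)

lemma prob_space_I01: "prob_space I01"
  by (rule prob_spaceI) (simp add: I01_def emeasure_restrict_space space_restrict_space)

lemma prob_space_cube: "prob_space (cube k)"
  unfolding cube_def by (intro prob_space_PiM prob_space_I01)

lemma space_cube: "space (cube k) = ({..<k} \<rightarrow>\<^sub>E {0..1})"
  by (simp add: cube_def space_PiM)

lemma space_cube_component: "x \<in> space (cube k) \<Longrightarrow> i < k \<Longrightarrow> x i \<in> {0..1}"
  unfolding space_cube by (erule PiE_mem) simp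

lemma measurable_cube_component [measurable]:
  "i < k \<Longrightarrow> (\<lambda>x. x i) \<in> measurable (cube k) I01"
  unfolding cube_def by measurable

text \<open>The concrete weights and biases all have this form: substitute a random argument
  \<open>\<tau> x y\<close>, average over \<open>y\<close>, scale by \<open>c\<close>. One proof of
  membership in \<open>LE\<close> then serves coordinate substitution, averaging over one coordinate
  and the full mean.\<close>

definition averaging ::
    "real \<Rightarrow> ((nat \<Rightarrow> real) \<Rightarrow> 'b \<Rightarrow> nat \<Rightarrow> real) \<Rightarrow> 'b measure \<Rightarrow> tensor \<Rightarrow> tensor" where
  "averaging c \<tau> Q U = (\<lambda>x. c * (\<integral>y. U (\<tau> x y) \<partial>Q))"

lemma (in prob_space) square_expectation_le:
  fixes f :: "'a \<Rightarrow> real"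
  assumes "integrable M f" "integrable M (\<lambda>x. (f x)\<^sup>2)"
  shows "(expectation f)\<^sup>2 \<le> expectation (\<lambda>x. (f x)\<^sup>2)"
proof -
  have "0 \<le> expectation (\<lambda>x. (f x)\<^sup>2) - (expectation f)\<^sup>2"
    unfolding variance_eq[OF assms, symmetric] by (rule variance_positive)
  then show ?thesis by simp
qed

lemma sq_integrable_imp_integrable:
  assumes "U \<in> sq_integrable k"
  shows "integrable (cube k) U"
proof -
  interpret prob_space "cube k" by (rule prob_space_cube)
  show ?thesis
    by (rule square_integrable_imp_integrable) (use assms in \<open>simp_all add: sq_integrable_def\<close>)
qed

text \<open>\<open>distr_tau\<close> says that a uniform \<open>x\<close> and an independent
  \<open>y\<close> yield a uniform point of the cube on which the argument lives. Hence null sets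
  pull back to null sets, so the operator acts on classes, and integrals survive the
  substitution.\<close>

locale averaging_map =
  fixes k l :: nat and Q :: "'b measure" and \<tau> :: "(nat \<Rightarrow> real) \<Rightarrow> 'b \<Rightarrow> nat \<Rightarrow> real"
  assumes prob_Q: "prob_space Q"
    and measurable_tau: "case_prod \<tau> \<in> measurable (cube l \<Otimes>\<^sub>M Q) (cube k)"
    and distr_tau: "distr (cube l \<Otimes>\<^sub>M Q) (cube k) (case_prod \<tau>) = cube k"
begin

sublocale Q: prob_space Q by (rule prob_Q)

sublocale Pl: pair_prob_space "cube l" Q
  by (intro pair_prob_space.intro pair_sigma_finite.intro)
    (simp_all add: prob_space_cube prob_Q prob_space_imp_sigma_finite)

lemma integrable_tau:
  fixes h :: tensor
  assumes "integrable (cube k) h"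
  shows "integrable (cube l \<Otimes>\<^sub>M Q) (\<lambda>z. h (case_prod \<tau> z))"
    and "(\<integral>z. h (case_prod \<tau> z) \<partial>(cube l \<Otimes>\<^sub>M Q)) = (\<integral>x. h x \<partial>cube k)"
proof -
  have "integrable (distr (cube l \<Otimes>\<^sub>M Q) (cube k) (case_prod \<tau>)) h"
    using assms by (simp add: distr_tau)
  then show "integrable (cube l \<Otimes>\<^sub>M Q) (\<lambda>z. h (case_prod \<tau> z))"
    by (rule integrable_distr[OF measurable_tau])
  show "(\<integral>z. h (case_prod \<tau> z) \<partial>(cube l \<Otimes>\<^sub>M Q)) = (\<integral>x. h x \<partial>cube k)"
    using integral_distr[OF measurable_tau, of h] assms by (simp add: distr_tau)
qed

lemma AE_integrable_tau:
  fixes h :: tensor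
  assumes "integrable (cube k) h"
  shows "AE x in cube l. integrable Q (\<lambda>y. h (\<tau> x y))"
  using Pl.AE_integrable_fst'[OF integrable_tau(1)[OF assms]] by simp

lemma integral_averaging:
  fixes h :: tensor
  assumes "integrable (cube k) h"
  shows "integrable (cube l) (\<lambda>x. \<integral>y. h (\<tau> x y) \<partial>Q)"
    and "(\<integral>x. (\<integral>y. h (\<tau> x y) \<partial>Q) \<partial>cube l) = (\<integral>x. h x \<partial>cube k)"
  using Pl.integrable_fst'[OF integrable_tau(1)[OF assms]]
    Pl.integral_fst'[OF integrable_tau(1)[OF assms]] integrable_tau(2)[OF assms] by simp_all

lemma measurable_averaging:
  assumes "U \<in> borel_measurable (cube k)"
  shows "averaging c \<tau> Q U \<in> borel_measurable (cube l)"
proof -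
  have "(\<lambda>z. U (case_prod \<tau> z)) \<in> borel_measurable (cube l \<Otimes>\<^sub>M Q)"
    using measurable_compose[OF measurable_tau assms] by simp
  then have "case_prod (\<lambda>x y. U (\<tau> x y)) \<in> borel_measurable (cube l \<Otimes>\<^sub>M Q)"
    by (simp add: case_prod_beta')
  then have "(\<lambda>x. \<integral>y. U (\<tau> x y) \<partial>Q) \<in> borel_measurable (cube l)"
    by (rule Q.borel_measurable_lebesgue_integral)
  then show ?thesis
    unfolding averaging_def by simp
qed

text \<open>Jensen's inequality in \<open>y\<close>, available for almost every \<open>x\<close>,
  followed by Fubini and \<open>distr_tau\<close>. The operator norm is thus at most
  \<open>\<bar>c\<bar>\<close>.\<close>

lemma averaging_sq:
  assumes U: "U \<in> sq_integrable k"
  shows "averaging c \<tau> Q U \<in> sq_integrable l"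
    and "(\<integral>x. (averaging c \<tau> Q U x)\<^sup>2 \<partial>cube l) \<le> c\<^sup>2 * (\<integral>x. (U x)\<^sup>2 \<partial>cube k)"
proof -
  have i1: "integrable (cube k) U" using U by (rule sq_integrable_imp_integrable)
  have i2: "integrable (cube k) (\<lambda>x. (U x)\<^sup>2)" using U by (simp add: sq_integrable_def)
  have m: "averaging c \<tau> Q U \<in> borel_measurable (cube l)"
    using U by (intro measurable_averaging) (simp add: sq_integrable_def)
  have le: "AE x in cube l. (averaging c \<tau> Q U x)\<^sup>2 \<le> c\<^sup>2 * (\<integral>y. (U (\<tau> x y))\<^sup>2 \<partial>Q)"
    using AE_integrable_tau[OF i1] AE_integrable_tau[OF i2]
  proof eventually_elim
    case (elim x)
    show ?case
      using Q.square_expectation_le[OF elim] 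
      by (auto simp: averaging_def power_mult_distrib intro!: mult_left_mono)
  qed
  have i3: "integrable (cube l) (\<lambda>x. c\<^sup>2 * (\<integral>y. (U (\<tau> x y))\<^sup>2 \<partial>Q))"
    using integral_averaging(1)[OF i2] by simp
  have i4: "integrable (cube l) (\<lambda>x. (averaging c \<tau> Q U x)\<^sup>2)"
  proof (rule Bochner_Integration.integrable_bound[OF i3])
    show "(\<lambda>x. (averaging c \<tau> Q U x)\<^sup>2) \<in> borel_measurable (cube l)" using m by simp
    show "AE x in cube l. norm ((averaging c \<tau> Q U x)\<^sup>2)
        \<le> norm (c\<^sup>2 * (\<integral>y. (U (\<tau> x y))\<^sup>2 \<partial>Q))"
      using le by eventually_elim simp
  qed
  show "averaging c \<tau> Q U \<in> sq_integrable l"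
    using m i4 by (simp add: sq_integrable_def)
  have "(\<integral>x. (averaging c \<tau> Q U x)\<^sup>2 \<partial>cube l) \<le> (\<integral>x. c\<^sup>2 * (\<integral>y. (U (\<tau> x y))\<^sup>2 \<partial>Q) \<partial>cube l)"
    by (rule integral_mono_AE[OF i4 i3 le])
  also have "\<dots> = c\<^sup>2 * (\<integral>x. (U x)\<^sup>2 \<partial>cube k)"
    using integral_averaging(2)[OF i2] by simp
  finally show "(\<integral>x. (averaging c \<tau> Q U x)\<^sup>2 \<partial>cube l) \<le> c\<^sup>2 * (\<integral>x. (U x)\<^sup>2 \<partial>cube k)" .
qed

text \<open>Equivariance is a change of variables: by \<open>equiv\<close>, relabelling the
  substituted point amounts to relabelling \<open>x\<close> and moving \<open>y\<close> by a measure
  preserving \<open>\<psi>\<close>, which the integral over \<open>Q\<close> does not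
  notice.\<close>

lemma averaging_in_LE:
  assumes equiv: "\<And>\<phi>. measure_preserving01 \<phi> \<Longrightarrow> \<exists>\<psi>. \<psi> \<in> measurable Q Q \<and> distr Q Q \<psi> = Q \<and>
      (\<forall>x\<in>space (cube l). \<forall>y\<in>space Q.
        (\<lambda>i\<in>{..<k}. \<phi> (\<tau> x y i)) = \<tau> (\<lambda>i\<in>{..<l}. \<phi> (x i)) (\<psi> y))"
  shows "averaging c \<tau> Q \<in> LE k l"
  unfolding LE_def
proof (intro CollectI conjI ballI allI impI)
  fix U V assume U: "U \<in> sq_integrable k" and V: "V \<in> sq_integrable k"
  show "averaging c \<tau> Q U \<in> sq_integrable l" by (rule averaging_sq(1)[OF U])
  {
    assume "AE x in cube k. U x = V x"
    then have "AE x in distr (cube l \<Otimes>\<^sub>M Q) (cube k) (case_prod \<tau>). U x = V x"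
      unfolding distr_tau .
    then have "AE z in cube l \<Otimes>\<^sub>M Q. U (case_prod \<tau> z) = V (case_prod \<tau> z)"
      by (rule AE_distrD[OF measurable_tau])
    then have "AE x in cube l. AE y in Q. U (\<tau> x y) = V (\<tau> x y)"
      by (auto dest: Pl.AE_pair)
    with AE_space show "AE x in cube l. averaging c \<tau> Q U x = averaging c \<tau> Q V x"
    proof eventually_elim
      case (elim x)
      have m: "(\<lambda>y. F (\<tau> x y)) \<in> borel_measurable Q" if "F \<in> sq_integrable k" for F
      proof -
        have "(\<lambda>z. F (case_prod \<tau> z)) \<in> borel_measurable (cube l \<Otimes>\<^sub>M Q)"
          using that by (intro measurable_compose[OF measurable_tau]) (simp add: sq_integrable_def)
        then have "(\<lambda>y. F (case_prod \<tau> (x, y))) \<in> borel_measurable Q"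
          using elim(1) by (rule measurable_compose[OF measurable_Pair1', rotated])
        then show ?thesis by simp
      qed
      have "(\<integral>y. U (\<tau> x y) \<partial>Q) = (\<integral>y. V (\<tau> x y) \<partial>Q)"
        by (rule integral_cong_AE[OF m[OF U] m[OF V] elim(2)])
      then show ?case by (simp add: averaging_def)
    qed
  }
  show "AE x in cube l. averaging c \<tau> Q (\<lambda>z. U z + V z) x
      = averaging c \<tau> Q U x + averaging c \<tau> Q V x"
    using AE_integrable_tau[OF sq_integrable_imp_integrable[OF U]]
      AE_integrable_tau[OF sq_integrable_imp_integrable[OF V]]
    by eventually_elim (simp add: averaging_def algebra_simps)
next
  fix c' U
  show "AE x in cube l. averaging c \<tau> Q (\<lambda>z. c' * U z) x = c' * averaging c \<tau> Q U x"
    by (simp add: averaging_def)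
next
  have "norm2 l (averaging c \<tau> Q U) \<le> \<bar>c\<bar> * norm2 k U" if "U \<in> sq_integrable k" for U
  proof -
    have "norm2 l (averaging c \<tau> Q U) \<le> sqrt (c\<^sup>2 * (\<integral>x. (U x)\<^sup>2 \<partial>cube k))"
      unfolding norm2_def by (rule real_sqrt_le_mono[OF averaging_sq(2)[OF that]])
    then show ?thesis by (simp add: real_sqrt_mult norm2_def)
  qed
  then show "\<exists>C. \<forall>U\<in>sq_integrable k. norm2 l (averaging c \<tau> Q U) \<le> C * norm2 k U" by blast
next
  fix \<phi> U assume phi: "measure_preserving01 \<phi>" and U: "U \<in> sq_integrable k"
  obtain \<psi> where psi: "\<psi> \<in> measurable Q Q" "distr Q Q \<psi> = Q"
      "\<And>x y. x \<in> space (cube l) \<Longrightarrow> y \<in> space Q \<Longrightarrow>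
        (\<lambda>i\<in>{..<k}. \<phi> (\<tau> x y i)) = \<tau> (\<lambda>i\<in>{..<l}. \<phi> (x i)) (\<psi> y)"
    using equiv[OF phi] by blast
  have "averaging c \<tau> Q (relabel k \<phi> U) x = relabel l \<phi> (averaging c \<tau> Q U) x"
    if x: "x \<in> space (cube l)" for x
  proof -
    let ?x = "\<lambda>i\<in>{..<l}. \<phi> (x i)"
    have "\<phi> t \<in> {0..1}" if "t \<in> {0..1}" for t
      using phi that measurable_space[of \<phi> I01 I01] by (simp add: measure_preserving01_def)
    then have x': "?x \<in> space (cube l)"
      using x by (auto simp: space_cube PiE_iff)
    have "(\<lambda>z. U (case_prod \<tau> z)) \<in> borel_measurable (cube l \<Otimes>\<^sub>M Q)"
      using U by (intro measurable_compose[OF measurable_tau]) (simp add: sq_integrable_def)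
    then have "(\<lambda>y. U (case_prod \<tau> (?x, y))) \<in> borel_measurable Q"
      using x' by (rule measurable_compose[OF measurable_Pair1', rotated])
    then have m: "(\<lambda>y. U (\<tau> ?x y)) \<in> borel_measurable Q" by simp
    have "(\<integral>y. relabel k \<phi> U (\<tau> x y) \<partial>Q) = (\<integral>y. U (\<tau> ?x (\<psi> y)) \<partial>Q)"
      by (rule Bochner_Integration.integral_cong) (simp_all add: relabel_def psi(3)[OF x])
    also have "\<dots> = (\<integral>y. U (\<tau> ?x y) \<partial>distr Q Q \<psi>)"
      by (rule integral_distr[symmetric, OF psi(1) m])
    finally show ?thesis by (simp add: averaging_def relabel_def psi(2))
  qed
  then show "AE x in cube l. averaging c \<tau> Q (relabel k \<phi> U) x = relabel l \<phi> (averaging c \<tau> Q U) x"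
    by (rule AE_I2)
qed

end

section \<open>Coordinate substitution, full mean, resampling of one coordinate\<close>

lemma averaging_map_reindex:
  assumes p: "inj_on p {..<k}" "\<And>i. i < k \<Longrightarrow> p i < l"
  shows "averaging_map k l (cube 0) (\<lambda>x _. \<lambda>i\<in>{..<k}. x (p i))"
proof (rule averaging_map.intro)
  interpret C0: prob_space "cube 0" by (rule prob_space_cube)
  interpret Cl: prob_space "cube l" by (rule prob_space_cube)
  interpret pair_prob_space "cube l" "cube 0" ..
  show "prob_space (cube 0)" by (rule prob_space_cube)
  have m: "(\<lambda>x. \<lambda>i\<in>{..<k}. x (p i)) \<in> measurable (cube l) (cube k)"
    unfolding cube_def by (intro measurable_restrict) (auto simp: p intro!: measurable_component_singleton)
  show m': "(\<lambda>(x, _). \<lambda>i\<in>{..<k}. x (p i)) \<in> measurable (cube l \<Otimes>\<^sub>M cube 0) (cube k)"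
    using measurable_compose[OF measurable_fst m] by (simp add: case_prod_beta')
  have "distr (cube l \<Otimes>\<^sub>M cube 0) (cube k) (\<lambda>(x, _). \<lambda>i\<in>{..<k}. x (p i))
      = distr (distr (cube l \<Otimes>\<^sub>M cube 0) (cube l) fst) (cube k) (\<lambda>x. \<lambda>i\<in>{..<k}. x (p i))"
    using m by (subst distr_distr) (auto simp: comp_def case_prod_beta')
  also have "distr (cube l \<Otimes>\<^sub>M cube 0) (cube l) fst = cube l"
    by (rule C0.distr_pair_fst)
  \<comment> \<open>Injectivity of \<open>p\<close> keeps the selected coordinates independent. A
    repeated coordinate would restrict to a diagonal, a null set on which classes have no
    values.\<close>
  also have "distr (cube l) (cube k) (\<lambda>x. \<lambda>i\<in>{..<k}. x (p i)) = cube k"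
    unfolding cube_def using p by (intro distr_PiM_reindex) (auto simp: prob_space_I01)
  finally show "distr (cube l \<Otimes>\<^sub>M cube 0) (cube k) (\<lambda>(x, _). \<lambda>i\<in>{..<k}. x (p i)) = cube k" .
qed

lemma averaging_map_const: "averaging_map k l (cube k) (\<lambda>_ y. y)"
proof (rule averaging_map.intro)
  interpret Ck: prob_space "cube k" by (rule prob_space_cube)
  interpret Cl: prob_space "cube l" by (rule prob_space_cube)
  interpret pair_prob_space "cube l" "cube k" ..
  show "prob_space (cube k)" by (rule prob_space_cube)
  show "(\<lambda>(_, y). y) \<in> measurable (cube l \<Otimes>\<^sub>M cube k) (cube k)" by simp
  show "distr (cube l \<Otimes>\<^sub>M cube k) (cube k) (\<lambda>(_, y). y) = cube k"
  proof (rule measure_eqI)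
    fix A assume "A \<in> sets (distr (cube l \<Otimes>\<^sub>M cube k) (cube k) (\<lambda>(_, y). y))"
    then have A: "A \<in> sets (cube k)" by simp
    have "(\<lambda>(_, y). y) -` A \<inter> space (cube l \<Otimes>\<^sub>M cube k) = space (cube l) \<times> A"
      using sets.sets_into_space[OF A] by (auto simp: space_pair_measure)
    then show "emeasure (distr (cube l \<Otimes>\<^sub>M cube k) (cube k) (\<lambda>(_, y). y)) A = emeasure (cube k) A"
      using A by (simp add: emeasure_distr Ck.emeasure_pair_measure_Times Cl.emeasure_space_1)
  qed simp
qed

lemma measurable_cube_update:
  assumes "j < k"
  shows "(\<lambda>(x, y). x(j := y)) \<in> measurable (cube k \<Otimes>\<^sub>M I01) (cube k)"
proof -
  have "(\<lambda>z. (fst z)(j := snd z)) \<in> measurable (cube k \<Otimes>\<^sub>M I01) (cube k)"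
    unfolding cube_def by (rule measurable_fun_upd[where J="{..<k}"]) (use assms in auto)
  then show ?thesis by (simp add: case_prod_beta')
qed

lemma averaging_map_update:
  assumes j: "j < k"
  shows "averaging_map k k I01 (\<lambda>x y. x(j := y))"
proof (rule averaging_map.intro)
  interpret I: prob_space I01 by (rule prob_space_I01)
  interpret Ck: prob_space "cube k" by (rule prob_space_cube)
  interpret P: pair_prob_space "cube k" I01 ..
  interpret product_prob_space "\<lambda>_::nat. I01" by (intro product_prob_spaceI prob_space_I01)
  show "prob_space I01" by (rule prob_space_I01)
  show m: "(\<lambda>(x, y). x(j := y)) \<in> measurable (cube k \<Otimes>\<^sub>M I01) (cube k)"
    by (rule measurable_cube_update[OF j])
  have "distr (cube k \<Otimes>\<^sub>M I01) (cube k) (\<lambda>(x, y). x(j := y)) = PiM {..<k} (\<lambda>_. I01)"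
  proof (rule PiM_eqI)
    fix A :: "nat \<Rightarrow> real set" assume A: "\<And>i. i \<in> {..<k} \<Longrightarrow> A i \<in> sets I01"
    \<comment> \<open>The old coordinate \<open>j\<close> of \<open>x\<close> is overwritten, hence
      unconstrained, and the constraint \<open>A j\<close> moves to \<open>y\<close>. Volumes of
      boxes determine the product measure.\<close>
    let ?A = "A(j := {0..1})"
    have A': "A i \<subseteq> {0..1}" if "i < k" for i
      using sets.sets_into_space[OF A, of i] that by simp
    have iff: "x(j := y) \<in> Pi\<^sub>E {..<k} A \<and> x \<in> space (cube k) \<and> y \<in> space I01
        \<longleftrightarrow> x \<in> Pi\<^sub>E {..<k} ?A \<and> y \<in> A j" for x y
    proof -
      have "(x(j := y)) \<in> extensional {..<k} \<longleftrightarrow> x \<in> extensional {..<k}"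
        unfolding extensional_def mem_Collect_eq using j by (metis fun_upd_other lessThan_iff)
      moreover have "(\<forall>i\<in>{..<k}. (x(j := y)) i \<in> A i) \<and> (\<forall>i\<in>{..<k}. x i \<in> {0..1}) \<and> y \<in> {0..1}
          \<longleftrightarrow> (\<forall>i\<in>{..<k}. x i \<in> ?A i) \<and> y \<in> A j"
        (is "?L \<longleftrightarrow> ?R")
      proof
        assume L: ?L
        have "x i \<in> ?A i" if "i < k" for i
          using bspec[OF conjunct1[OF L], of i] L that by (cases "i = j") auto
        moreover have "y \<in> A j" using L j by (metis fun_upd_same lessThan_iff)
        ultimately show ?R by auto
      next
        assume R: ?R
        have "(x(j := y)) i \<in> A i" if "i < k" for i using bspec[OF conjunct1[OF R], of i] R that by (cases "i = j") auto
        moreover have "x i \<in> {0..1}" if "i < k" for i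
          using bspec[OF conjunct1[OF R], of i] A'[OF that] that by (cases "i = j") auto
        ultimately show ?L using R A'[OF j] by blast
      qed
      ultimately show ?thesis unfolding space_cube PiE_iff space_I01 by blast
    qed
    have "(\<lambda>(x, y). x(j := y)) -` Pi\<^sub>E {..<k} A \<inter> space (cube k \<Otimes>\<^sub>M I01)
        = Pi\<^sub>E {..<k} ?A \<times> A j"
    proof (rule set_eqI)
      fix z :: "(nat \<Rightarrow> real) \<times> real"
      show "z \<in> (\<lambda>(x, y). x(j := y)) -` Pi\<^sub>E {..<k} A \<inter> space (cube k \<Otimes>\<^sub>M I01)
          \<longleftrightarrow> z \<in> Pi\<^sub>E {..<k} ?A \<times> A j"
        using iff[of "fst z" "snd z"]
        by (simp add: case_prod_beta' space_pair_measure mem_Times_iff del: space_I01)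
    qed
    then have "emeasure (distr (cube k \<Otimes>\<^sub>M I01) (cube k) (\<lambda>(x, y). x(j := y))) (Pi\<^sub>E {..<k} A)
        = emeasure (cube k \<Otimes>\<^sub>M I01) (Pi\<^sub>E {..<k} ?A \<times> A j)"
      using A by (subst emeasure_distr[OF m]) (auto simp: cube_def intro!: sets_PiM_I_finite)
    also have "\<dots> = emeasure (cube k) (Pi\<^sub>E {..<k} ?A) * emeasure I01 (A j)"
      using A j sets.top[of I01] unfolding cube_def
      by (intro I.emeasure_pair_measure_Times sets_PiM_I_finite) auto
    also have "emeasure (cube k) (Pi\<^sub>E {..<k} ?A) = (\<Prod>i<k. emeasure I01 (?A i))"
      using A sets.top[of I01] unfolding cube_def by (intro emeasure_PiM) auto
    also have "\<dots> = (\<Prod>i\<in>{..<k} - {j}. emeasure I01 (A i))"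
      using j I.emeasure_space_1 by (subst prod.remove[of _ j]) auto
    also have "\<dots> * emeasure I01 (A j) = (\<Prod>i<k. emeasure I01 (A i))"
      using j prod.remove[of "{..<k}" j "\<lambda>i. emeasure I01 (A i)"] by (simp add: mult.commute)
    finally show "emeasure (distr (cube k \<Otimes>\<^sub>M I01) (cube k) (\<lambda>(x, y). x(j := y))) (Pi\<^sub>E {..<k} A)
      = (\<Prod>i\<in>{..<k}. emeasure I01 (A i))" .
  qed (simp_all add: cube_def)
  then show "distr (cube k \<Otimes>\<^sub>M I01) (cube k) (\<lambda>(x, y). x(j := y)) = cube k"
    by (simp add: cube_def)
qed

abbreviation reindex_op :: "real \<Rightarrow> (nat \<Rightarrow> nat) \<Rightarrow> nat \<Rightarrow> tensor \<Rightarrow> tensor" where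
  "reindex_op c p k \<equiv> averaging c (\<lambda>x _. \<lambda>i\<in>{..<k}. x (p i)) (cube 0)"

text \<open>The integrated coordinate survives as a dummy on which the result does not depend, so
  averaging keeps the tensor dimension at \<open>k\<close>.\<close>

abbreviation update_op :: "nat \<Rightarrow> tensor \<Rightarrow> tensor" where
  "update_op j \<equiv> averaging 1 (\<lambda>x y. x(j := y)) I01"

abbreviation mean_op :: "real \<Rightarrow> nat \<Rightarrow> tensor \<Rightarrow> tensor" where
  "mean_op c k \<equiv> averaging c (\<lambda>_ y. y) (cube k)"

lemma reindex_op_apply: "reindex_op c p k U = (\<lambda>x. c * U (\<lambda>i\<in>{..<k}. x (p i)))"
proof -
  interpret prob_space "cube 0" by (rule prob_space_cube)
  show ?thesis by (simp add: averaging_def prob_space)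
qed

lemma reindex_op_LE:
  assumes p: "inj_on p {..<k}" "\<And>i. i < k \<Longrightarrow> p i < l"
  shows "reindex_op c p k \<in> LE k l"
proof -
  interpret averaging_map k l "cube 0" "\<lambda>x _. \<lambda>i\<in>{..<k}. x (p i)"
    by (rule averaging_map_reindex[OF p])
  show ?thesis
  proof (rule averaging_in_LE)
    fix \<phi> :: "real \<Rightarrow> real"
    have "(\<lambda>i\<in>{..<k}. \<phi> ((\<lambda>i\<in>{..<k}. x (p i)) i)) = (\<lambda>i\<in>{..<k}. (\<lambda>i\<in>{..<l}. \<phi> (x i)) (p i))"
      for x :: "nat \<Rightarrow> real"
      using p(2) by (intro restrict_ext) simp
    then show "\<exists>\<psi>. \<psi> \<in> measurable (cube 0) (cube 0) \<and> distr (cube 0) (cube 0) \<psi> = cube 0 \<and>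
      (\<forall>x\<in>space (cube l). \<forall>y\<in>space (cube 0). (\<lambda>i\<in>{..<k}. \<phi> ((\<lambda>i\<in>{..<k}. x (p i)) i))
        = (\<lambda>i\<in>{..<k}. (\<lambda>i\<in>{..<l}. \<phi> (x i)) (p i)))"
      by (intro exI[of _ "\<lambda>y. y"] conjI ballI distr_id2 measurable_ident_sets refl)
  qed
qed

lemma update_op_LE:
  assumes j: "j < k"
  shows "update_op j \<in> LE k k"
proof -
  interpret averaging_map k k I01 "\<lambda>x y. x(j := y)"
    by (rule averaging_map_update[OF j])
  show ?thesis
  proof (rule averaging_in_LE)
    fix \<phi> assume phi: "measure_preserving01 \<phi>"
    have "(\<lambda>i\<in>{..<k}. \<phi> ((x(j := y)) i)) = (\<lambda>i\<in>{..<k}. \<phi> (x i))(j := \<phi> y)" for x y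
      using j by (intro ext) simp
    with phi show "\<exists>\<psi>. \<psi> \<in> measurable I01 I01 \<and> distr I01 I01 \<psi> = I01 \<and>
      (\<forall>x\<in>space (cube k). \<forall>y\<in>space I01.
        (\<lambda>i\<in>{..<k}. \<phi> ((x(j := y)) i)) = (\<lambda>i\<in>{..<k}. \<phi> (x i))(j := \<psi> y))"
      unfolding measure_preserving01_def by blast
  qed
qed

text \<open>The target dimension is arbitrary because the output is constant: \<open>l = 0\<close>
  serves as readout, \<open>k = 0\<close> as constant bias, and \<open>c = 0\<close> as a missing
  connection.\<close>

lemma mean_op_LE: "mean_op c k \<in> LE k l"
proof -
  interpret averaging_map k l "cube k" "\<lambda>_ y. y" by (rule averaging_map_const)
  show ?thesis
  proof (rule averaging_in_LE)
    fix \<phi> assume phi: "measure_preserving01 \<phi>"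
    then have m: "\<phi> \<in> measurable I01 I01" and d: "distr I01 I01 \<phi> = I01"
      by (auto simp: measure_preserving01_def)
    have "distr (cube k) (cube k) (compose {..<k} \<phi>) = cube k"
      unfolding cube_def using distr_PiM_finite_prob_space'[of "{..<k}" "\<lambda>_. I01" "\<lambda>_. I01" \<phi>] m d
      by (simp add: prob_space_I01)
    moreover have "compose {..<k} \<phi> \<in> measurable (cube k) (cube k)"
      unfolding compose_def cube_def using m by measurable
    ultimately show "\<exists>\<psi>. \<psi> \<in> measurable (cube k) (cube k) \<and> distr (cube k) (cube k) \<psi> = cube k \<and>
      (\<forall>x\<in>space (cube l). \<forall>y\<in>space (cube k). (\<lambda>i\<in>{..<k}. \<phi> (y i)) = \<psi> y)"
      by (intro exI[of _ "compose {..<k} \<phi>"]) (auto simp: compose_def)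
  qed
qed


section \<open>Topologies induced by sequences of real functions\<close>

text \<open>
  The initial topology of a sequence of real functions is second countable and completely regular, which
  is all that is used of the colour spaces; no separation is required.
\<close>

definition euclidean_pullback :: "'a topology \<Rightarrow> ('a \<Rightarrow> nat \<Rightarrow> real) \<Rightarrow> bool" where
  "euclidean_pullback X \<Phi> \<longleftrightarrow> continuous_map X euclidean \<Phi> \<and>
     (\<forall>U. openin X U \<longrightarrow> (\<exists>V. open V \<and> U = topspace X \<inter> \<Phi> -` V))"

lemma euclidean_pullback_preimage_topology:
  "istopology (\<lambda>U. \<exists>V. open V \<and> U = S \<inter> \<Phi> -` (V :: 'b::topological_space set))"
proof -
  have "istopology (\<lambda>U. \<exists>V. openin euclidean V \<and> U = \<Phi> -` (V :: 'b set) \<inter> S)"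
    by (rule istopology_pullback_topology)
  then show ?thesis by (simp add: Int_commute)
qed

text \<open>The preimages of open sets under one map form a topology, so a generating family is
  enough to test.\<close>

lemma euclidean_pullback_generated:
  assumes "X = topology_generated_by \<S>" and "continuous_map X euclidean \<Phi>"
    and "\<And>U. U \<in> \<S> \<Longrightarrow> \<exists>V. open V \<and> U = topspace X \<inter> \<Phi> -` V"
  shows "euclidean_pullback X \<Phi>"
  unfolding euclidean_pullback_def
proof (intro conjI allI impI)
  fix U assume "openin X U"
  then have "generate_topology_on \<S> U"
    by (simp add: assms(1) openin_topology_generated_by_iff)
  then show "\<exists>V. open V \<and> U = topspace X \<inter> \<Phi> -` V"
    by (rule generate_topology_on_coarsest[OF euclidean_pullback_preimage_topology, rotated])
      (rule assms(3))
qed (fact assms(2))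

lemma continuous_map_euclidean_coordinatewise:
  "continuous_map X euclidean (\<Phi> :: 'a \<Rightarrow> nat \<Rightarrow> real)
     \<longleftrightarrow> (\<forall>n. continuous_map X euclideanreal (\<lambda>x. \<Phi> x n))"
  by (simp add: euclidean_product_topology[symmetric] continuous_map_componentwise_UNIV)

lemma space_borel_of [simp]: "space (borel_of X) = topspace X"
  unfolding borel_of_def by (rule space_measure_of) (auto dest: openin_subset)

lemma sets_borel_of: "sets (borel_of X) = sigma_sets (topspace X) {U. openin X U}"
  unfolding borel_of_def by (rule sets_measure_of) (auto dest: openin_subset)

text \<open>The Borel sets of \<open>nat \<Rightarrow> real\<close> are generated by the
  coordinates, so measurability into a colour space reduces to that of countably many real
  functions. Every measurability claim about colours rests on this reduction.\<close>

lemma measurable_borel_of_pullback: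
  assumes X: "euclidean_pullback X \<Phi>" and c: "c \<in> space N \<rightarrow> topspace X"
    and coord: "\<And>n. (\<lambda>\<omega>. \<Phi> (c \<omega>) n) \<in> borel_measurable N"
  shows "c \<in> measurable N (borel_of X)"
  unfolding borel_of_def
proof (rule measurable_measure_of)
  show "{U. openin X U} \<subseteq> Pow (topspace X)" by (auto dest: openin_subset)
  have m: "(\<lambda>\<omega>. \<Phi> (c \<omega>)) \<in> borel_measurable N"
    by (rule measurable_coordinatewise_then_product) (rule coord)
  fix U assume "U \<in> {U. openin X U}"
  then obtain V where V: "open V" "U = topspace X \<inter> \<Phi> -` V"
    using X by (auto simp: euclidean_pullback_def)
  have "c -` U \<inter> space N = (\<lambda>\<omega>. \<Phi> (c \<omega>)) -` V \<inter> space N"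
    using c V by auto
  then show "c -` U \<inter> space N \<in> sets N"
    using measurable_sets[OF m] V(1) by simp
qed (fact c)

lemma continuous_map_imp_measurable_borel_of:
  assumes "continuous_map X euclideanreal h"
  shows "h \<in> borel_measurable (borel_of X)"
proof (rule borel_measurableI)
  fix S :: "real set" assume "open S"
  then have "openin X {x \<in> topspace X. h x \<in> S}"
    using assms by (auto simp: continuous_map_def)
  moreover have "{x \<in> topspace X. h x \<in> S} = h -` S \<inter> space (borel_of X)" by auto
  ultimately show "h -` S \<inter> space (borel_of X) \<in> sets (borel_of X)"
    by (auto simp: sets_borel_of intro: sigma_sets.Basic)
qed

lemma euclidean_pullback_top_of_set:
  "euclidean_pullback (top_of_set (S :: real set)) (\<lambda>x n. x)"
  unfolding euclidean_pullback_def continuous_map_euclidean_coordinatewise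
proof (intro conjI allI impI)
  show "continuous_map (top_of_set S) euclidean (\<lambda>x. x)"
    by (simp add: continuous_map_iff_continuous)
  fix U assume "openin (top_of_set S) U"
  then obtain T where T: "open T" "U = S \<inter> T" by (auto simp: openin_open)
  have "open ((\<lambda>z :: nat \<Rightarrow> real. z 0) -` T)"
    using continuous_on_product_coordinates T(1) by (rule open_vimage[rotated])
  then show "\<exists>V. open V \<and> U = topspace (top_of_set S) \<inter> (\<lambda>x n::nat. x) -` V"
    using T by (intro exI[of _ "(\<lambda>z. z 0) -` T"]) auto
qed

text \<open>The coordinate sequences of countably many factors are interleaved into one sequence.
  The default 0 occurs only for empty \<open>I\<close>.\<close>

lemma euclidean_pullback_product:
  fixes X :: "'i \<Rightarrow> 'a topology"
  assumes I: "countable I" and X: "\<And>i. i \<in> I \<Longrightarrow> euclidean_pullback (X i) (\<Phi> i)"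
  shows "euclidean_pullback (product_topology X I) (\<lambda>x n.
     let (j, m) = prod_decode n; i = from_nat_into I j in if i \<in> I then \<Phi> i (x i) m else 0)"
    (is "euclidean_pullback ?P ?F")
proof (rule euclidean_pullback_generated[OF product_topology_def])
  show "continuous_map ?P euclidean ?F"
    unfolding continuous_map_euclidean_coordinatewise
  proof
    fix n
    obtain j m where jm: "prod_decode n = (j, m)" by fastforce
    define i where "i = from_nat_into I j"
    note im = jm i_def[symmetric]
    show "continuous_map ?P euclideanreal (\<lambda>x. ?F x n)"
    proof (cases "i \<in> I")
      case True
      have "continuous_map (X i) euclideanreal (\<lambda>y. \<Phi> i y m)"
        using X[OF True] by (simp add: euclidean_pullback_def continuous_map_euclidean_coordinatewise)
      then have "continuous_map ?P euclideanreal ((\<lambda>y. \<Phi> i y m) \<circ> (\<lambda>x. x i))"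
        by (rule continuous_map_compose[OF continuous_map_product_projection[OF True]])
      then show ?thesis using True by (simp add: im comp_def)
    qed (simp add: im)
  qed
  fix U assume "U \<in> {Pi\<^sub>E I Y |Y. (\<forall>i. openin (X i) (Y i)) \<and> finite {i. Y i \<noteq> topspace (X i)}}"
  then obtain Y where U: "U = Pi\<^sub>E I Y" and Y: "\<And>i. openin (X i) (Y i)"
    and fin: "finite {i. Y i \<noteq> topspace (X i)}" by auto
  define J where "J = {i. Y i \<noteq> topspace (X i)} \<inter> I"
  have "\<exists>V. open V \<and> Y i = topspace (X i) \<inter> \<Phi> i -` V" if "i \<in> I" for i
    using X[OF that] Y[of i] by (simp add: euclidean_pullback_def)
  then obtain V where V: "\<And>i. i \<in> I \<Longrightarrow> open (V i)"
      "\<And>i. i \<in> I \<Longrightarrow> Y i = topspace (X i) \<inter> \<Phi> i -` V i" by metis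
  \<comment> \<open>\<open>R i\<close> recovers from an interleaved sequence the subsequence that
    belongs to the factor \<open>i\<close>. It is continuous, so each of the finitely many
    constraints in \<open>J\<close> becomes an open condition.\<close>
  define R where "R = (\<lambda>(i :: 'i) (z :: nat \<Rightarrow> real) (m :: nat). z (prod_encode (to_nat_on I i, m)))"
  have R: "R i (?F x) = \<Phi> i (x i)" if "i \<in> I" for i x
    using that I by (simp add: R_def fun_eq_iff)
  have "open (\<Inter>i\<in>J. R i -` V i)"
  proof (rule open_INT)
    show "finite J" using fin by (simp add: J_def)
    show "\<forall>i\<in>J. open (R i -` V i)"
    proof
      fix i assume "i \<in> J"
      moreover have "continuous_on UNIV (R i)"
        unfolding R_def by (intro continuous_on_coordinatewise_then_product continuous_on_product_coordinates)
      ultimately show "open (R i -` V i)" using V(1) by (auto simp: J_def intro: open_vimage)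
    qed
  qed
  moreover have "U = topspace ?P \<inter> ?F -` (\<Inter>i\<in>J. R i -` V i)"
  proof (rule set_eqI)
    fix x
    have RJ: "R i (?F x) = \<Phi> i (x i)" if "i \<in> J" for i
      by (rule R) (use that in \<open>simp add: J_def\<close>)
    have "x \<in> topspace ?P \<inter> ?F -` (\<Inter>i\<in>J. R i -` V i)
        \<longleftrightarrow> x \<in> (\<Pi>\<^sub>E i\<in>I. topspace (X i)) \<and> (\<forall>i\<in>J. R i (?F x) \<in> V i)"
      unfolding topspace_product_topology by blast
    also have "\<dots> \<longleftrightarrow> x \<in> (\<Pi>\<^sub>E i\<in>I. topspace (X i)) \<and> (\<forall>i\<in>J. \<Phi> i (x i) \<in> V i)"
      by (rule conj_cong[OF refl], rule ball_cong[OF refl], subst RJ, assumption, rule refl)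
    also have "\<dots> \<longleftrightarrow> x \<in> (\<Pi>\<^sub>E i\<in>I. topspace (X i)) \<and> (\<forall>i\<in>J. x i \<in> Y i)"
    proof (rule conj_cong[OF refl], rule ball_cong[OF refl])
      fix i assume "x \<in> (\<Pi>\<^sub>E i\<in>I. topspace (X i))" "i \<in> J"
      then have "i \<in> I" "x i \<in> topspace (X i)" unfolding J_def by blast+
      then show "\<Phi> i (x i) \<in> V i \<longleftrightarrow> x i \<in> Y i" using V(2)[of i] by blast
    qed
    also have "\<dots> \<longleftrightarrow> x \<in> U"
    proof -
      have "Y i \<subseteq> topspace (X i)" for i using Y by (rule openin_subset)
      moreover have "Y i = topspace (X i)" if "i \<in> I" "i \<notin> J" for i
        using that by (simp add: J_def)
      moreover have "J \<subseteq> I" by (simp add: J_def)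
      ultimately show ?thesis unfolding U PiE_iff by blast
    qed
    finally show "x \<in> U \<longleftrightarrow> x \<in> topspace ?P \<inter> ?F -` (\<Inter>i\<in>J. R i -` V i)" by simp
  qed
  ultimately show "\<exists>V. open V \<and> U = topspace ?P \<inter> ?F -` V" by blast
qed

lemma euclidean_pullback_pullback_topology:
  assumes X: "euclidean_pullback X \<Phi>" and sub: "f ` A \<subseteq> topspace X"
  shows "euclidean_pullback (pullback_topology A f X) (\<lambda>x. \<Phi> (f x))"
  unfolding euclidean_pullback_def
proof (intro conjI allI impI)
  show "continuous_map (pullback_topology A f X) euclidean (\<lambda>x. \<Phi> (f x))"
    using X continuous_map_pullback[of X euclidean \<Phi> A f] by (simp add: euclidean_pullback_def comp_def)
  fix U assume "openin (pullback_topology A f X) U"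
  then obtain U' where U': "openin X U'" "U = f -` U' \<inter> A" by (auto simp: openin_pullback_topology)
  then obtain V where "open V" "U' = topspace X \<inter> \<Phi> -` V"
    using X by (auto simp: euclidean_pullback_def)
  then show "\<exists>V. open V \<and> U = topspace (pullback_topology A f X) \<inter> (\<lambda>x. \<Phi> (f x)) -` V"
    using U'(2) by (intro exI[of _ V]) (auto simp: topspace_pullback_topology)
qed

text \<open>
  Finite maxima of shifted tents with rational data: every bounded lower semicontinuous function
  is the supremum of the ones below it, so their integrals determine the weak topology.
\<close>

definition tent :: "rat \<times> rat \<times> (nat \<Rightarrow> real) \<times> nat \<Rightarrow> (nat \<Rightarrow> real) \<Rightarrow> real" where
  "tent i z = (case i of (q, p, d, m) \<Rightarrow> of_rat q + of_rat p * max 0 (1 - m * dist z d))"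

text \<open>The default 0 at the empty list is harmless: wherever lists are quantified over, they
  are also required to lie below the function in question.\<close>

fun max_tent :: "(rat \<times> rat \<times> (nat \<Rightarrow> real) \<times> nat) list \<Rightarrow> (nat \<Rightarrow> real) \<Rightarrow> real" where
  "max_tent [] z = 0"
| "max_tent [i] z = tent i z"
| "max_tent (i # j # l) z = max (tent i z) (max_tent (j # l) z)"

lemma continuous_tent: "continuous_on UNIV (tent i)"
  unfolding tent_def by (cases i) (auto intro!: continuous_intros)

lemma continuous_max_tent: "continuous_on UNIV (max_tent l)"
proof (induction l rule: induct_list012)
  case (3 i j l)
  have "max_tent (i # j # l) = (\<lambda>z. max (tent i z) (max_tent (j # l) z))" by (rule ext) simp
  then show ?case using 3 continuous_tent[of i] by (auto intro!: continuous_intros)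
next
  case 1
  have "max_tent [] = (\<lambda>z. 0)" by (rule ext) simp
  then show ?case by simp
next
  case (2 i)
  have "max_tent [i] = tent i" by (rule ext) simp
  then show ?case by (simp add: continuous_tent)
qed

lemma max_tent_eq_Max: "l \<noteq> [] \<Longrightarrow> max_tent l z = Max ((\<lambda>i. tent i z) ` set l)"
  by (induction l z rule: max_tent.induct) auto

lemma bounded_tent: "\<bar>tent (q, p, d, m) z\<bar> \<le> \<bar>of_rat q\<bar> + \<bar>of_rat p\<bar>"
proof -
  have "\<bar>max 0 (1 - m * dist z d)\<bar> \<le> (1::real)" by (simp add: max_def)
  then have "\<bar>of_rat p * max 0 (1 - m * dist z d)\<bar> \<le> \<bar>of_rat p\<bar> * (1::real)"
    unfolding abs_mult by (intro mult_left_mono) auto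
  then show ?thesis
    unfolding tent_def prod.case mult_1_right
    by (rule order_trans[OF abs_triangle_ineq add_left_mono])
qed

lemma ex_bounded_tent: "\<exists>B. \<forall>z. \<bar>tent i z\<bar> \<le> B"
  by (cases i) (metis bounded_tent)

lemma bounded_max_tent: "\<exists>B. \<forall>z. \<bar>max_tent l z\<bar> \<le> B"
proof (induction l rule: induct_list012)
  case (2 i)
  show ?case using ex_bounded_tent[of i] by simp
next
  case (3 i j l)
  obtain B where B: "\<And>z. \<bar>max_tent (j # l) z\<bar> \<le> B" using 3 by auto
  obtain B' where B': "\<And>z. \<bar>tent i z\<bar> \<le> B'" using ex_bounded_tent by blast
  have "\<bar>max_tent (i # j # l) z\<bar> \<le> max B B'" for z
    using B[of z] B'[of z] by (auto simp: max_def)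
  then show ?case by blast
qed auto

section \<open>Countably many minorants and the weak topology\<close>

definition dense_sequences :: "(nat \<Rightarrow> real) set" where
  "dense_sequences = (SOME D. countable D \<and> (\<forall>X. open X \<longrightarrow> X \<noteq> {} \<longrightarrow> (\<exists>d\<in>D. d \<in> X)))"

lemma dense_sequences:
  "countable dense_sequences" "open X \<Longrightarrow> X \<noteq> {} \<Longrightarrow> \<exists>d\<in>dense_sequences. d \<in> X"
proof -
  have "\<exists>D :: (nat \<Rightarrow> real) set. countable D \<and> (\<forall>X. open X \<longrightarrow> X \<noteq> {} \<longrightarrow> (\<exists>d\<in>D. d \<in> X))"
    by (rule countable_dense_exists)
  from someI_ex[OF this] show "countable dense_sequences"
    "open X \<Longrightarrow> X \<noteq> {} \<Longrightarrow> \<exists>d\<in>dense_sequences. d \<in> X"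
    unfolding dense_sequences_def by blast+
qed

definition tent_indices :: "(rat \<times> rat \<times> (nat \<Rightarrow> real) \<times> nat) set" where
  "tent_indices = UNIV \<times> UNIV \<times> dense_sequences \<times> UNIV"

lemma countable_tent_indices: "countable tent_indices"
  unfolding tent_indices_def by (intro countable_SIGMA dense_sequences(1)) auto

text \<open>This notion covers both the continuous functions, whose integrals generate the weak
  topology, and the indicators of open sets, whose integrals determine the measure.\<close>

definition lower_semicontinuous_map :: "'a topology \<Rightarrow> ('a \<Rightarrow> real) \<Rightarrow> bool" where
  "lower_semicontinuous_map X h \<longleftrightarrow>
     (\<forall>x\<in>topspace X. \<forall>c<h x. \<exists>G. openin X G \<and> x \<in> G \<and> (\<forall>y\<in>G. c < h y))"

lemma lower_semicontinuous_map_continuous: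
  assumes "continuous_map X euclideanreal h"
  shows "lower_semicontinuous_map X h"
  unfolding lower_semicontinuous_map_def
proof (intro ballI allI impI)
  fix x c assume x: "x \<in> topspace X" "c < h x"
  have "openin X {y \<in> topspace X. h y \<in> {c<..}}"
    using open_greaterThan by (intro openin_continuous_map_preimage[OF assms]) simp
  then show "\<exists>G. openin X G \<and> x \<in> G \<and> (\<forall>y\<in>G. c < h y)"
    using x by (intro exI[of _ "{y \<in> topspace X. h y \<in> {c<..}}"]) simp
qed

lemma lower_semicontinuous_map_indicator:
  assumes "openin X G"
  shows "lower_semicontinuous_map X (indicator G :: _ \<Rightarrow> real)"
  unfolding lower_semicontinuous_map_def
proof (intro ballI allI impI)
  fix x and c :: real assume x: "x \<in> topspace X" "c < indicator G x"
  show "\<exists>G'. openin X G' \<and> x \<in> G' \<and> (\<forall>y\<in>G'. c < indicator G y)"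
  proof (cases "x \<in> G")
    case True
    then show ?thesis using assms x by (intro exI[of _ G]) simp
  next
    case False
    then have "c < 0" using x by simp
    then show ?thesis
      using x by (intro exI[of _ "topspace X"]) (auto simp: indicator_def)
  qed
qed

lemma tent_below_lower_semicontinuous:
  assumes X: "euclidean_pullback X \<Phi>" and h: "lower_semicontinuous_map X h"
    and B: "\<And>y. y \<in> topspace X \<Longrightarrow> B \<le> h y" and x: "x \<in> topspace X" "c < h x"
  obtains i where "i \<in> tent_indices" "c < tent i (\<Phi> x)" "\<And>y. y \<in> topspace X \<Longrightarrow> tent i (\<Phi> y) \<le> h y"
proof -
  obtain a :: rat where a: "c < of_rat a" "of_rat a < h x" using of_rat_dense[OF x(2)] by blast
  obtain G where G: "openin X G" "x \<in> G" "\<And>y. y \<in> G \<Longrightarrow> of_rat a < h y"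
    using h[unfolded lower_semicontinuous_map_def, rule_format, OF x(1) a(2)] by metis
  obtain V where V: "open V" "G = topspace X \<inter> \<Phi> -` V"
    using X G(1) unfolding euclidean_pullback_def by blast
  have "\<Phi> x \<in> V" using V(2) G(2) by blast
  then obtain e where e: "e > 0" "ball (\<Phi> x) e \<subseteq> V"
    using V(1) open_contains_ball by blast
  \<comment> \<open>The tent has floor \<open>q\<close>, below the global bound \<open>B\<close>,
    and peak \<open>a\<close>, which \<open>h\<close> exceeds on \<open>G\<close>; its height is
    therefore \<open>p = a - q\<close>.\<close>
  have "min B (of_rat a) - 1 < min B (of_rat a)" by linarith
  from of_rat_dense[OF this] obtain q :: rat where q: "of_rat q < min B (of_rat a)" by blast
  define p where "p = a - q"
  have p: "of_rat p > (0::real)" "of_rat q + of_rat p = (of_rat a :: real)"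
    using q by (auto simp: p_def of_rat_diff)
  obtain m :: nat where m: "2 / e < m" using reals_Archimedean2 by blast
  have m0: "m > 0" using m e(1) by (metis divide_pos_pos less_trans of_nat_0_less_iff zero_less_numeral)
  \<comment> \<open>The first bound keeps the support of the bump, of radius \<open>1 / m\<close>
    about \<open>d\<close>, inside the ball of radius \<open>e\<close>, since
    \<open>2 / m < e\<close>. The second keeps the loss \<open>p * m * dist (\<Phi> x) d\<close> at
    \<open>x\<close> below \<open>a - c\<close>.\<close>
  define \<delta> where "\<delta> = min (1 / m) ((of_rat a - c) / (of_rat p * m))"
  have "\<delta> > 0" using p a m0 by (simp add: \<delta>_def)
  then have "ball (\<Phi> x) \<delta> \<noteq> {}" by simp
  then obtain d where d: "d \<in> dense_sequences" "dist (\<Phi> x) d < \<delta>"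
    using dense_sequences(2)[OF open_ball, of "\<Phi> x" \<delta>] by (metis mem_ball)
  let ?i = "(q, p, d, m)"
  show thesis
  proof (rule that)
    show "?i \<in> tent_indices" using d(1) by (simp add: tent_indices_def)
    have "dist (\<Phi> x) d < (of_rat a - c) / (of_rat p * m)" using d(2) by (simp add: \<delta>_def)
    then have "dist (\<Phi> x) d * (of_rat p * m) < of_rat a - c"
      using p(1) m0 by (subst (asm) pos_less_divide_eq) simp_all
    moreover have "of_rat p * (1 - m * dist (\<Phi> x) d) \<le> of_rat p * max 0 (1 - m * dist (\<Phi> x) d)"
      using p(1) by (intro mult_left_mono) auto
    ultimately show "c < tent ?i (\<Phi> x)"
      using p(2) by (simp add: tent_def algebra_simps)
  next
    fix y assume y: "y \<in> topspace X"
    show "tent ?i (\<Phi> y) \<le> h y"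
    proof (cases "y \<in> G")
      case True
      have "max 0 (1 - m * dist (\<Phi> y) d) \<le> 1" by simp
      then have "of_rat p * max 0 (1 - m * dist (\<Phi> y) d) \<le> of_rat p * 1"
        using p(1) by (intro mult_left_mono) auto
      then show ?thesis using p(2) G(3)[OF True] by (simp add: tent_def)
    next
      case False
      then have "\<Phi> y \<notin> ball (\<Phi> x) e" using y V(2) e(2) by blast
      then have "e \<le> dist (\<Phi> x) (\<Phi> y)" by simp
      moreover have "dist (\<Phi> x) (\<Phi> y) \<le> dist (\<Phi> x) d + dist (\<Phi> y) d" by (rule dist_triangle2)
      moreover have "dist (\<Phi> x) d < 1 / m" using d(2) by (simp add: \<delta>_def)
      moreover have "2 / m < e" using m m0 e(1) by (simp add: field_simps)
      ultimately have "1 / m < dist (\<Phi> y) d" by (simp add: field_simps)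
      then have "1 < m * dist (\<Phi> y) d" using m0 by (simp add: field_simps)
      then have "tent ?i (\<Phi> y) = of_rat q" by (simp add: tent_def)
      then show ?thesis using q B[OF y] by simp
    qed
  qed
qed

lemma continuous_map_max_tent:
  assumes "euclidean_pullback X \<Phi>"
  shows "continuous_map X euclideanreal (\<lambda>x. max_tent l (\<Phi> x))"
proof -
  have "continuous_map euclidean euclideanreal (max_tent l)"
    using continuous_max_tent by (simp add: continuous_map_iff_continuous2)
  then show ?thesis
    using assms continuous_map_compose[of X euclidean \<Phi> euclideanreal "max_tent l"]
    by (simp add: euclidean_pullback_def comp_def)
qed

lemma borel_probsD:
  assumes "\<mu> \<in> borel_probs X"
  shows "prob_space \<mu>" "sets \<mu> = sets (borel_of X)" "space \<mu> = topspace X"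
  using assms sets_eq_imp_space_eq[of \<mu> "borel_of X"] by (auto simp: borel_probs_def)

text \<open>\<open>h\<close> is the limit of an increasing sequence of maxima of tents below it, and
  dominated convergence applies. The index set \<open>lists tent_indices\<close> is countable and
  depends on neither \<open>h\<close> nor \<open>\<mu>\<close>, so countably many integrals control
  the integrals of all such \<open>h\<close>.\<close>

lemma lower_semicontinuous_integral_gt:
  assumes X: "euclidean_pullback X \<Phi>" and h: "lower_semicontinuous_map X h"
    and B: "\<And>y. y \<in> topspace X \<Longrightarrow> \<bar>h y\<bar> \<le> B" and mu: "\<mu> \<in> borel_probs X"
  shows "a < (\<integral>x. h x \<partial>\<mu>) \<longleftrightarrow> (\<exists>l\<in>lists tent_indices.
     (\<forall>y\<in>topspace X. max_tent l (\<Phi> y) \<le> h y) \<and> a < (\<integral>x. max_tent l (\<Phi> x) \<partial>\<mu>))"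
proof -
  interpret prob_space \<mu> by (rule borel_probsD(1)[OF mu])
  note sp = borel_probsD(3)[OF mu]
  have cm: "(\<lambda>x. max_tent l (\<Phi> x)) \<in> borel_measurable \<mu>" for l
    using continuous_map_imp_measurable_borel_of[OF continuous_map_max_tent[OF X]]
      measurable_cong_sets[OF borel_probsD(2)[OF mu] refl] by blast
  have lb: "-B \<le> h y" if "y \<in> topspace X" for y using B[OF that] by simp
  define I where "I = {i \<in> tent_indices. \<forall>y\<in>topspace X. tent i (\<Phi> y) \<le> h y}"
  have cI: "countable I" unfolding I_def by (rule countable_subset[OF _ countable_tent_indices]) auto
  have sup: "\<exists>i\<in>I. c < tent i (\<Phi> y)" if "y \<in> topspace X" "c < h y" for y c
  proof (rule tent_below_lower_semicontinuous[OF X h lb that])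
    fix i assume i: "i \<in> tent_indices" "c < tent i (\<Phi> y)" "\<And>y. y \<in> topspace X \<Longrightarrow> tent i (\<Phi> y) \<le> h y"
    then have "i \<in> I" by (simp add: I_def)
    with i(2) show ?thesis by blast
  qed
  obtain y0 where "y0 \<in> topspace X" using not_empty unfolding sp by blast
  then have "I \<noteq> {}" using sup[of y0 "h y0 - 1"] by auto
  define ix where "ix = from_nat_into I"
  have ix: "range ix = I" unfolding ix_def by (rule range_from_nat_into[OF \<open>I \<noteq> {}\<close> cI])
  \<comment> \<open>\<open>Suc n\<close> keeps the list nonempty, so that \<open>max_tent\<close> is
    a genuine maximum and not its default.\<close>
  define s where "s = (\<lambda>n y. max_tent (map ix [0..<Suc n]) (\<Phi> y))"
  have s: "s n y = Max ((\<lambda>m. tent (ix m) (\<Phi> y)) ` {..n})" for n y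
  proof -
    have "set [0..<Suc n] = {..n}" by auto
    then show ?thesis unfolding s_def
      by (subst max_tent_eq_Max) (simp_all only: set_map image_image map_is_Nil_conv upt_eq_Nil_conv, simp_all)
  qed
  have tent_le: "tent (ix m) (\<Phi> y) \<le> h y" if "y \<in> topspace X" for m y
    using ix that unfolding I_def by blast
  have s_le: "s n y \<le> h y" if "y \<in> topspace X" for n y
    unfolding s using tent_le[OF that] by (subst Max_le_iff) auto
  have s_ge: "tent (ix m) (\<Phi> y) \<le> s n y" if "m \<le> n" for m n y
    unfolding s using that by (intro Max_ge) auto
  have lim: "(\<lambda>n. s n y) \<longlonglongrightarrow> h y" if y: "y \<in> topspace X" for y
  proof (rule order_tendstoI)
    fix c assume "c < h y"
    then obtain i where "i \<in> I" "c < tent i (\<Phi> y)" using sup[OF y] by blast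
    then obtain m where m: "c < tent (ix m) (\<Phi> y)" using ix by (metis rangeE)
    show "eventually (\<lambda>n. c < s n y) sequentially"
      using eventually_ge_at_top[of m] by eventually_elim (use m s_ge in \<open>fastforce intro: less_le_trans\<close>)
  next
    fix c assume "h y < c"
    then show "eventually (\<lambda>n. s n y < c) sequentially"
      using s_le[OF y] by (intro always_eventually allI) (rule le_less_trans)
  qed
  have s_meas: "s n \<in> borel_measurable \<mu>" for n unfolding s_def by (rule cm)
  have h_meas: "h \<in> borel_measurable \<mu>"
    by (rule borel_measurable_LIMSEQ_real[where u=s, OF _ s_meas]) (simp add: lim sp)
  have h_int: "integrable \<mu> h"
    using B by (intro integrable_const_bound[OF _ h_meas, of B] AE_I2) (simp add: sp)
  \<comment> \<open>Every \<open>s n\<close> lies between the tent with index 0 and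
    \<open>h\<close>, so one constant dominates the whole sequence.\<close>
  obtain B0 where B0: "\<And>z. \<bar>max_tent [ix 0] z\<bar> \<le> B0" using bounded_max_tent by blast
  have s_bd: "\<bar>s n y\<bar> \<le> max B B0" if "y \<in> topspace X" for n y
    using s_le[OF that, of n] s_ge[of 0 n y] B[OF that] B0[of "\<Phi> y"] by (auto simp: max_def)
  have conv: "(\<lambda>n. \<integral>x. s n x \<partial>\<mu>) \<longlonglongrightarrow> (\<integral>x. h x \<partial>\<mu>)"
    by (rule integral_dominated_convergence[OF h_meas s_meas, of "\<lambda>_. max B B0"])
      (use lim s_bd in \<open>auto intro!: AE_I2 simp: sp\<close>)
  show ?thesis
  proof
    assume "a < (\<integral>x. h x \<partial>\<mu>)"
    then have "eventually (\<lambda>n. a < (\<integral>x. s n x \<partial>\<mu>)) sequentially"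
      by (rule order_tendstoD(1)[OF conv])
    then obtain n where n: "a < (\<integral>x. s n x \<partial>\<mu>)" by (auto simp: eventually_sequentially)
    have "ix m \<in> tent_indices" for m using ix unfolding I_def by blast
    then have "map ix [0..<Suc n] \<in> lists tent_indices" by auto
    then show "\<exists>l\<in>lists tent_indices. (\<forall>y\<in>topspace X. max_tent l (\<Phi> y) \<le> h y) \<and>
        a < (\<integral>x. max_tent l (\<Phi> x) \<partial>\<mu>)"
      using n s_le unfolding s_def by blast
  next
    assume "\<exists>l\<in>lists tent_indices. (\<forall>y\<in>topspace X. max_tent l (\<Phi> y) \<le> h y) \<and>
        a < (\<integral>x. max_tent l (\<Phi> x) \<partial>\<mu>)"
    then obtain l where l: "\<And>y. y \<in> topspace X \<Longrightarrow> max_tent l (\<Phi> y) \<le> h y"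
        "a < (\<integral>x. max_tent l (\<Phi> x) \<partial>\<mu>)" by blast
    obtain B1 where B1: "\<And>z. \<bar>max_tent l z\<bar> \<le> B1" using bounded_max_tent by blast
    have "integrable \<mu> (\<lambda>x. max_tent l (\<Phi> x))"
      by (rule integrable_const_bound[where B=B1, OF _ cm]) (simp add: B1)
    then have "(\<integral>x. max_tent l (\<Phi> x) \<partial>\<mu>) \<le> (\<integral>x. h x \<partial>\<mu>)"
      using h_int l(1) by (intro integral_mono) (simp_all add: sp)
    then show "a < (\<integral>x. h x \<partial>\<mu>)" using l(2) by simp
  qed
qed

lemma topspace_weak_topology: "topspace (weak_topology X) = borel_probs X"
proof -
  have "borel_probs X \<in> {{\<mu> \<in> borel_probs X. (\<integral>x. h x \<partial>\<mu>) \<in> A} | h A.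
        continuous_map X euclideanreal h \<and> bounded (h ` topspace X) \<and> open A}"
    by (intro CollectI exI[of _ "\<lambda>_. 0"] exI[of _ UNIV]) (auto simp: image_constant_conv)
  then show ?thesis unfolding weak_topology_def topology_generated_by_topspace by blast
qed

text \<open>Both conclusions rest on \<open>gt\<close>, which reads from the values
  \<open>?\<Psi> \<mu> n\<close> whether an integral exceeds a bound. Applied to \<open>h\<close>
  and \<open>- h\<close> it describes the topology; applied to indicators of open sets it gives
  injectivity.\<close>

lemma euclidean_pullback_weak_topology:
  assumes X: "euclidean_pullback X \<Phi>"
  shows "\<exists>g. (\<forall>n. continuous_map X euclideanreal (g n)) \<and> (\<forall>n. \<exists>B. \<forall>x. \<bar>g n x\<bar> \<le> B) \<and>
    euclidean_pullback (weak_topology X) (\<lambda>\<mu> n. \<integral>x. g n x \<partial>\<mu>) \<and>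
    inj_on (\<lambda>\<mu> n. \<integral>x. g n x \<partial>\<mu>) (borel_probs X)"
proof -
  define L where "L = lists tent_indices"
  have cL: "countable L" unfolding L_def by (rule countable_lists[OF countable_tent_indices])
  have "L \<noteq> {}" unfolding L_def by (metis empty_iff lists.Nil)
  define g where "g = (\<lambda>n x. max_tent (from_nat_into L n) (\<Phi> x))"
  have Lg: "(\<exists>l\<in>L. P (\<lambda>x. max_tent l (\<Phi> x))) \<longleftrightarrow> (\<exists>n. P (g n))" for P
    unfolding g_def using range_from_nat_into[OF \<open>L \<noteq> {}\<close> cL] by (metis rangeE rangeI)
  let ?\<Psi> = "\<lambda>\<mu> n. \<integral>x. g n x \<partial>\<mu>"
  have gt: "a < (\<integral>x. h x \<partial>\<mu>) \<longleftrightarrow> (\<exists>n. (\<forall>y\<in>topspace X. g n y \<le> h y) \<and> a < ?\<Psi> \<mu> n)"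
    if "lower_semicontinuous_map X h" "\<And>y. y \<in> topspace X \<Longrightarrow> \<bar>h y\<bar> \<le> B" "\<mu> \<in> borel_probs X"
    for h B \<mu> a
    using lower_semicontinuous_integral_gt[OF X that]
      Lg[of "\<lambda>f. (\<forall>y\<in>topspace X. f y \<le> h y) \<and> a < (\<integral>x. f x \<partial>\<mu>)"]
    unfolding L_def by blast
  show ?thesis
  proof (intro exI[of _ g] conjI allI)
    show g_cont: "continuous_map X euclideanreal (g n)" for n
      unfolding g_def by (rule continuous_map_max_tent[OF X])
    show g_bd: "\<exists>B. \<forall>x. \<bar>g n x\<bar> \<le> B" for n
      unfolding g_def using bounded_max_tent by blast
    show "euclidean_pullback (weak_topology X) ?\<Psi>"
    proof (rule euclidean_pullback_generated[OF weak_topology_def])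
      show "continuous_map (weak_topology X) euclidean ?\<Psi>"
        unfolding continuous_map_euclidean_coordinatewise
      proof
        fix n
        have "bounded (g n ` topspace X)"
          using g_bd[of n] by (auto simp: bounded_iff)
        then have "openin (weak_topology X) {\<mu> \<in> borel_probs X. ?\<Psi> \<mu> n \<in> A}" if "open A" for A
          unfolding weak_topology_def using that g_cont[of n] 
          by (intro topology_generated_by_Basis) blast
        then show "continuous_map (weak_topology X) euclideanreal (\<lambda>\<mu>. ?\<Psi> \<mu> n)"
          by (simp add: continuous_map_def topspace_weak_topology)
      qed
      fix U assume "U \<in> {{\<mu> \<in> borel_probs X. (\<integral>x. h x \<partial>\<mu>) \<in> A} | h A.
        continuous_map X euclideanreal h \<and> bounded (h ` topspace X) \<and> open A}"
      then obtain h A where U: "U = {\<mu> \<in> borel_probs X. (\<integral>x. h x \<partial>\<mu>) \<in> A}"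
        and h: "continuous_map X euclideanreal h" "bounded (h ` topspace X)" and A: "open A" by blast
      obtain B where B: "\<And>y. y \<in> topspace X \<Longrightarrow> \<bar>h y\<bar> \<le> B"
        using h(2) by (auto simp: bounded_iff)
      \<comment> \<open>The open condition on sequences that encodes
        \<open>a < (\<integral>x. h x \<partial>\<mu>)\<close>: some listed minorant of
        \<open>h\<close> already has integral above \<open>a\<close>.\<close>
      define V where "V = (\<lambda>h a. \<Union>n\<in>{n. \<forall>y\<in>topspace X. g n y \<le> h y}. {z :: nat \<Rightarrow> real. a < z n})"
      have oV: "open (V h' a)" for h' a
        unfolding V_def
        by (intro open_UN ballI open_Collect_less continuous_intros continuous_on_product_coordinates)
      have gt1: "a < (\<integral>x. h x \<partial>\<mu>) \<longleftrightarrow> ?\<Psi> \<mu> \<in> V h a" if "\<mu> \<in> borel_probs X" for \<mu> a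
        using gt[OF lower_semicontinuous_map_continuous[OF h(1)] B that] unfolding V_def by blast
      have h': "continuous_map X euclideanreal (\<lambda>x. - h x)" using h(1) by (rule continuous_map_minus)
      have gt2: "(\<integral>x. h x \<partial>\<mu>) < a \<longleftrightarrow> ?\<Psi> \<mu> \<in> V (\<lambda>x. - h x) (- a)" if "\<mu> \<in> borel_probs X" for \<mu> a
      proof -
        have "(\<integral>x. h x \<partial>\<mu>) < a \<longleftrightarrow> - a < (\<integral>x. - h x \<partial>\<mu>)" by simp
        also have "\<dots> \<longleftrightarrow> ?\<Psi> \<mu> \<in> V (\<lambda>x. - h x) (- a)"
          using gt[OF lower_semicontinuous_map_continuous[OF h'] _ that, of B] B unfolding V_def by simp
        finally show ?thesis .
      qed
      \<comment> \<open>An open \<open>A\<close> is the union of the open intervals inside it; the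
        upper endpoint is tested through \<open>- h\<close>.\<close>
      define VA where "VA = (\<Union>(a, b)\<in>{(a, b). {a<..<b} \<subseteq> A}. V h a \<inter> V (\<lambda>x. - h x) (- b))"
      have "open VA" unfolding VA_def by (intro open_UN ballI) (auto intro!: open_Int oV)
      moreover have "(\<integral>x. h x \<partial>\<mu>) \<in> A \<longleftrightarrow> ?\<Psi> \<mu> \<in> VA" if mu: "\<mu> \<in> borel_probs X" for \<mu>
      proof -
        have "(\<integral>x. h x \<partial>\<mu>) \<in> A \<longleftrightarrow> (\<exists>a b. {a<..<b} \<subseteq> A \<and> a < (\<integral>x. h x \<partial>\<mu>) \<and> (\<integral>x. h x \<partial>\<mu>) < b)"
        proof
          assume "(\<integral>x. h x \<partial>\<mu>) \<in> A"
          then obtain e where "e > 0" "ball (\<integral>x. h x \<partial>\<mu>) e \<subseteq> A" using A open_contains_ball by blast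
          then show "\<exists>a b. {a<..<b} \<subseteq> A \<and> a < (\<integral>x. h x \<partial>\<mu>) \<and> (\<integral>x. h x \<partial>\<mu>) < b"
            by (intro exI[of _ "(\<integral>x. h x \<partial>\<mu>) - e"] exI[of _ "(\<integral>x. h x \<partial>\<mu>) + e"])
              (simp add: ball_eq_greaterThanLessThan)
        qed auto
        also have "\<dots> \<longleftrightarrow> ?\<Psi> \<mu> \<in> VA"
          unfolding VA_def gt1[OF mu] gt2[OF mu] by blast
        finally show ?thesis .
      qed
      ultimately show "\<exists>V. open V \<and> U = topspace (weak_topology X) \<inter> ?\<Psi> -` V"
        unfolding U topspace_weak_topology by (intro exI[of _ VA]) blast
    qed
    show "inj_on ?\<Psi> (borel_probs X)"
    proof (rule inj_onI)
      fix \<mu> \<nu> assume mu: "\<mu> \<in> borel_probs X" and nu: "\<nu> \<in> borel_probs X" and eq: "?\<Psi> \<mu> = ?\<Psi> \<nu>"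
      have eq': "(\<integral>x. g n x \<partial>\<mu>) = (\<integral>x. g n x \<partial>\<nu>)" for n
        using fun_cong[OF eq, of n] .
      interpret M: prob_space \<mu> by (rule borel_probsD(1)[OF mu])
      interpret N: prob_space \<nu> by (rule borel_probsD(1)[OF nu])
      \<comment> \<open>Open sets form an intersection-stable generator, and their indicators are
        lower semicontinuous, so their measures can be read from the sequence of integrals.\<close>
      show "\<mu> = \<nu>"
      proof (rule measure_eqI_generator_eq[where \<Omega> = "topspace X" and E = "{U. openin X U}"
            and A = "\<lambda>_. topspace X"])
        show "Int_stable {U. openin X U}" by (auto simp: Int_stable_def)
        show "sets \<mu> = sigma_sets (topspace X) {U. openin X U}"
          "sets \<nu> = sigma_sets (topspace X) {U. openin X U}"
          using borel_probsD(2)[OF mu] borel_probsD(2)[OF nu] by (simp_all add: sets_borel_of)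
        show "{U. openin X U} \<subseteq> Pow (topspace X)" by (auto dest: openin_subset)
        fix G assume "G \<in> {U. openin X U}"
        then have G: "openin X G" by simp
        then have Gs: "G \<in> sets \<mu>" "G \<in> sets \<nu>"
          using borel_probsD(2)[OF mu] borel_probsD(2)[OF nu]
          by (simp_all add: sets_borel_of sigma_sets.Basic)
        have b: "\<And>y. y \<in> topspace X \<Longrightarrow> \<bar>indicator G y :: real\<bar> \<le> 1" by (simp add: indicator_def)
        have "a < (\<integral>x. indicator G x \<partial>\<mu>) \<longleftrightarrow> a < (\<integral>x. indicator G x \<partial>\<nu>)" for a :: real
        proof -
          have "a < (\<integral>x. indicator G x \<partial>\<mu>) \<longleftrightarrow>
              (\<exists>n. (\<forall>y\<in>topspace X. g n y \<le> indicator G y) \<and> a < (\<integral>x. g n x \<partial>\<mu>))"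
            by (rule gt[OF lower_semicontinuous_map_indicator[OF G] b mu])
          also have "\<dots> \<longleftrightarrow> (\<exists>n. (\<forall>y\<in>topspace X. g n y \<le> indicator G y) \<and> a < (\<integral>x. g n x \<partial>\<nu>))"
            by (simp only: eq')
          also have "\<dots> \<longleftrightarrow> a < (\<integral>x. indicator G x \<partial>\<nu>)"
            by (rule gt[OF lower_semicontinuous_map_indicator[OF G] b nu, symmetric])
          finally show ?thesis .
        qed
        then have "(\<integral>x. indicator G x \<partial>\<mu>) = (\<integral>x. indicator G x \<partial>\<nu> :: real)"
          by (meson less_irrefl linorder_neqE)
        then have "measure \<mu> G = measure \<nu> G"
          using Gs by simp
        then show "emeasure \<mu> G = emeasure \<nu> G"
          by (simp add: M.emeasure_eq_measure N.emeasure_eq_measure)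
      qed simp_all
    qed
  qed
qed

section \<open>Codes of measures\<close>

lemma inj_sequences_real: "\<exists>e :: (nat \<Rightarrow> real) \<Rightarrow> real. inj e"
proof -
  obtain b :: "real \<Rightarrow> nat set" where b: "bij b"
    using nat_sets_eqpoll_reals eqpoll_sym unfolding eqpoll_def by blast
  obtain b' :: "nat set \<Rightarrow> real" where b': "bij b'"
    using nat_sets_eqpoll_reals unfolding eqpoll_def by blast
  define e where "e = (\<lambda>z. b' (prod_encode ` {(n, m). m \<in> b (z n)}))"
  have "inj e"
  proof (rule injI)
    fix z z' assume "e z = e z'"
    then have "prod_encode ` {(n, m). m \<in> b (z n)} = prod_encode ` {(n, m). m \<in> b (z' n)}"
      unfolding e_def using b' by (simp add: bij_def inj_eq)
    then have eq: "{(n, m). m \<in> b (z n)} = {(n, m). m \<in> b (z' n)}"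
      by (simp only: inj_image_eq_iff[OF inj_prod_encode])
    have "m \<in> b (z n) \<longleftrightarrow> m \<in> b (z' n)" for n m
      using arg_cong[OF eq, of "\<lambda>S. (n, m) \<in> S"] by simp
    then have "b (z n) = b (z' n)" for n by blast
    then have "z n = z' n" for n using b by (simp add: bij_def inj_eq)
    then show "z = z'" by (rule ext)
  qed
  then show ?thesis by blast
qed

text \<open>A measure is determined by its sequence of integrals, and sequences inject into the
  reals; hence the choice in \<open>code_of\<close> has a witness.\<close>

lemma inj_on_code_of:
  assumes X: "euclidean_pullback X \<Phi>"
  shows "inj_on (code_of X) (borel_probs X)"
proof -
  obtain g :: "nat \<Rightarrow> color \<Rightarrow> real" where g: "inj_on (\<lambda>\<mu> n. \<integral>x. g n x \<partial>\<mu>) (borel_probs X)"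
    using euclidean_pullback_weak_topology[OF X] by (elim exE conjE)
  obtain e :: "(nat \<Rightarrow> real) \<Rightarrow> real" where e: "inj e" using inj_sequences_real by blast
  have "inj_on (e \<circ> (\<lambda>\<mu> n. \<integral>x. g n x \<partial>\<mu>)) (borel_probs X)"
    by (rule comp_inj_on[OF g inj_on_subset[OF e subset_UNIV]])
  then show ?thesis unfolding code_of_def by (rule someI[of "\<lambda>e. inj_on e (borel_probs X)"])
qed

text \<open>The coordinates of a code are integrals against the decoded measure. Continuity and
  boundedness of \<open>g n\<close> are recorded because \<open>g n\<close> will be composed with
  colourings and must then yield bounded measurable functions.\<close>

lemma euclidean_pullback_prob_topology:
  assumes X: "euclidean_pullback X \<Phi>"
  shows "\<exists>g. (\<forall>n. continuous_map X euclideanreal (g n)) \<and> (\<forall>n. \<exists>B. \<forall>x. \<bar>g n x\<bar> \<le> B) \<and>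
    euclidean_pullback (prob_topology X)
      (\<lambda>t n. \<integral>x. g n x \<partial>the_inv_into (borel_probs X) (code_of X) t)"
proof -
  obtain g where g: "\<forall>n. continuous_map X euclideanreal (g n)" "\<forall>n. \<exists>B. \<forall>x. \<bar>g n x\<bar> \<le> B"
    "euclidean_pullback (weak_topology X) (\<lambda>\<mu> n. \<integral>x. g n x \<partial>\<mu>)"
    using euclidean_pullback_weak_topology[OF X] by (elim exE conjE)
  have "the_inv_into (borel_probs X) (code_of X) ` code_of X ` borel_probs X \<subseteq> topspace (weak_topology X)"
    using the_inv_into_f_f[OF inj_on_code_of[OF X]] by (auto simp: topspace_weak_topology)
  from euclidean_pullback_pullback_topology[OF g(3) this] show ?thesis
    unfolding prob_topology_def using g(1,2) by (intro exI[of _ g] conjI)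
qed

lemma topspace_prob_topology:
  assumes X: "euclidean_pullback X \<Phi>"
  shows "topspace (prob_topology X) = code_of X ` borel_probs X"
  using the_inv_into_f_f[OF inj_on_code_of[OF X]]
  by (auto simp: prob_topology_def topspace_pullback_topology topspace_weak_topology)

lemma countable_coords: "countable (edge_coords k)" "countable (vertex_coords k)"
proof -
  have "finite {e. e \<subseteq> {..<k} \<and> card e = 2}"
    by (rule finite_subset[of _ "Pow {..<k}"]) auto
  then show "countable (edge_coords k)" unfolding edge_coords_def by (intro countable_finite finite_imageI)
  show "countable (vertex_coords k)" unfolding vertex_coords_def by (intro countable_finite) simp
qed

text \<open>Strong induction, since the measures of one round live on the product of all earlier
  rounds.\<close>

lemma ex_euclidean_pullback_P_space: "\<exists>\<Phi>. euclidean_pullback (P_space k r s) \<Phi>"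
proof (induction s rule: less_induct)
  case (less s)
  show ?case
  proof (cases s)
    case 0
    have "\<exists>\<Phi>. euclidean_pullback (case_coord (\<lambda>_. top_of_set {0..1}) (\<lambda>_. top_of_set {-r..r}) c) \<Phi>" for c
      using euclidean_pullback_top_of_set by (cases c) auto
    then obtain \<Phi> where "\<And>c. euclidean_pullback (case_coord (\<lambda>_. top_of_set {0..1}) (\<lambda>_. top_of_set {-r..r}) c) (\<Phi> c)"
      by metis
    then show ?thesis unfolding 0 P_space.simps
      by (intro exI) (rule euclidean_pullback_product, simp_all add: countable_coords)
  next
    case (Suc s')
    obtain \<Phi> where "\<And>i. i \<in> {..s'} \<Longrightarrow> euclidean_pullback (P_space k r i) (\<Phi> i)"
      using less.IH Suc by (metis atMost_iff le_imp_less_Suc)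
    then have "\<exists>\<Psi>. euclidean_pullback (product_topology (P_space k r) {..s'}) \<Psi>"
      by (intro exI) (rule euclidean_pullback_product, simp_all)
    then obtain \<Psi> where "euclidean_pullback (product_topology (P_space k r) {..s'}) \<Psi>" ..
    from euclidean_pullback_prob_topology[OF this]
    have "\<exists>\<Psi>. euclidean_pullback (prob_topology (product_topology (P_space k r) {..s'})) \<Psi>" by blast
    then show ?thesis unfolding Suc P_space.simps
      by (elim exE, intro exI) (rule euclidean_pullback_product, simp_all add: countable_coords)
  qed
qed


section \<open>Sums of ridge functions\<close>

text \<open>What one further layer can do to a single channel: affine preactivations, the
  nonlinearity, a linear combination.\<close>

inductive ridge_sum :: "(real \<Rightarrow> real) \<Rightarrow> (real \<Rightarrow> real) \<Rightarrow> bool" for \<rho> where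
  unit: "ridge_sum \<rho> (\<lambda>t. c * \<rho> (a * t + b))"
| add: "ridge_sum \<rho> p \<Longrightarrow> ridge_sum \<rho> q \<Longrightarrow> ridge_sum \<rho> (\<lambda>t. p t + q t)"

definition ridge_approximable :: "(real \<Rightarrow> real) \<Rightarrow> (real \<Rightarrow> real) \<Rightarrow> bool" where
  "ridge_approximable \<rho> q \<longleftrightarrow>
     (\<forall>M. \<forall>\<epsilon>>0. \<exists>p. ridge_sum \<rho> p \<and> (\<forall>t. \<bar>t\<bar> \<le> M \<longrightarrow> \<bar>q t - p t\<bar> \<le> \<epsilon>))"

lemma ridge_sum_scale: "ridge_sum \<rho> p \<Longrightarrow> ridge_sum \<rho> (\<lambda>t. c * p t)"
proof (induction rule: ridge_sum.induct)
  case (unit d a b)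
  show ?case using ridge_sum.unit[of \<rho> "c * d" a b] by (simp add: mult.assoc)
next
  case (add p q)
  show ?case using ridge_sum.add[OF add.IH] by (simp add: distrib_left)
qed

lemma ridge_sum_affine: "ridge_sum \<rho> p \<Longrightarrow> ridge_sum \<rho> (\<lambda>t. p (c * t + d))"
proof (induction rule: ridge_sum.induct)
  case (unit e a b)
  show ?case using ridge_sum.unit[of \<rho> e "a * c" "a * d + b"] by (simp add: algebra_simps)
next
  case (add p q)
  show ?case by (rule ridge_sum.add[OF add.IH])
qed

lemma ridge_approximableD:
  assumes "ridge_approximable \<rho> q" "\<epsilon> > 0"
  obtains p where "ridge_sum \<rho> p" "\<And>t. \<bar>t\<bar> \<le> M \<Longrightarrow> \<bar>q t - p t\<bar> \<le> \<epsilon>"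
  using assms unfolding ridge_approximable_def by blast

lemma ridge_approximable_ridge_sum: "ridge_sum \<rho> p \<Longrightarrow> ridge_approximable \<rho> p"
  unfolding ridge_approximable_def by (intro allI impI exI[of _ p]) simp

lemma ridge_approximable_closed:
  assumes "\<And>M \<epsilon>. \<epsilon> > 0 \<Longrightarrow> \<exists>p. ridge_approximable \<rho> p \<and> (\<forall>t. \<bar>t\<bar> \<le> M \<longrightarrow> \<bar>q t - p t\<bar> \<le> \<epsilon>)"
  shows "ridge_approximable \<rho> q"
  unfolding ridge_approximable_def
proof (intro allI impI)
  fix M \<epsilon> :: real assume e: "\<epsilon> > 0"
  then obtain p where p: "ridge_approximable \<rho> p" "\<And>t. \<bar>t\<bar> \<le> M \<Longrightarrow> \<bar>q t - p t\<bar> \<le> \<epsilon> / 2"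
    using assms[of "\<epsilon> / 2" M] by auto
  obtain p' where p': "ridge_sum \<rho> p'" "\<And>t. \<bar>t\<bar> \<le> M \<Longrightarrow> \<bar>p t - p' t\<bar> \<le> \<epsilon> / 2"
    using ridge_approximableD[OF p(1), of "\<epsilon> / 2" M] e by auto
  have "\<bar>q t - p' t\<bar> \<le> \<epsilon>" if "\<bar>t\<bar> \<le> M" for t
    using p(2)[OF that] p'(2)[OF that] by linarith
  then show "\<exists>p. ridge_sum \<rho> p \<and> (\<forall>t. \<bar>t\<bar> \<le> M \<longrightarrow> \<bar>q t - p t\<bar> \<le> \<epsilon>)"
    using p'(1) by blast
qed

lemma ridge_approximable_add:
  assumes "ridge_approximable \<rho> p" "ridge_approximable \<rho> q"
  shows "ridge_approximable \<rho> (\<lambda>t. p t + q t)"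
  unfolding ridge_approximable_def
proof (intro allI impI)
  fix M \<epsilon> :: real assume e: "\<epsilon> > 0"
  then have e2: "\<epsilon> / 2 > 0" by simp
  obtain p' where p': "ridge_sum \<rho> p'" "\<And>t. \<bar>t\<bar> \<le> M \<Longrightarrow> \<bar>p t - p' t\<bar> \<le> \<epsilon> / 2"
    using ridge_approximableD[OF assms(1) e2] by metis
  obtain q' where q': "ridge_sum \<rho> q'" "\<And>t. \<bar>t\<bar> \<le> M \<Longrightarrow> \<bar>q t - q' t\<bar> \<le> \<epsilon> / 2"
    using ridge_approximableD[OF assms(2) e2] by metis
  have "\<bar>(p t + q t) - (p' t + q' t)\<bar> \<le> \<epsilon>" if "\<bar>t\<bar> \<le> M" for t
    using p'(2)[OF that] q'(2)[OF that] by linarith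
  then show "\<exists>f. ridge_sum \<rho> f \<and> (\<forall>t. \<bar>t\<bar> \<le> M \<longrightarrow> \<bar>p t + q t - f t\<bar> \<le> \<epsilon>)"
    using ridge_sum.add[OF p'(1) q'(1)] by blast
qed

lemma ridge_approximable_scale:
  assumes "ridge_approximable \<rho> p"
  shows "ridge_approximable \<rho> (\<lambda>t. c * p t)"
  unfolding ridge_approximable_def
proof (intro allI impI)
  fix M \<epsilon> :: real assume e: "\<epsilon> > 0"
  then have e2: "\<epsilon> / (\<bar>c\<bar> + 1) > 0" by simp
  obtain p' where p': "ridge_sum \<rho> p'" "\<And>t. \<bar>t\<bar> \<le> M \<Longrightarrow> \<bar>p t - p' t\<bar> \<le> \<epsilon> / (\<bar>c\<bar> + 1)"
    using ridge_approximableD[OF assms e2] by metis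
  have "\<bar>c * p t - c * p' t\<bar> \<le> \<epsilon>" if "\<bar>t\<bar> \<le> M" for t
  proof -
    have "\<bar>c * p t - c * p' t\<bar> = \<bar>c\<bar> * \<bar>p t - p' t\<bar>"
      by (simp add: abs_mult[symmetric] right_diff_distrib)
    also have "\<dots> \<le> (\<bar>c\<bar> + 1) * (\<epsilon> / (\<bar>c\<bar> + 1))"
      by (rule mult_mono) (use p'(2)[OF that] e in auto)
    finally show ?thesis by simp
  qed
  then show "\<exists>f. ridge_sum \<rho> f \<and> (\<forall>t. \<bar>t\<bar> \<le> M \<longrightarrow> \<bar>c * p t - f t\<bar> \<le> \<epsilon>)"
    using ridge_sum_scale[OF p'(1)] by blast
qed

lemma ridge_approximable_affine:
  assumes "ridge_approximable \<rho> p"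
  shows "ridge_approximable \<rho> (\<lambda>t. p (c * t + d))"
  unfolding ridge_approximable_def
proof (intro allI impI)
  fix M \<epsilon> :: real assume e: "\<epsilon> > 0"
  obtain p' where p': "ridge_sum \<rho> p'" "\<And>t. \<bar>t\<bar> \<le> \<bar>c\<bar> * \<bar>M\<bar> + \<bar>d\<bar> \<Longrightarrow> \<bar>p t - p' t\<bar> \<le> \<epsilon>"
    using ridge_approximableD[OF assms e] by metis
  have "\<bar>p (c * t + d) - p' (c * t + d)\<bar> \<le> \<epsilon>" if "\<bar>t\<bar> \<le> M" for t
  proof (rule p'(2))
    have "\<bar>c * t\<bar> \<le> \<bar>c\<bar> * \<bar>M\<bar>" using that unfolding abs_mult by (intro mult_left_mono) auto
    then show "\<bar>c * t + d\<bar> \<le> \<bar>c\<bar> * \<bar>M\<bar> + \<bar>d\<bar>" by linarith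
  qed
  then show "\<exists>f. ridge_sum \<rho> f \<and> (\<forall>t. \<bar>t\<bar> \<le> M \<longrightarrow> \<bar>p (c * t + d) - f t\<bar> \<le> \<epsilon>)"
    using ridge_sum_affine[OF p'(1), of c d] by blast
qed

lemma ridge_approximable_sum:
  assumes "\<And>i. ridge_approximable \<rho> (p i)"
  shows "ridge_approximable \<rho> (\<lambda>t. \<Sum>i<Suc n. p i t)"
proof (induction n)
  case (Suc n)
  show ?case using ridge_approximable_add[OF Suc assms[of "Suc n"]] by simp
qed (simp add: assms)

text \<open>A difference quotient of an antiderivative is a limit of Riemann sums.\<close>

lemma ridge_approximable_average:
  assumes \<sigma>: "ridge_approximable \<rho> \<sigma>" and lip: "\<And>x y. \<bar>\<sigma> x - \<sigma> y\<bar> \<le> L * \<bar>x - y\<bar>"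
    and S: "\<And>x. (S has_real_derivative \<sigma> x) (at x)" and \<delta>: "\<delta> > 0"
  shows "ridge_approximable \<rho> (\<lambda>t. (S (t + \<delta>) - S t) / \<delta>)"
proof (rule ridge_approximable_closed)
  fix M \<epsilon> :: real assume e: "\<epsilon> > 0"
  have L: "L \<ge> 0" using lip[of 1 0] by simp
  \<comment> \<open>The mesh \<open>\<delta> / N\<close> makes the Lipschitz oscillation over one
    cell at most \<open>\<epsilon>\<close>; passing to \<open>Suc n\<close> keeps the divisor
    positive.\<close>
  obtain n :: nat where n: "L * \<delta> / \<epsilon> < n" using reals_Archimedean2 by blast
  define N where "N = Suc n"
  have N: "N > 0" "L * \<delta> / N \<le> \<epsilon>"
    using n e by (auto simp: N_def field_simps)
  define x where "x = (\<lambda>t i. t + \<delta> / N * real i)"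
  \<comment> \<open>The Riemann sum with left endpoints, written with \<open>1 * t\<close> so that
    \<open>ridge_approximable_affine\<close> applies.\<close>
  define p where "p = (\<lambda>t. (1 / N) * (\<Sum>i<Suc n. \<sigma> (1 * t + \<delta> / N * real i)))"
  have "ridge_approximable \<rho> p" unfolding p_def
    by (intro ridge_approximable_scale ridge_approximable_sum ridge_approximable_affine \<sigma>)
  moreover have "\<bar>(S (t + \<delta>) - S t) / \<delta> - p t\<bar> \<le> \<epsilon>" for t
  proof -
    have step: "\<bar>(S (x t (Suc i)) - S (x t i)) / \<delta> - \<sigma> (x t i) / N\<bar> \<le> \<epsilon> / N" for i
    proof -
      have xi: "x t (Suc i) - x t i = \<delta> / N" by (simp add: x_def algebra_simps add_divide_distrib)
      then have lt: "x t i < x t (Suc i)" using \<delta> N by (simp add: algebra_simps)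
      \<comment> \<open>By the mean value theorem, the increment of \<open>S\<close> over a cell is
        its length times a value of \<open>\<sigma>\<close> inside the cell, which differs from the
        value at the left endpoint by at most \<open>\<epsilon>\<close>.\<close>
      obtain z where z: "x t i < z" "z < x t (Suc i)"
          "S (x t (Suc i)) - S (x t i) = (x t (Suc i) - x t i) * \<sigma> z"
        using MVT2[OF lt] S by metis
      have "(S (x t (Suc i)) - S (x t i)) / \<delta> - \<sigma> (x t i) / N = (\<sigma> z - \<sigma> (x t i)) / N"
        using \<delta> N by (simp add: z(3) xi field_simps)
      moreover have "\<bar>\<sigma> z - \<sigma> (x t i)\<bar> \<le> \<epsilon>"
      proof -
        have "\<bar>\<sigma> z - \<sigma> (x t i)\<bar> \<le> L * \<bar>z - x t i\<bar>" by (rule lip)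
        also have "\<dots> \<le> L * (\<delta> / N)" using z xi L by (intro mult_left_mono) auto
        finally show ?thesis using N(2) by simp
      qed
      ultimately show ?thesis using N(1) by (simp add: abs_divide divide_right_mono)
    qed
    have "(\<Sum>i<N. S (x t (Suc i)) - S (x t i)) = S (x t N) - S (x t 0)"
      by (rule sum_lessThan_telescope)
    then have "(S (t + \<delta>) - S t) / \<delta> = (\<Sum>i<N. (S (x t (Suc i)) - S (x t i)) / \<delta>)"
      using N by (simp add: x_def sum_divide_distrib[symmetric])
    moreover have "p t = (\<Sum>i<N. \<sigma> (x t i) / N)"
      by (simp add: p_def x_def N_def[symmetric] sum_divide_distrib)
    ultimately have "\<bar>(S (t + \<delta>) - S t) / \<delta> - p t\<bar>
        = \<bar>\<Sum>i<N. (S (x t (Suc i)) - S (x t i)) / \<delta> - \<sigma> (x t i) / N\<bar>"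
      by (simp add: sum_subtractf)
    also have "\<dots> \<le> (\<Sum>i<N. \<epsilon> / N)"
      by (rule order_trans[OF sum_abs sum_mono]) (rule step)
    also have "\<dots> = \<epsilon>" using N by simp
    finally show ?thesis .
  qed
  ultimately show "\<exists>p. ridge_approximable \<rho> p \<and> (\<forall>t. \<bar>t\<bar> \<le> M \<longrightarrow> \<bar>(S (t + \<delta>) - S t) / \<delta> - p t\<bar> \<le> \<epsilon>)"
    by blast
qed

text \<open>A second-order Taylor expansion at \<open>b\<close>, rescaled.\<close>

lemma ridge_approximable_quadratic:
  assumes R: "ridge_approximable \<rho> R" and R': "\<And>x. (R has_real_derivative R' x) (at x)"
    and R'': "(R' has_real_derivative c) (at b)"
    and const: "\<And>d. ridge_approximable \<rho> (\<lambda>_. d)"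
  shows "ridge_approximable \<rho> (\<lambda>t. c * t\<^sup>2)"
proof (rule ridge_approximable_closed)
  fix M \<epsilon> :: real assume e: "\<epsilon> > 0"
  define K where "K = \<bar>M\<bar> + 1"
  have K: "K > 0" by (simp add: K_def)
  \<comment> \<open>Chosen so that the final error \<open>2 * \<eta> * K\<^sup>2\<close> is exactly
    \<open>\<epsilon>\<close>.\<close>
  define \<eta> where "\<eta> = \<epsilon> / (2 * K\<^sup>2)"
  have eta: "\<eta> > 0" using e K by (simp add: \<eta>_def)
  have "((\<lambda>h. (R' (b + h) - R' b) / h) \<longlongrightarrow> c) (at 0)"
    using R'' by (simp add: DERIV_def)
  then obtain s where s: "s > 0" "\<And>h. h \<noteq> 0 \<Longrightarrow> \<bar>h\<bar> < s \<Longrightarrow> \<bar>(R' (b + h) - R' b) / h - c\<bar> < \<eta>"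
    using eta unfolding LIM_def by (auto simp: dist_real_def)
  have lin: "\<bar>R' (b + h) - R' b - c * h\<bar> \<le> \<eta> * \<bar>h\<bar>" if "\<bar>h\<bar> < s" for h
  proof (cases "h = 0")
    case False
    have "\<bar>R' (b + h) - R' b - c * h\<bar> = \<bar>(R' (b + h) - R' b) / h - c\<bar> * \<bar>h\<bar>"
      using False by (simp add: abs_mult[symmetric] field_simps)
    also have "\<dots> \<le> \<eta> * \<bar>h\<bar>" using s(2)[OF False that] by (intro mult_right_mono) auto
    finally show ?thesis .
  qed simp
  \<comment> \<open>Symmetrising about \<open>b\<close> cancels the linear term of \<open>R\<close>.
    Differentiability of \<open>R'\<close> at \<open>b\<close> then bounds the derivative of
    \<open>D\<close> at \<open>t\<close> by \<open>2 * \<eta> * \<bar>t\<bar>\<close>.\<close>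
  define D where "D = (\<lambda>t. R (b + t) + R (b - t) - 2 * R b - c * t\<^sup>2)"
  have D': "(D has_real_derivative R' (b + t) - R' (b - t) - 2 * c * t) (at t)" for t
    unfolding D_def by (auto intro!: derivative_eq_intros DERIV_chain2[OF R'])
  have D_le: "\<bar>D t\<bar> \<le> 2 * \<eta> * t\<^sup>2" if t: "\<bar>t\<bar> < s" for t
  proof -
    have "norm (D t - D 0) \<le> (2 * \<eta> * \<bar>t\<bar>) * norm (t - 0)"
    proof (rule field_differentiable_bound[where S = "{-\<bar>t\<bar>..\<bar>t\<bar>}" and f' = "\<lambda>t. R' (b + t) - R' (b - t) - 2 * c * t"])
      fix z assume z: "z \<in> {-\<bar>t\<bar>..\<bar>t\<bar>}"
      show "(D has_field_derivative R' (b + z) - R' (b - z) - 2 * c * z) (at z within {-\<bar>t\<bar>..\<bar>t\<bar>})"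
        by (rule has_field_derivative_at_within[OF D'])
      have "\<bar>z\<bar> \<le> \<bar>t\<bar>" using z by auto
      have "\<bar>R' (b + z) - R' b - c * z\<bar> \<le> \<eta> * \<bar>z\<bar>"
        by (rule lin) (use t \<open>\<bar>z\<bar> \<le> \<bar>t\<bar>\<close> in linarith)
      moreover have "\<bar>R' (b + - z) - R' b - c * (- z)\<bar> \<le> \<eta> * \<bar>- z\<bar>"
        by (rule lin) (use t \<open>\<bar>z\<bar> \<le> \<bar>t\<bar>\<close> in linarith)
      ultimately have "\<bar>R' (b + z) - R' (b - z) - 2 * c * z\<bar> \<le> 2 * (\<eta> * \<bar>z\<bar>)" by simp
      also have "\<dots> \<le> 2 * (\<eta> * \<bar>t\<bar>)" using eta \<open>\<bar>z\<bar> \<le> \<bar>t\<bar>\<close> by simp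
      finally show "norm (R' (b + z) - R' (b - z) - 2 * c * z) \<le> 2 * \<eta> * \<bar>t\<bar>" by simp
    qed auto
    moreover have "D 0 = 0" by (simp add: D_def)
    ultimately show ?thesis by (simp add: power2_eq_square mult.assoc)
  qed
  \<comment> \<open>For \<open>\<bar>t\<bar> \<le> K\<close> the rescaled argument
    \<open>h * t\<close> stays within \<open>s / 2\<close> of 0, where the bound on \<open>D\<close>
    holds.\<close>
  define h where "h = s / (2 * K)"
  have h: "h > 0" using s K by (simp add: h_def)
  define p where "p = (\<lambda>t. (1 / h\<^sup>2) * ((R (h * t + b) + R ((- h) * t + b)) + (- 2 * R b)))"
  have "ridge_approximable \<rho> p" unfolding p_def
    by (rule ridge_approximable_scale[OF ridge_approximable_add[OF ridge_approximable_add[OF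
          ridge_approximable_affine[OF R] ridge_approximable_affine[OF R]] const]])
  moreover have "\<bar>c * t\<^sup>2 - p t\<bar> \<le> \<epsilon>" if t: "\<bar>t\<bar> \<le> M" for t
  proof -
    have tK: "\<bar>t\<bar> \<le> K" using t by (simp add: K_def)
    have "\<bar>h * t\<bar> \<le> h * K" using h tK by (simp add: abs_mult)
    also have "\<dots> < s" using s K by (simp add: h_def)
    finally have ht: "\<bar>h * t\<bar> < s" .
    have "c * t\<^sup>2 - p t = - (D (h * t) / h\<^sup>2)"
      using h by (simp add: p_def D_def field_simps)
    then have "\<bar>c * t\<^sup>2 - p t\<bar> = \<bar>D (h * t)\<bar> / h\<^sup>2" by (simp add: abs_divide)
    also have "\<dots> \<le> 2 * \<eta> * (h * t)\<^sup>2 / h\<^sup>2" using D_le[OF ht] by (rule divide_right_mono) simp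
    also have "\<dots> = 2 * \<eta> * t\<^sup>2" using h by (simp add: power_mult_distrib)
    also have "\<dots> \<le> 2 * \<eta> * K\<^sup>2"
      using eta tK by (intro mult_left_mono) (auto simp: abs_le_square_iff[symmetric])
    also have "\<dots> = \<epsilon>" using K by (simp add: \<eta>_def)
    finally show ?thesis .
  qed
  ultimately show "\<exists>p. ridge_approximable \<rho> p \<and> (\<forall>t. \<bar>t\<bar> \<le> M \<longrightarrow> \<bar>c * t\<^sup>2 - p t\<bar> \<le> \<epsilon>)" by blast
qed

text \<open>Subtracting the chord through 0 and 1 leaves a function \<open>h\<close> that is linear
  along every progression starting at 0 and vanishes at 1. So it vanishes at all rationals, and by
  continuity everywhere.\<close>

lemma affine_if_second_differences_vanish:
  fixes f :: "real \<Rightarrow> real"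
  assumes cont: "continuous_on UNIV f"
    and diff: "\<And>x d. d > 0 \<Longrightarrow> f (x + 2 * d) - 2 * f (x + d) + f x = 0"
  shows "f x = f 0 + x * (f 1 - f 0)"
proof -
  define h where "h = (\<lambda>x. f x - f 0 - x * (f 1 - f 0))"
  have hd: "h (x + 2 * d) = 2 * h (x + d) - h x" if "d > 0" for x d
    using diff[OF that, of x] by (simp add: h_def algebra_simps)
  have h0: "h 0 = 0" and h1: "h 1 = 0" by (simp_all add: h_def)
  have mult: "h (real n * d) = real n * h d" if "d > 0" for n d
  proof (induction n rule: induct_nat_012)
    case (ge2 n)
    have "h (real n * d + 2 * d) = 2 * h (real n * d + d) - h (real n * d)" by (rule hd[OF that])
    then have "h (real (Suc (Suc n)) * d) = 2 * h (real (Suc n) * d) - h (real n * d)"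
      by (simp add: algebra_simps)
    then show ?case using ge2 by (simp add: algebra_simps)
  qed (simp_all add: h0)
  have pos: "h (real m / real n) = 0" if "n \<noteq> 0" for m n :: nat
  proof -
    have d: "1 / real n > 0" using that by simp
    have "real n * h (1 / real n) = 0" using mult[OF d, of n] that h1 by simp
    then have "h (1 / real n) = 0" using that by simp
    then show ?thesis using mult[OF d, of m] by simp
  qed
  have neg: "h (- y) = - h y" for y
  proof -
    \<comment> \<open>The progression \<open>- d\<close>, \<open>0\<close>, \<open>d\<close>, whose
      middle term gives \<open>h 0 = 0\<close>.\<close>
    have "h (- d) = - h d" if "d > 0" for d using hd[OF that, of "- d"] h0 by simp
    from this[of y] this[of "- y"] h0 show ?thesis by (cases y "0 :: real" rule: linorder_cases) auto
  qed
  have rat: "h q = 0" if q: "q \<in> \<rat>" for q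
  proof -
    obtain m n :: nat where mn: "n \<noteq> 0" "\<bar>q\<bar> = real m / real n"
      using Rats_abs_nat_div_natE[OF q] by metis
    have "h \<bar>q\<bar> = 0" unfolding mn(2) by (rule pos[OF mn(1)])
    then show ?thesis using neg[of q] by (cases "q \<ge> 0") auto
  qed
  have "continuous_on UNIV h" unfolding h_def by (intro continuous_intros cont)
  then have "h x = 0"
    using continuous_constant_on_closure[of \<rat> h 0 x] rat by (simp add: Rats_closure_real)
  then show ?thesis by (simp add: h_def)
qed

lemma nonaffine_second_difference:
  fixes \<rho> :: "real \<Rightarrow> real"
  assumes cont: "continuous_on UNIV \<rho>" and nonpoly: "\<not> (\<exists>p :: real poly. \<forall>t. \<rho> t = poly p t)"
  shows "\<exists>b \<delta>. \<delta> > 0 \<and> \<rho> (b + 2 * \<delta>) - 2 * \<rho> (b + \<delta>) + \<rho> b \<noteq> 0"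
proof (rule ccontr)
  assume "\<not> ?thesis"
  then have "\<rho> (x + 2 * d) - 2 * \<rho> (x + d) + \<rho> x = 0" if "d > 0" for x d
    using that by blast
  then have eq: "\<rho> x = \<rho> 0 + x * (\<rho> 1 - \<rho> 0)" for x
    by (rule affine_if_second_differences_vanish[OF cont])
  have "\<rho> t = poly [:\<rho> 0, \<rho> 1 - \<rho> 0:] t" for t by (rule trans[OF eq]) simp
  with nonpoly show False by blast
qed

lemma exists_antiderivative:
  fixes f :: "real \<Rightarrow> real"
  assumes "continuous_on UNIV f"
  shows "\<exists>F. \<forall>x. (F has_real_derivative f x) (at x)"
proof -
  have "\<exists>F. \<forall>x :: real. -\<infinity> < ereal x \<longrightarrow> ereal x < \<infinity> \<longrightarrow> (F has_vector_derivative f x) (at x)"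
    by (rule einterval_antiderivative) (use assms in \<open>auto simp: continuous_on_eq_continuous_at\<close>)
  then show ?thesis
    by (simp add: has_real_derivative_iff_has_vector_derivative)
qed

text \<open>Averaging \<open>\<rho>\<close> twice over windows of length \<open>\<delta>\<close>
  gives a function \<open>R\<close> whose second derivative is a second difference quotient of
  \<open>\<rho>\<close>. As \<open>\<rho>\<close> is not affine, this is nonzero at some
  \<open>b\<close> for a suitable \<open>\<delta>\<close>, and the Taylor expansion there isolates
  the square.\<close>

lemma
  fixes \<rho> :: "real \<Rightarrow> real"
  assumes lip: "L-lipschitz_on UNIV \<rho>" and nonpoly: "\<not> (\<exists>p :: real poly. \<forall>t. \<rho> t = poly p t)"
  shows ridge_approximable_square: "ridge_approximable \<rho> (\<lambda>t. t\<^sup>2)"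
    and ridge_approximable_id: "ridge_approximable \<rho> (\<lambda>t. t)"
proof -
  have cont: "continuous_on UNIV \<rho>" using lip by (rule lipschitz_on_continuous_on)
  have lip': "\<bar>\<rho> x - \<rho> y\<bar> \<le> L * \<bar>x - y\<bar>" for x y
    using lipschitz_onD[OF lip, of x y] by (simp add: dist_real_def)
  obtain b \<delta> where \<delta>: "\<delta> > 0" and nz: "\<rho> (b + 2 * \<delta>) - 2 * \<rho> (b + \<delta>) + \<rho> b \<noteq> 0"
    using nonaffine_second_difference[OF cont nonpoly] by blast
  \<comment> \<open>With inner slope 0, a ridge function is a multiple of \<open>\<rho> b0\<close>,
    so all constants are available.\<close>
  obtain b0 where b0: "\<rho> b0 \<noteq> 0" using nz by force
  have const: "ridge_approximable \<rho> (\<lambda>_. d)" for d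
    using ridge_approximable_ridge_sum[OF ridge_sum.unit[of \<rho> "d / \<rho> b0" 0 b0]] b0 by simp
  have base: "ridge_approximable \<rho> \<rho>"
    using ridge_approximable_ridge_sum[OF ridge_sum.unit[of \<rho> 1 1 0]] by simp
  obtain P where P: "\<And>x. (P has_real_derivative \<rho> x) (at x)"
    using exists_antiderivative[OF cont] by blast
  define R1 where "R1 = (\<lambda>t. (P (t + \<delta>) - P t) / \<delta>)"
  have R1: "ridge_approximable \<rho> R1"
    unfolding R1_def by (rule ridge_approximable_average[OF base lip' P \<delta>])
  have R1': "(R1 has_real_derivative (\<rho> (t + \<delta>) - \<rho> t) / \<delta>) (at t)" for t
    unfolding R1_def using \<delta> by (auto intro!: derivative_eq_intros DERIV_chain2[OF P] P)
  \<comment> \<open>Averaging does not worsen the Lipschitz constant, so it can be repeated.\<close>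
  have lip1: "\<bar>R1 x - R1 y\<bar> \<le> L * \<bar>x - y\<bar>" for x y
  proof -
    have "norm (R1 x - R1 y) \<le> L * norm (x - y)"
    proof (rule field_differentiable_bound[where S = UNIV and f' = "\<lambda>t. (\<rho> (t + \<delta>) - \<rho> t) / \<delta>"])
      fix z show "(R1 has_field_derivative (\<rho> (z + \<delta>) - \<rho> z) / \<delta>) (at z within UNIV)"
        using R1' by simp
      show "norm ((\<rho> (z + \<delta>) - \<rho> z) / \<delta>) \<le> L"
        using lip'[of "z + \<delta>" z] \<delta> by (simp add: field_simps)
    qed auto
    then show ?thesis by simp
  qed
  have "continuous_on UNIV R1"
    using R1' DERIV_continuous continuous_at_imp_continuous_on by blast
  then obtain Q where Q: "\<And>x. (Q has_real_derivative R1 x) (at x)"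
    using exists_antiderivative by blast
  define R where "R = (\<lambda>t. (Q (t + \<delta>) - Q t) / \<delta>)"
  have R: "ridge_approximable \<rho> R"
    unfolding R_def by (rule ridge_approximable_average[OF R1 lip1 Q \<delta>])
  have R': "(R has_real_derivative (R1 (t + \<delta>) - R1 t) / \<delta>) (at t)" for t
    unfolding R_def using \<delta> by (auto intro!: derivative_eq_intros DERIV_chain2[OF Q] Q)
  define c where "c = ((\<rho> (b + \<delta> + \<delta>) - \<rho> (b + \<delta>)) / \<delta> - (\<rho> (b + \<delta>) - \<rho> b) / \<delta>) / \<delta>"
  have R'': "((\<lambda>t. (R1 (t + \<delta>) - R1 t) / \<delta>) has_real_derivative c) (at b)"
    unfolding c_def using \<delta> by (auto intro!: derivative_eq_intros DERIV_chain2[OF R1'] R1')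
  have "b + \<delta> + \<delta> = b + 2 * \<delta>" by simp
  then have "c = (\<rho> (b + 2 * \<delta>) - 2 * \<rho> (b + \<delta>) + \<rho> b) / (\<delta> * \<delta>)"
    unfolding c_def by (simp add: diff_divide_distrib[symmetric] add.commute)
  then have "c \<noteq> 0" using nz \<delta> by simp
  have "ridge_approximable \<rho> (\<lambda>t. (1 / c) * (c * t\<^sup>2))"
    by (rule ridge_approximable_scale[OF ridge_approximable_quadratic[OF R R' R'' const]])
  then show sq: "ridge_approximable \<rho> (\<lambda>t. t\<^sup>2)" using \<open>c \<noteq> 0\<close> by simp
  \<comment> \<open>Polarisation: \<open>(t + 1)\<^sup>2 - (t - 1)\<^sup>2 = 4 * t\<close>.\<close>
  have "ridge_approximable \<rho> (\<lambda>t. (1 / 4) * (1 * t + 1)\<^sup>2 + (- 1 / 4) * (1 * t + (- 1))\<^sup>2)"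
    by (rule ridge_approximable_add[OF ridge_approximable_scale[OF ridge_approximable_affine[OF sq]]
          ridge_approximable_scale[OF ridge_approximable_affine[OF sq]]])
  moreover have "(1 / 4) * (1 * t + 1)\<^sup>2 + (- 1 / 4) * (1 * t + (- 1))\<^sup>2 = t" for t :: real
    by (simp add: power2_eq_square field_simps)
  ultimately show "ridge_approximable \<rho> (\<lambda>t. t)" by (simp only:)
qed


section \<open>Square-integrable tensors\<close>

lemma sq_integrable_add:
  assumes "U \<in> sq_integrable k" "V \<in> sq_integrable k"
  shows "(\<lambda>x. U x + V x) \<in> sq_integrable k"
proof -
  have m: "U \<in> borel_measurable (cube k)" "V \<in> borel_measurable (cube k)"
    using assms by (auto simp: sq_integrable_def)
  have "integrable (cube k) (\<lambda>x. 2 * (U x)\<^sup>2 + 2 * (V x)\<^sup>2)"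
    using assms by (simp add: sq_integrable_def)
  then have "integrable (cube k) (\<lambda>x. (U x + V x)\<^sup>2)"
  proof (rule Bochner_Integration.integrable_bound)
    show "(\<lambda>x. (U x + V x)\<^sup>2) \<in> borel_measurable (cube k)" using m by measurable
    have "(U x + V x)\<^sup>2 \<le> 2 * (U x)\<^sup>2 + 2 * (V x)\<^sup>2" for x
      using sum_squares_bound[of "U x" "V x"] by (simp add: power2_sum)
    then show "AE x in cube k. norm ((U x + V x)\<^sup>2) \<le> norm (2 * (U x)\<^sup>2 + 2 * (V x)\<^sup>2)"
      by (intro AE_I2) simp
  qed
  then show ?thesis using m by (simp add: sq_integrable_def)
qed

lemma sq_integrable_scale:
  assumes "U \<in> sq_integrable k"
  shows "(\<lambda>x. c * U x) \<in> sq_integrable k"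
proof -
  have [measurable]: "U \<in> borel_measurable (cube k)" using assms by (simp add: sq_integrable_def)
  show ?thesis using assms by (simp add: sq_integrable_def power_mult_distrib)
qed

lemma sq_integrable_diff:
  assumes "U \<in> sq_integrable k" "V \<in> sq_integrable k"
  shows "(\<lambda>x. U x - V x) \<in> sq_integrable k"
  using sq_integrable_add[OF assms(1) sq_integrable_scale[OF assms(2), of "-1"]] by simp

lemma sq_integrable_bounded:
  assumes "U \<in> borel_measurable (cube k)" "\<And>x. x \<in> space (cube k) \<Longrightarrow> \<bar>U x\<bar> \<le> B"
  shows "U \<in> sq_integrable k"
proof -
  interpret prob_space "cube k" by (rule prob_space_cube)
  have "(U x)\<^sup>2 \<le> B\<^sup>2" if "x \<in> space (cube k)" for x
    using assms(2)[OF that] by (simp add: abs_le_square_iff[symmetric])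
  then have "integrable (cube k) (\<lambda>x. (U x)\<^sup>2)"
    using assms(1) by (intro integrable_const_bound[where B = "B\<^sup>2"] AE_I2) simp_all
  then show ?thesis using assms(1) by (simp add: sq_integrable_def)
qed

lemma sq_integrable_const: "(\<lambda>_. c) \<in> sq_integrable k"
  by (rule sq_integrable_bounded[of _ _ "\<bar>c\<bar>"]) auto

lemma sq_integrable_dominated:
  assumes "V \<in> sq_integrable k" "U \<in> borel_measurable (cube k)"
    and "\<And>x. x \<in> space (cube k) \<Longrightarrow> \<bar>U x\<bar> \<le> \<bar>V x\<bar>"
  shows "U \<in> sq_integrable k"
proof -
  have "integrable (cube k) (\<lambda>x. (V x)\<^sup>2)" using assms(1) by (simp add: sq_integrable_def)
  then have "integrable (cube k) (\<lambda>x. (U x)\<^sup>2)"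
  proof (rule Bochner_Integration.integrable_bound)
    show "(\<lambda>x. (U x)\<^sup>2) \<in> borel_measurable (cube k)" using assms(2) by measurable
    show "AE x in cube k. norm ((U x)\<^sup>2) \<le> norm ((V x)\<^sup>2)"
      using assms(3) by (intro AE_I2) (simp add: abs_le_square_iff[symmetric])
  qed
  then show ?thesis using assms(2) by (simp add: sq_integrable_def)
qed

lemma lipschitz_bound:
  fixes \<rho> :: "real \<Rightarrow> real"
  assumes "L-lipschitz_on UNIV \<rho>"
  shows "\<bar>\<rho> x - \<rho> y\<bar> \<le> L * \<bar>x - y\<bar>"
  using lipschitz_onD[OF assms, of x y] by (simp add: dist_real_def)

lemma lipschitz_borel_measurable:
  fixes \<rho> :: "real \<Rightarrow> real"
  assumes "L-lipschitz_on UNIV \<rho>"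
  shows "\<rho> \<in> borel_measurable borel"
  using lipschitz_on_continuous_on[OF assms] by (rule borel_measurable_continuous_onI)

lemma sq_integrable_lipschitz:
  assumes lip: "L-lipschitz_on UNIV \<rho>" and U: "U \<in> sq_integrable k"
  shows "(\<lambda>x. \<rho> (U x)) \<in> sq_integrable k"
proof -
  have mU [measurable]: "U \<in> borel_measurable (cube k)" using U by (simp add: sq_integrable_def)
  have L: "L \<ge> 0" using lip by (rule lipschitz_on_nonneg)
  have abs: "(\<lambda>x. \<bar>U x\<bar>) \<in> sq_integrable k"
    using U by (simp add: sq_integrable_def)
  have *: "(\<lambda>x. \<bar>\<rho> 0\<bar> + L * \<bar>U x\<bar>) \<in> sq_integrable k"
    by (rule sq_integrable_add[OF sq_integrable_const sq_integrable_scale[OF abs]])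
  show ?thesis
  proof (rule sq_integrable_dominated[OF *])
    show "(\<lambda>x. \<rho> (U x)) \<in> borel_measurable (cube k)"
      by (rule measurable_compose[OF mU lipschitz_borel_measurable[OF lip]])
    fix x
    have "\<bar>\<rho> (U x)\<bar> \<le> \<bar>\<rho> 0\<bar> + L * \<bar>U x\<bar>"
      using lipschitz_bound[OF lip, of "U x" 0] by simp
    then show "\<bar>\<rho> (U x)\<bar> \<le> \<bar>\<bar>\<rho> 0\<bar> + L * \<bar>U x\<bar>\<bar>" by simp
  qed
qed

section \<open>Squared distances and closures of pairs\<close>

definition sqdist :: "nat \<Rightarrow> tensor \<Rightarrow> tensor \<Rightarrow> real" where
  "sqdist k U V = (\<integral>x. (U x - V x)\<^sup>2 \<partial>cube k)"

lemma sqdist_nonneg: "0 \<le> sqdist k U V"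
  unfolding sqdist_def by simp

lemma sqdist_eq_norm2: "sqdist k U V = (norm2 k (\<lambda>x. U x - V x))\<^sup>2"
  unfolding sqdist_def norm2_def by simp

lemma integrable_sqdiff:
  "U \<in> sq_integrable k \<Longrightarrow> V \<in> sq_integrable k \<Longrightarrow> integrable (cube k) (\<lambda>x. (U x - V x)\<^sup>2)"
  using sq_integrable_diff by (simp add: sq_integrable_def)

text \<open>Working with squared distances avoids roots; the price is the factor 2 from
  \<open>(a + b)\<^sup>2 \<le> 2 * a\<^sup>2 + 2 * b\<^sup>2\<close>, absorbed later by choosing
  \<open>\<epsilon> / 4\<close>.\<close>

lemma sqdist_triangle:
  assumes "U \<in> sq_integrable k" "V \<in> sq_integrable k" "Z \<in> sq_integrable k"
  shows "sqdist k U Z \<le> 2 * sqdist k U V + 2 * sqdist k V Z"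
proof -
  have "sqdist k U Z \<le> (\<integral>x. 2 * (U x - V x)\<^sup>2 + 2 * (V x - Z x)\<^sup>2 \<partial>cube k)"
    unfolding sqdist_def
  proof (rule integral_mono)
    fix x
    show "(U x - Z x)\<^sup>2 \<le> 2 * (U x - V x)\<^sup>2 + 2 * (V x - Z x)\<^sup>2"
      using sum_squares_bound[of "U x - V x" "V x - Z x"]
      by (simp add: power2_eq_square algebra_simps)
  qed (use assms integrable_sqdiff in simp_all)
  also have "\<dots> = 2 * sqdist k U V + 2 * sqdist k V Z"
    unfolding sqdist_def using assms integrable_sqdiff by simp
  finally show ?thesis .
qed

lemma sqdist_add:
  assumes "U \<in> sq_integrable k" "V \<in> sq_integrable k" "U' \<in> sq_integrable k" "V' \<in> sq_integrable k"
  shows "sqdist k (\<lambda>x. U x + V x) (\<lambda>x. U' x + V' x) \<le> 2 * sqdist k U U' + 2 * sqdist k V V'"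
proof -
  have "sqdist k (\<lambda>x. U x + V x) (\<lambda>x. U' x + V' x)
      \<le> (\<integral>x. 2 * (U x - U' x)\<^sup>2 + 2 * (V x - V' x)\<^sup>2 \<partial>cube k)"
    unfolding sqdist_def
  proof (rule integral_mono)
    show "integrable (cube k) (\<lambda>x. (U x + V x - (U' x + V' x))\<^sup>2)"
      by (rule integrable_sqdiff[OF sq_integrable_add[OF assms(1,2)] sq_integrable_add[OF assms(3,4)]])
    fix x
    show "(U x + V x - (U' x + V' x))\<^sup>2 \<le> 2 * (U x - U' x)\<^sup>2 + 2 * (V x - V' x)\<^sup>2"
      using sum_squares_bound[of "U x - U' x" "V x - V' x"]
      by (simp add: power2_eq_square algebra_simps)
  qed (use assms integrable_sqdiff in simp_all)
  also have "\<dots> = 2 * sqdist k U U' + 2 * sqdist k V V'"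
    unfolding sqdist_def using assms integrable_sqdiff by simp
  finally show ?thesis .
qed

lemma sqdist_lipschitz:
  assumes q: "L-lipschitz_on UNIV q" and UV: "U \<in> sq_integrable k" "V \<in> sq_integrable k"
  shows "sqdist k (\<lambda>x. q (U x)) (\<lambda>x. q (V x)) \<le> L\<^sup>2 * sqdist k U V"
proof -
  have "sqdist k (\<lambda>x. q (U x)) (\<lambda>x. q (V x)) \<le> (\<integral>x. L\<^sup>2 * (U x - V x)\<^sup>2 \<partial>cube k)"
    unfolding sqdist_def
  proof (rule integral_mono)
    show "integrable (cube k) (\<lambda>x. (q (U x) - q (V x))\<^sup>2)"
      by (rule integrable_sqdiff[OF sq_integrable_lipschitz[OF q UV(1)] sq_integrable_lipschitz[OF q UV(2)]])
    fix x
    have "\<bar>q (U x) - q (V x)\<bar> \<le> \<bar>L * (U x - V x)\<bar>"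
      using lipschitz_bound[OF q, of "U x" "V x"] lipschitz_on_nonneg[OF q] by (simp add: abs_mult)
    then show "(q (U x) - q (V x))\<^sup>2 \<le> L\<^sup>2 * (U x - V x)\<^sup>2"
      unfolding power_mult_distrib[symmetric] by (simp add: abs_le_square_iff)
  qed (use assms integrable_sqdiff in simp_all)
  then show ?thesis unfolding sqdist_def by simp
qed

lemma sqdist_AE:
  assumes "U \<in> sq_integrable k" "U' \<in> sq_integrable k" "V \<in> sq_integrable k" "AE x in cube k. U x = U' x"
  shows "sqdist k U V = sqdist k U' V"
  unfolding sqdist_def
proof (rule integral_cong_AE)
  show "(\<lambda>x. (U x - V x)\<^sup>2) \<in> borel_measurable (cube k)" "(\<lambda>x. (U' x - V x)\<^sup>2) \<in> borel_measurable (cube k)"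
    using integrable_sqdiff assms by blast+
  show "AE x in cube k. (U x - V x)\<^sup>2 = (U' x - V x)\<^sup>2"
    using assms(4) by eventually_elim simp
qed

lemma sqdist_uniform:
  assumes "U \<in> sq_integrable k" "V \<in> sq_integrable k" "\<And>x. x \<in> space (cube k) \<Longrightarrow> \<bar>U x - V x\<bar> \<le> \<epsilon>"
  shows "sqdist k U V \<le> \<epsilon>\<^sup>2"
proof -
  interpret prob_space "cube k" by (rule prob_space_cube)
  have "sqdist k U V \<le> (\<integral>x. \<epsilon>\<^sup>2 \<partial>cube k)"
    unfolding sqdist_def
  proof (rule integral_mono)
    fix x assume "x \<in> space (cube k)"
    from assms(3)[OF this] show "(U x - V x)\<^sup>2 \<le> \<epsilon>\<^sup>2" by (simp add: abs_le_square_iff[symmetric])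
  qed (use assms integrable_sqdiff in simp_all)
  then show ?thesis by (simp add: prob_space)
qed

lemma integral_diff_le_sqdist:
  assumes "U \<in> sq_integrable k" "V \<in> sq_integrable k"
  shows "((\<integral>x. U x \<partial>cube k) - (\<integral>x. V x \<partial>cube k))\<^sup>2 \<le> sqdist k U V"
proof -
  interpret prob_space "cube k" by (rule prob_space_cube)
  have "((\<integral>x. U x \<partial>cube k) - (\<integral>x. V x \<partial>cube k))\<^sup>2 = (\<integral>x. U x - V x \<partial>cube k)\<^sup>2"
    using sq_integrable_imp_integrable[OF assms(1)] sq_integrable_imp_integrable[OF assms(2)] by simp
  also have "\<dots> \<le> sqdist k U V"
    unfolding sqdist_def
    by (rule square_expectation_le[OF sq_integrable_imp_integrable[OF sq_integrable_diff[OF assms]]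
          integrable_sqdiff[OF assms]])
  finally show ?thesis .
qed

lemma LE_sq: "T \<in> LE k l \<Longrightarrow> U \<in> sq_integrable k \<Longrightarrow> T U \<in> sq_integrable l"
  by (simp add: LE_def)

lemma LE_add:
  "T \<in> LE k l \<Longrightarrow> U \<in> sq_integrable k \<Longrightarrow> V \<in> sq_integrable k \<Longrightarrow>
    AE x in cube l. T (\<lambda>z. U z + V z) x = T U x + T V x"
  by (simp add: LE_def)

lemma LE_scale:
  "T \<in> LE k l \<Longrightarrow> U \<in> sq_integrable k \<Longrightarrow> AE x in cube l. T (\<lambda>z. c * U z) x = c * T U x"
  by (simp add: LE_def)

text \<open>On representatives an operator is linear only up to null sets, so the difference of the
  images is first identified almost everywhere with the image of the difference.\<close>

lemma LE_sqdist:
  assumes T: "T \<in> LE k l"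
  shows "\<exists>C>0. \<forall>U\<in>sq_integrable k. \<forall>V\<in>sq_integrable k. sqdist l (T U) (T V) \<le> C * sqdist k U V"
proof -
  obtain C where C: "\<And>U. U \<in> sq_integrable k \<Longrightarrow> norm2 l (T U) \<le> C * norm2 k U"
    using T unfolding LE_def by blast
  \<comment> \<open>Adding 1 makes the constant positive even for the zero operator, so that later
    estimates may divide by it.\<close>
  have "sqdist l (T U) (T V) \<le> (C\<^sup>2 + 1) * sqdist k U V"
    if U: "U \<in> sq_integrable k" and V: "V \<in> sq_integrable k" for U V
  proof -
    let ?D = "\<lambda>x. U x + - 1 * V x"
    have V': "(\<lambda>x. - 1 * V x) \<in> sq_integrable k" by (rule sq_integrable_scale[OF V])
    have D: "?D \<in> sq_integrable k" by (rule sq_integrable_add[OF U V'])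
    have a1: "AE x in cube l. T ?D x = T U x + T (\<lambda>x. - 1 * V x) x"
      by (rule LE_add[OF T U V'])
    have a2: "AE x in cube l. T (\<lambda>x. - 1 * V x) x = - 1 * T V x"
      by (rule LE_scale[OF T V])
    have e1: "AE x in cube l. (T U x - T V x)\<^sup>2 = (T ?D x)\<^sup>2"
      using a1 a2 by eventually_elim simp
    have m1: "(\<lambda>x. (T U x - T V x)\<^sup>2) \<in> borel_measurable (cube l)"
      using integrable_sqdiff[OF LE_sq[OF T U] LE_sq[OF T V]] by blast
    have m2: "(\<lambda>x. (T ?D x)\<^sup>2) \<in> borel_measurable (cube l)"
    proof -
      have [measurable]: "T ?D \<in> borel_measurable (cube l)"
        using LE_sq[OF T D] unfolding sq_integrable_def by blast
      show ?thesis by measurable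
    qed
    have "sqdist l (T U) (T V) = (\<integral>x. (T ?D x)\<^sup>2 \<partial>cube l)"
      unfolding sqdist_def by (rule integral_cong_AE[OF m1 m2 e1])
    also have "\<dots> = (norm2 l (T ?D))\<^sup>2"
      unfolding norm2_def by (rule real_sqrt_pow2[symmetric]) simp
    also have "\<dots> \<le> (C * norm2 k ?D)\<^sup>2"
      by (rule power_mono[OF C[OF D]]) (simp add: norm2_def)
    also have "\<dots> = C\<^sup>2 * sqdist k U V"
      by (simp add: power_mult_distrib sqdist_eq_norm2)
    also have "\<dots> \<le> (C\<^sup>2 + 1) * sqdist k U V"
      using sqdist_nonneg by (intro mult_right_mono) auto
    finally show ?thesis .
  qed
  moreover have "C\<^sup>2 + 1 > 0" by (simp add: add_nonneg_pos)
  ultimately show ?thesis by blast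
qed

text \<open>A single \<open>F\<close> must approximate both components: approximating them by
  different elements of \<open>S\<close> would mean using different networks on the two
  inputs.\<close>

definition l2_closure :: "nat \<Rightarrow> (bool \<Rightarrow> tensor) set \<Rightarrow> (bool \<Rightarrow> tensor) set" where
  "l2_closure k S = {U. (\<forall>b. U b \<in> sq_integrable k) \<and> (\<forall>\<epsilon>>0. \<exists>F\<in>S. \<forall>b. sqdist k (U b) (F b) \<le> \<epsilon>)}"

lemma l2_closure_sq: "U \<in> l2_closure k S \<Longrightarrow> U b \<in> sq_integrable k"
  by (simp add: l2_closure_def)

lemma l2_closure_approx:
  "U \<in> l2_closure k S \<Longrightarrow> \<epsilon> > 0 \<Longrightarrow> \<exists>F\<in>S. \<forall>b. sqdist k (U b) (F b) \<le> \<epsilon>"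
  by (simp add: l2_closure_def)

lemma l2_closureI:
  assumes "\<And>b. U b \<in> sq_integrable k" "\<And>\<epsilon>. \<epsilon> > 0 \<Longrightarrow> \<exists>F\<in>S. \<forall>b. sqdist k (U b) (F b) \<le> \<epsilon>"
  shows "U \<in> l2_closure k S"
  using assms by (simp add: l2_closure_def)

context
  fixes k :: nat and S :: "(bool \<Rightarrow> tensor) set"
  assumes all_sq: "\<forall>F\<in>S. \<forall>b. F b \<in> sq_integrable k"
begin

private lemma sq: "F \<in> S \<Longrightarrow> F b \<in> sq_integrable k"
  using all_sq by blast

lemma l2_closure_superset: "F \<in> S \<Longrightarrow> F \<in> l2_closure k S"
  by (rule l2_closureI[OF sq]) (auto intro!: bexI[of _ F] simp: sqdist_def)

lemma l2_closure_closed: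
  assumes U: "\<And>b. U b \<in> sq_integrable k"
    and appr: "\<And>\<epsilon>. \<epsilon> > 0 \<Longrightarrow> \<exists>V\<in>l2_closure k S. \<forall>b. sqdist k (U b) (V b) \<le> \<epsilon>"
  shows "U \<in> l2_closure k S"
proof (rule l2_closureI[OF U])
  fix \<epsilon> :: real assume "\<epsilon> > 0"
  then have e: "\<epsilon> / 4 > 0" by simp
  obtain V where V: "V \<in> l2_closure k S" "\<And>b. sqdist k (U b) (V b) \<le> \<epsilon> / 4" using appr[OF e] by blast
  obtain F where F: "F \<in> S" "\<And>b. sqdist k (V b) (F b) \<le> \<epsilon> / 4"
    using l2_closure_approx[OF V(1) e] by blast
  have "sqdist k (U b) (F b) \<le> \<epsilon>" for b
    using sqdist_triangle[OF U l2_closure_sq[OF V(1)] sq[OF F(1)], of b b b]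
      V(2)[of b] F(2)[of b] by linarith
  then show "\<exists>F\<in>S. \<forall>b. sqdist k (U b) (F b) \<le> \<epsilon>" using F(1) by blast
qed

text \<open>Operators in \<open>LE\<close> satisfy their algebraic laws only almost everywhere; with
  this lemma such identities can be used inside the closure.\<close>

lemma l2_closure_AE:
  assumes V: "V \<in> l2_closure k S" and U: "\<And>b. U b \<in> sq_integrable k"
    and ae: "\<And>b. AE x in cube k. U b x = V b x"
  shows "U \<in> l2_closure k S"
proof (rule l2_closure_closed[OF U])
  fix \<epsilon> :: real assume "\<epsilon> > 0"
  moreover have "sqdist k (U b) (V b) = sqdist k (V b) (V b)" for b
    by (rule sqdist_AE[OF U l2_closure_sq[OF V] l2_closure_sq[OF V] ae])
  moreover have "sqdist k (V b) (V b) = 0" for b by (simp add: sqdist_def)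
  ultimately show "\<exists>V\<in>l2_closure k S. \<forall>b. sqdist k (U b) (V b) \<le> \<epsilon>"
    using V by (intro bexI[of _ V]) auto
qed

text \<open>Composition with a Lipschitz function is continuous on L2, so \<open>image\<close> need
  only be known on \<open>S\<close>.\<close>

lemma l2_closure_lipschitz:
  assumes U: "U \<in> l2_closure k S" and q: "C-lipschitz_on UNIV q"
    and image: "\<And>F. F \<in> S \<Longrightarrow> (\<lambda>b x. q (F b x)) \<in> l2_closure k S"
  shows "(\<lambda>b x. q (U b x)) \<in> l2_closure k S"
proof (rule l2_closure_closed)
  show "(\<lambda>x. q (U b x)) \<in> sq_integrable k" for b
    by (rule sq_integrable_lipschitz[OF q l2_closure_sq[OF U]])
  fix \<epsilon> :: real assume e: "\<epsilon> > 0"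
  have K: "C\<^sup>2 + 1 > 0" by (simp add: add_nonneg_pos)
  then have "\<epsilon> / (C\<^sup>2 + 1) > 0" using e by simp
  then obtain V where V: "V \<in> S" "\<And>b. sqdist k (U b) (V b) \<le> \<epsilon> / (C\<^sup>2 + 1)"
    using l2_closure_approx[OF U] by blast
  have "sqdist k (\<lambda>x. q (U b x)) (\<lambda>x. q (V b x)) \<le> \<epsilon>" for b
  proof -
    have "sqdist k (\<lambda>x. q (U b x)) (\<lambda>x. q (V b x)) \<le> C\<^sup>2 * sqdist k (U b) (V b)"
      by (rule sqdist_lipschitz[OF q l2_closure_sq[OF U] sq[OF V(1)]])
    also have "\<dots> \<le> (C\<^sup>2 + 1) * (\<epsilon> / (C\<^sup>2 + 1))"
      using V(2)[of b] sqdist_nonneg by (intro mult_mono) auto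
    finally show ?thesis using K by simp
  qed
  then show "\<exists>V\<in>l2_closure k S. \<forall>b. sqdist k (\<lambda>x. q (U b x)) (V b) \<le> \<epsilon>"
    by (intro bexI[OF _ image[OF V(1)]] allI)
qed

lemma l2_closure_affine:
  assumes S: "\<forall>F\<in>S. \<forall>c d. (\<lambda>b x. c * F b x + d) \<in> S" and U: "U \<in> l2_closure k S"
  shows "(\<lambda>b x. c * U b x + d) \<in> l2_closure k S"
proof (rule l2_closure_lipschitz[OF U])
  show "\<bar>c\<bar>-lipschitz_on UNIV (\<lambda>t. c * t + d)"
    by (rule lipschitz_onI) (simp_all add: dist_real_def abs_mult[symmetric] right_diff_distrib)
  show "(\<lambda>b x. c * F b x + d) \<in> l2_closure k S" if "F \<in> S" for F
    using S that by (intro l2_closure_superset) blast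
qed

lemma l2_closure_add:
  assumes S: "\<forall>F\<in>S. \<forall>G\<in>S. (\<lambda>b x. F b x + G b x) \<in> S"
    and U: "U \<in> l2_closure k S" and V: "V \<in> l2_closure k S"
  shows "(\<lambda>b x. U b x + V b x) \<in> l2_closure k S"
proof (rule l2_closureI)
  show "(\<lambda>x. U b x + V b x) \<in> sq_integrable k" for b
    by (rule sq_integrable_add[OF l2_closure_sq[OF U] l2_closure_sq[OF V]])
  fix \<epsilon> :: real assume "\<epsilon> > 0"
  then have e: "\<epsilon> / 4 > 0" by simp
  obtain F where F: "F \<in> S" "\<And>b. sqdist k (U b) (F b) \<le> \<epsilon> / 4"
    using l2_closure_approx[OF U e] by blast
  obtain G where G: "G \<in> S" "\<And>b. sqdist k (V b) (G b) \<le> \<epsilon> / 4"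
    using l2_closure_approx[OF V e] by blast
  have "sqdist k (\<lambda>x. U b x + V b x) (\<lambda>x. F b x + G b x) \<le> \<epsilon>" for b
    using sqdist_add[OF l2_closure_sq[OF U] l2_closure_sq[OF V] sq[OF F(1)] sq[OF G(1)], of b b b b]
      F(2)[of b] G(2)[of b] by linarith
  then show "\<exists>F\<in>S. \<forall>b. sqdist k (\<lambda>x. U b x + V b x) (F b) \<le> \<epsilon>"
    using S F(1) G(1) by (intro bexI[of _ "\<lambda>b x. F b x + G b x"] allI) blast+
qed

end


section \<open>Features computed by networks\<close>

lemma norm2_scale: "norm2 l (\<lambda>x. c * U x) = \<bar>c\<bar> * norm2 l U"
  by (simp add: norm2_def power_mult_distrib real_sqrt_mult)

lemma LE_scaled:
  assumes T: "T \<in> LE k l"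
  shows "(\<lambda>U x. c * T U x) \<in> LE k l"
  unfolding LE_def
proof (intro CollectI conjI ballI allI impI)
  fix U V assume U: "U \<in> sq_integrable k" and V: "V \<in> sq_integrable k"
  show "(\<lambda>x. c * T U x) \<in> sq_integrable l" by (rule sq_integrable_scale[OF LE_sq[OF T U]])
  show "AE x in cube l. c * T (\<lambda>z. U z + V z) x = c * T U x + c * T V x"
    using LE_add[OF T U V] by eventually_elim (simp add: distrib_left)
  assume "AE x in cube k. U x = V x"
  then have "AE x in cube l. T U x = T V x" using T U V by (simp add: LE_def)
  then show "AE x in cube l. c * T U x = c * T V x" by eventually_elim simp
next
  fix a U assume U: "U \<in> sq_integrable k"
  show "AE x in cube l. c * T (\<lambda>z. a * U z) x = a * (c * T U x)"
    using LE_scale[OF T U, of a] by eventually_elim simp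
next
  obtain C where C: "\<And>U. U \<in> sq_integrable k \<Longrightarrow> norm2 l (T U) \<le> C * norm2 k U"
    using T unfolding LE_def by blast
  have "norm2 l (\<lambda>x. c * T U x) \<le> (\<bar>c\<bar> * C) * norm2 k U" if "U \<in> sq_integrable k" for U
    using mult_left_mono[OF C[OF that], of "\<bar>c\<bar>"] by (simp add: norm2_scale mult.assoc)
  then show "\<exists>C. \<forall>U\<in>sq_integrable k. norm2 l (\<lambda>x. c * T U x) \<le> C * norm2 k U" by blast
next
  fix \<phi> U assume "measure_preserving01 \<phi>" "U \<in> sq_integrable k"
  then have "AE x in cube l. T (relabel k \<phi> U) x = relabel l \<phi> (T U) x"
    using T by (simp add: LE_def)
  then show "AE x in cube l. c * T (relabel k \<phi> U) x = relabel l \<phi> (\<lambda>x. c * T U x) x"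
    by eventually_elim (simp add: relabel_def)
qed

lemma mean_op_zero: "mean_op 0 k U = (\<lambda>_. 0)"
  by (simp add: averaging_def)

lemma mean_op_one: "mean_op d k (\<lambda>_. 1) = (\<lambda>_. d)"
proof -
  interpret prob_space "cube k" by (rule prob_space_cube)
  show ?thesis by (simp add: averaging_def prob_space)
qed

text \<open>A layer is appended by changing the record at one new index; the features below it stay
  the same.\<close>

lemma iwn_features_cong:
  assumes "\<And>t. t \<le> s \<Longrightarrow> width N' t = width N t"
    "\<And>t. t \<le> s \<Longrightarrow> weight N' t = weight N t" "\<And>t. t \<le> s \<Longrightarrow> bias N' t = bias N t"
  shows "iwn_features \<rho> N' U s = iwn_features \<rho> N U s"
  using assms
proof (induction s)
  case (Suc s)
  have IH: "iwn_features \<rho> N' U s = iwn_features \<rho> N U s"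
    by (rule Suc.IH) (simp_all add: Suc.prems)
  have "layer N' (Suc s) X = layer N (Suc s) X" for X
    by (rule ext) (simp add: layer_def Suc.prems)
  then show ?case by (simp add: IH)
qed simp

locale tensor_network =
  fixes \<rho> :: "real \<Rightarrow> real" and L :: real and k :: nat and inp :: "bool \<Rightarrow> nat \<Rightarrow> tensor"
  assumes lip: "L-lipschitz_on UNIV \<rho>"
    and nonpoly: "\<not> (\<exists>p :: real poly. \<forall>t. \<rho> t = poly p t)"
    and measurable_inp: "\<And>b p. p < 2 \<Longrightarrow> inp b p \<in> borel_measurable (cube 2)"
    and bounded_inp: "\<exists>B. \<forall>b. \<forall>p<2. \<forall>x\<in>space (cube 2). \<bar>inp b p x\<bar> \<le> B"
begin

lemma sq_integrable_inp:
  assumes "p < 2"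
  shows "inp b p \<in> sq_integrable 2"
proof -
  obtain B where "\<forall>b. \<forall>p<2. \<forall>x\<in>space (cube 2). \<bar>inp b p x\<bar> \<le> B" using bounded_inp by blast
  then show ?thesis using assms measurable_inp by (intro sq_integrable_bounded[of _ _ B]) auto
qed

text \<open>
  \<open>feat s\<close> consists of the pairs of tensors that one and the same channel of layer \<open>s + 1\<close> of a network
  with hidden tensor dimension \<open>k\<close> computes on the two inputs.
\<close>

primrec feat :: "nat \<Rightarrow> (bool \<Rightarrow> tensor) set" where
  "feat 0 = {\<lambda>b x. T (inp b p) x + d | T p d. T \<in> LE 2 k \<and> p < 2}"
| "feat (Suc s) = {\<lambda>b x. (\<Sum>(T, V)\<leftarrow>ts. T (\<lambda>z. \<rho> (V b z)) x) + d | ts d.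
     ts \<noteq> [] \<and> (\<forall>(T, V)\<in>set ts. T \<in> LE k k \<and> V \<in> feat s)}"

lemma feat_0I: "T \<in> LE 2 k \<Longrightarrow> p < 2 \<Longrightarrow> U = (\<lambda>b x. T (inp b p) x + d) \<Longrightarrow> U \<in> feat 0"
  unfolding feat.simps by blast

lemma feat_SucI:
  "ts \<noteq> [] \<Longrightarrow> \<forall>(T, V)\<in>set ts. T \<in> LE k k \<and> V \<in> feat s \<Longrightarrow>
    U = (\<lambda>b x. (\<Sum>(T, V)\<leftarrow>ts. T (\<lambda>z. \<rho> (V b z)) x) + d) \<Longrightarrow> U \<in> feat (Suc s)"
  unfolding feat.simps by blast

lemma feat_sq: "U \<in> feat s \<Longrightarrow> U b \<in> sq_integrable k"
proof (induction s arbitrary: U)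
  case 0
  then obtain T p d where U: "U = (\<lambda>b x. T (inp b p) x + d)" and T: "T \<in> LE 2 k" "p < 2" by auto
  show ?case unfolding U
    by (rule sq_integrable_add[OF LE_sq[OF T(1) sq_integrable_inp[OF T(2)]] sq_integrable_const])
next
  case (Suc s)
  then obtain ts d where U: "U = (\<lambda>b x. (\<Sum>(T, V)\<leftarrow>ts. T (\<lambda>z. \<rho> (V b z)) x) + d)"
    and ts: "\<forall>(T, V)\<in>set ts. T \<in> LE k k \<and> V \<in> feat s" by auto
  have "(\<lambda>x. (\<Sum>(T, V)\<leftarrow>ts. T (\<lambda>z. \<rho> (V b z)) x)) \<in> sq_integrable k"
    using ts
  proof (induction ts)
    case Nil
    then show ?case by (simp add: sq_integrable_const)
  next
    case (Cons a ts)
    obtain T V where a: "a = (T, V)" by (cases a)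
    have TV: "T \<in> LE k k" "V \<in> feat s" and "\<forall>(T, V)\<in>set ts. T \<in> LE k k \<and> V \<in> feat s"
      using Cons.prems by (simp_all add: a)
    then have "(\<lambda>x. \<Sum>(T, V)\<leftarrow>ts. T (\<lambda>z. \<rho> (V b z)) x) \<in> sq_integrable k" by (intro Cons.IH)
    with LE_sq[OF TV(1) sq_integrable_lipschitz[OF lip Suc.IH[OF TV(2)]]] show ?case
      unfolding a list.map sum_list.Cons prod.case by (rule sq_integrable_add)
  qed
  then show ?case unfolding U by (rule sq_integrable_add[OF _ sq_integrable_const])
qed

lemma feat_affine:
  assumes "U \<in> feat s"
  shows "(\<lambda>b x. c * U b x + e) \<in> feat s"
proof (cases s)
  case 0
  with assms obtain T p d where U: "U = (\<lambda>b x. T (inp b p) x + d)" and T: "T \<in> LE 2 k" "p < 2" by auto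
  have "(\<lambda>b x. c * U b x + e) = (\<lambda>b x. (\<lambda>U x. c * T U x) (inp b p) x + (c * d + e))"
    by (simp add: U algebra_simps)
  then show ?thesis unfolding 0 by (rule feat_0I[OF LE_scaled[OF T(1)] T(2)])
next
  case (Suc s')
  with assms obtain ts d where U: "U = (\<lambda>b x. (\<Sum>(T, V)\<leftarrow>ts. T (\<lambda>z. \<rho> (V b z)) x) + d)"
    and ts: "ts \<noteq> []" "\<forall>(T, V)\<in>set ts. T \<in> LE k k \<and> V \<in> feat s'" by auto
  define ts' where "ts' = map (\<lambda>(T, V). ((\<lambda>U x. c * T U x) :: tensor \<Rightarrow> tensor, V :: bool \<Rightarrow> tensor)) ts"
  have "c * (\<Sum>(T, V)\<leftarrow>ts. T (\<lambda>z. \<rho> (V b z)) x) = (\<Sum>(T, V)\<leftarrow>ts'. T (\<lambda>z. \<rho> (V b z)) x)" for b x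
    unfolding ts'_def by (induction ts) (auto simp: algebra_simps)
  then have "(\<lambda>b x. c * U b x + e) = (\<lambda>b x. (\<Sum>(T, V)\<leftarrow>ts'. T (\<lambda>z. \<rho> (V b z)) x) + (c * d + e))"
    by (simp add: U distrib_left add.assoc)
  moreover have "ts' \<noteq> []" "\<forall>(T, V)\<in>set ts'. T \<in> LE k k \<and> V \<in> feat s'"
    using ts LE_scaled by (auto simp: ts'_def)
  ultimately show ?thesis unfolding Suc by (intro feat_SucI)
qed

text \<open>Term lists are concatenated. This needs a hidden layer below, because a feature of level
  0 reads a single input channel through a single operator.\<close>

lemma feat_add:
  assumes "U \<in> feat (Suc s)" "V \<in> feat (Suc s)"
  shows "(\<lambda>b x. U b x + V b x) \<in> feat (Suc s)"
proof -
  obtain ts d where U: "U = (\<lambda>b x. (\<Sum>(T, V)\<leftarrow>ts. T (\<lambda>z. \<rho> (V b z)) x) + d)"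
    and ts: "ts \<noteq> []" "\<forall>(T, V)\<in>set ts. T \<in> LE k k \<and> V \<in> feat s" using assms(1) by auto
  obtain us e where V: "V = (\<lambda>b x. (\<Sum>(T, V)\<leftarrow>us. T (\<lambda>z. \<rho> (V b z)) x) + e)"
    and us: "us \<noteq> []" "\<forall>(T, V)\<in>set us. T \<in> LE k k \<and> V \<in> feat s" using assms(2) by auto
  have "(\<lambda>b x. U b x + V b x) = (\<lambda>b x. (\<Sum>(T, V)\<leftarrow>ts @ us. T (\<lambda>z. \<rho> (V b z)) x) + (d + e))"
    by (simp add: U V algebra_simps)
  moreover have "ts @ us \<noteq> []" "\<forall>(T, V)\<in>set (ts @ us). T \<in> LE k k \<and> V \<in> feat s"
    using ts us by auto
  ultimately show ?thesis by (intro feat_SucI)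
qed

lemma feat_step:
  assumes "V \<in> feat s" "T \<in> LE k k"
  shows "(\<lambda>b x. T (\<lambda>z. \<rho> (V b z)) x) \<in> feat (Suc s)"
proof -
  have "(\<lambda>b x. T (\<lambda>z. \<rho> (V b z)) x) = (\<lambda>b x. (\<Sum>(T, V)\<leftarrow>[(T, V)]. T (\<lambda>z. \<rho> (V b z)) x) + 0)"
    by simp
  moreover have "[(T, V)] \<noteq> []" "\<forall>(T, V)\<in>set [(T, V)]. T \<in> LE k k \<and> V \<in> feat s"
    using assms by auto
  ultimately show ?thesis by (intro feat_SucI)
qed

text \<open>A network whose output layer is still missing. The field \<open>depth\<close> is left
  unconstrained so that layers can be appended.\<close>

definition hidden_net :: "iwn \<Rightarrow> nat \<Rightarrow> nat \<Rightarrow> bool" where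
  "hidden_net N s m \<longleftrightarrow> tdim N 0 = 2 \<and> width N 0 = 2 \<and> width N s = m \<and>
     (\<forall>t\<in>{1..s}. tdim N t = k \<and> 1 \<le> width N t \<and> (\<forall>i<width N t.
       (\<forall>j<width N (t - 1). weight N t i j \<in> LE (tdim N (t - 1)) k) \<and> bias N t i \<in> LE 0 k))"

text \<open>The induction must realise arbitrarily many features in one layer, because the layer
  below has to supply every summand of every feature above it.\<close>

lemma realize_feat:
  assumes "m \<ge> 1" "\<And>i. i < m \<Longrightarrow> U i \<in> feat s"
  shows "\<exists>N. hidden_net N (Suc s) m \<and>
    (\<forall>b. \<forall>i<m. iwn_features \<rho> N (inp b) (Suc s) i = U i b)"
  using assms
proof (induction s arbitrary: m U)
  case 0
  have "\<exists>T p d. U i = (\<lambda>b x. T (inp b p) x + d) \<and> T \<in> LE 2 k \<and> p < 2" if "i < m" for i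
    using 0(2)[OF that] by auto
  then obtain T p d where U: "\<And>i. i < m \<Longrightarrow> U i = (\<lambda>b x. T i (inp b (p i)) x + d i)"
    and T: "\<And>i. i < m \<Longrightarrow> T i \<in> LE 2 k" and p: "\<And>i. i < m \<Longrightarrow> p i < 2" by metis
  \<comment> \<open>Output channel \<open>i\<close> reads input channel \<open>p i\<close>; the zero
    weight disconnects the other input channel.\<close>
  define N where "N = \<lparr>depth = 1, tdim = (\<lambda>t. if t = 0 then 2 else k),
    width = (\<lambda>t. if t = 0 then 2 else m),
    weight = (\<lambda>t i j. if j = p i then T i else mean_op 0 2), bias = (\<lambda>t i. mean_op (d i) 0)\<rparr>"
  have "hidden_net N (Suc 0) m"
    unfolding hidden_net_def N_def using 0(1) T mean_op_LE by auto
  moreover have "iwn_features \<rho> N (inp b) (Suc 0) i = U i b" if i: "i < m" for b i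
  proof
    fix x
    have "(\<Sum>j<2. (if j = p i then T i else mean_op 0 2) (inp b j) x)
        = (\<Sum>j<2. if j = p i then T i (inp b j) x else 0)"
      by (rule sum.cong) (auto simp: mean_op_zero)
    also have "\<dots> = T i (inp b (p i)) x" using p[OF i] by simp
    finally show "iwn_features \<rho> N (inp b) (Suc 0) i x = U i b x"
      by (simp add: layer_def N_def mean_op_one U[OF i])
  qed
  ultimately show ?case by blast
next
  case (Suc s)
  define P where "P = (\<lambda>i ts d. U i = (\<lambda>b x. (\<Sum>(T, V)\<leftarrow>ts. T (\<lambda>z. \<rho> (V b z)) x) + d) \<and> ts \<noteq> [] \<and>
      (\<forall>(T, V)\<in>set ts. T \<in> LE k k \<and> V \<in> feat s))"
  have "\<exists>ts d. P i ts d" if "i < m" for i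
    using Suc.prems(2)[OF that] unfolding P_def by auto
  then obtain ts d where P: "\<And>i. i < m \<Longrightarrow> P i (ts i) (d i)" by metis
  have U: "U i = (\<lambda>b x. (\<Sum>(T, V)\<leftarrow>ts i. T (\<lambda>z. \<rho> (V b z)) x) + d i)" and ne: "ts i \<noteq> []"
    and ts: "\<forall>(T, V)\<in>set (ts i). T \<in> LE k k \<and> V \<in> feat s" if "i < m" for i
    using P[OF that] unfolding P_def by simp_all
  have nth: "fst (ts i ! j) \<in> LE k k" "snd (ts i ! j) \<in> feat s" if "i < m" "j < length (ts i)" for i j
    using ts[OF that(1)] nth_mem[OF that(2)] by (auto simp: case_prod_beta)
  \<comment> \<open>Every summand \<open>j\<close> of every feature \<open>i\<close> gets its own
    channel in the layer below; \<open>\<pi>\<close> numbers these channels.\<close>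
  define K where "K = (SIGMA i:{..<m}. {..<length (ts i)})"
  have finK: "finite K" unfolding K_def by (intro finite_SigmaI) auto
  \<comment> \<open>Nonempty term lists ensure that the layer below has at least one channel, as a
    network requires.\<close>
  have "(0, 0) \<in> K" using Suc.prems(1) ne[of 0] by (auto simp: K_def)
  then have cK: "card K \<ge> 1" using finK by (metis One_nat_def Suc_leI card_gt_0_iff empty_iff)
  obtain \<pi> where \<pi>: "bij_betw \<pi> {0..<card K} K" using ex_bij_betw_nat_finite[OF finK] by blast
  have \<pi>K: "\<pi> q \<in> K" if "q < card K" for q using \<pi> that by (auto simp: bij_betw_def)
  define V where "V = (\<lambda>q. snd (ts (fst (\<pi> q)) ! snd (\<pi> q)))"
  have VF: "V q \<in> feat s" if "q < card K" for q
    using \<pi>K[OF that] nth(2) by (auto simp: V_def K_def)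
  from Suc.IH[of "card K" V, OF cK VF] obtain N where N: "hidden_net N (Suc s) (card K)"
    and NV: "\<And>b q. q < card K \<Longrightarrow> iwn_features \<rho> N (inp b) (Suc s) q = V q b" by blast
  let ?s = "Suc (Suc s)"
  define N' where "N' = N\<lparr>tdim := (tdim N)(?s := k), width := (width N)(?s := m),
    weight := (weight N)(?s := (\<lambda>i q. if fst (\<pi> q) = i then fst (ts i ! snd (\<pi> q)) else mean_op 0 k)),
    bias := (bias N)(?s := (\<lambda>i. mean_op (d i) 0))\<rparr>"
  have N'_old: "tdim N' t = tdim N t" "width N' t = width N t" "weight N' t = weight N t" "bias N' t = bias N t"
    if "t \<noteq> ?s" for t using that by (simp_all add: N'_def)
  have N'_new: "tdim N' ?s = k" "width N' ?s = m" "bias N' ?s = (\<lambda>i. mean_op (d i) 0)"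
    "weight N' ?s = (\<lambda>i q. if fst (\<pi> q) = i then fst (ts i ! snd (\<pi> q)) else mean_op 0 k)"
    by (simp_all add: N'_def)
  have wN: "width N (Suc s) = card K" "tdim N (Suc s) = k"
    using N by (auto simp: hidden_net_def)
  have "hidden_net N' ?s m"
    unfolding hidden_net_def
  proof (intro conjI ballI)
    show "tdim N' 0 = 2" "width N' 0 = 2" using N N'_old[of 0] by (simp_all add: hidden_net_def)
    show "width N' ?s = m" by (rule N'_new)
    fix t assume t: "t \<in> {1..?s}"
    have "tdim N' t = k \<and> 1 \<le> width N' t \<and> (\<forall>i<width N' t.
        (\<forall>j<width N' (t - 1). weight N' t i j \<in> LE (tdim N' (t - 1)) k) \<and> bias N' t i \<in> LE 0 k)"
    proof (cases "t = ?s")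
      case True
      have "weight N' ?s i j \<in> LE k k" if "i < m" "j < card K" for i j
        using \<pi>K[OF that(2)] nth(1) mean_op_LE by (auto simp: N'_new K_def)
      then show ?thesis
        using True Suc.prems(1) wN mean_op_LE by (simp add: N'_new(1,2,3) N'_old(1,2)[of "Suc s"])
    next
      case False
      then have "t \<in> {1..Suc s}" "t - 1 \<noteq> ?s" using t by auto
      then show ?thesis
        using N unfolding hidden_net_def N'_old[OF False] N'_old[OF \<open>t - 1 \<noteq> ?s\<close>] by blast
    qed
    then show "tdim N' t = k" "1 \<le> width N' t"
      "\<forall>i<width N' t. (\<forall>j<width N' (t - 1). weight N' t i j \<in> LE (tdim N' (t - 1)) k) \<and> bias N' t i \<in> LE 0 k"
      by blast+
  qed
  moreover have "iwn_features \<rho> N' (inp b) ?s i = U i b" if i: "i < m" for b i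
  proof
    fix x
    have old: "iwn_features \<rho> N' (inp b) (Suc s) = iwn_features \<rho> N (inp b) (Suc s)"
      by (rule iwn_features_cong) (use N'_old in auto)
    \<comment> \<open>The contribution of channel \<open>(i', j)\<close> to output channel
      \<open>i\<close>. It vanishes for \<open>i' \<noteq> i\<close>, which reflects the block
      structure of the weights.\<close>
    define h where "h = (\<lambda>(i', j). if i' = i then fst (ts i ! j) (\<lambda>z. \<rho> (snd (ts i ! j) b z)) x else 0)"
    have "(\<Sum>q<card K. weight N' ?s i q (\<rho> \<circ> iwn_features \<rho> N' (inp b) (Suc s) q) x) = (\<Sum>q<card K. h (\<pi> q))"
    proof (rule sum.cong[OF refl])
      fix q assume q: "q \<in> {..<card K}"
      then have "iwn_features \<rho> N' (inp b) (Suc s) q = V q b"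
        unfolding old by (intro NV) simp
      then have f: "\<rho> \<circ> iwn_features \<rho> N' (inp b) (Suc s) q = (\<lambda>z. \<rho> (V q b z))" 
        by (simp only:) (rule ext, simp)
      show "weight N' ?s i q (\<rho> \<circ> iwn_features \<rho> N' (inp b) (Suc s) q) x = h (\<pi> q)"
        unfolding f N'_new by (cases "\<pi> q") (simp add: h_def V_def mean_op_zero)
    qed
    also have "\<dots> = (\<Sum>z\<in>K. h z)"
      using sum.reindex_bij_betw[OF \<pi>, of h] by (simp add: atLeast0LessThan)
    also have "\<dots> = (\<Sum>i'<m. \<Sum>j<length (ts i'). h (i', j))"
      unfolding K_def by (subst sum.Sigma) auto
    also have "\<dots> = (\<Sum>i'<m. if i' = i then \<Sum>j<length (ts i). fst (ts i ! j) (\<lambda>z. \<rho> (snd (ts i ! j) b z)) x else 0)"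
      by (rule sum.cong) (auto simp: h_def)
    also have "\<dots> = (\<Sum>j<length (ts i). fst (ts i ! j) (\<lambda>z. \<rho> (snd (ts i ! j) b z)) x)"
      using i by simp
    also have "\<dots> = (\<Sum>(T, V)\<leftarrow>ts i. T (\<lambda>z. \<rho> (V b z)) x)"
      by (simp add: sum_list_sum_nth case_prod_beta atLeast0LessThan)
    finally have sum: "(\<Sum>q<card K. weight N' ?s i q (\<rho> \<circ> iwn_features \<rho> N' (inp b) (Suc s) q) x)
      = (\<Sum>(T, V)\<leftarrow>ts i. T (\<lambda>z. \<rho> (V b z)) x)" .
    have "iwn_features \<rho> N' (inp b) ?s i x =
        (\<Sum>q<width N' (Suc s). weight N' ?s i q (\<rho> \<circ> iwn_features \<rho> N' (inp b) (Suc s) q) x) + d i"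
      unfolding iwn_features.simps(2)[of \<rho> N' "inp b" "Suc s"] layer_def
      by (simp add: N'_new(3) mean_op_one del: iwn_features.simps)
    also have "width N' (Suc s) = card K" by (simp add: N'_old wN)
    finally show "iwn_features \<rho> N' (inp b) ?s i x = U i b x"
      unfolding sum by (simp add: U[OF i])
  qed
  ultimately show ?case by blast
qed

text \<open>The output layer takes the mean over the cube. It sees the features only after the
  nonlinearity, so the realised quantity is the mean of \<open>\<rho> \<circ> U\<close> and not of
  \<open>U\<close>.\<close>

lemma realize_integral:
  assumes U: "U \<in> feat s"
  shows "\<exists>N. is_iwn N \<and> iwn_order N \<le> k \<and>
    (\<forall>b. iwn_features \<rho> N (inp b) (depth N) 0 (\<lambda>_. undefined) = (\<integral>x. \<rho> (U b x) \<partial>cube k))"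
proof -
  obtain N where N: "hidden_net N (Suc s) 1" and NU: "\<And>b. iwn_features \<rho> N (inp b) (Suc s) 0 = U b"
    using realize_feat[of 1 "\<lambda>_. U" s] U by auto
  let ?s = "Suc (Suc s)"
  define N' where "N' = \<lparr>depth = ?s, tdim = (tdim N)(?s := 0), width = (width N)(?s := 1),
    weight = (weight N)(?s := (\<lambda>i q. mean_op 1 k)), bias = (bias N)(?s := (\<lambda>i. mean_op 0 0))\<rparr>"
  have N'_old: "tdim N' t = tdim N t" "width N' t = width N t" "weight N' t = weight N t" "bias N' t = bias N t"
    if "t \<noteq> ?s" for t using that by (simp_all add: N'_def)
  have N'_new: "depth N' = ?s" "tdim N' ?s = 0" "width N' ?s = 1" "bias N' ?s = (\<lambda>i. mean_op 0 0)"
    "weight N' ?s = (\<lambda>i q. mean_op 1 k)"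
    by (simp_all add: N'_def)
  have old: "tdim N t = k" "1 \<le> width N t"
    "\<And>i j. i < width N t \<Longrightarrow> j < width N (t - 1) \<Longrightarrow> weight N t i j \<in> LE (tdim N (t - 1)) k"
    "\<And>i. i < width N t \<Longrightarrow> bias N t i \<in> LE 0 k" if "t \<in> {1..Suc s}" for t
    using N that unfolding hidden_net_def by blast+
  have N0: "tdim N 0 = 2" "width N 0 = 2" "width N (Suc s) = 1" using N by (auto simp: hidden_net_def)
  have "is_iwn N'"
    unfolding is_iwn_def N'_new(1)
  proof (intro conjI allI ballI impI)
    show "1 \<le> ?s" by simp
    show "tdim N' 0 = 2" "width N' 0 = 2" using N0 by (simp_all add: N'_old)
    show "tdim N' ?s = 0" "width N' ?s = 1" by (rule N'_new)+
    fix t assume "t \<le> ?s"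
    then consider "t = 0" | "t = ?s" | "t \<in> {1..Suc s}" by force
    then show "1 \<le> width N' t"
      by cases (use N0 N'_old N'_new old in auto)
  next
    fix t i assume t: "t \<in> {1..?s}" and i: "i < width N' t"
    show "bias N' t i \<in> LE 0 (tdim N' t)"
    proof (cases "t = ?s")
      case False
      then have "t \<in> {1..Suc s}" using t by auto
      then show ?thesis using old i by (simp add: N'_old[OF False])
    qed (simp only: N'_new mean_op_LE)
    fix j assume j: "j < width N' (t - 1)"
    show "weight N' t i j \<in> LE (tdim N' (t - 1)) (tdim N' t)"
    proof (cases "t = ?s")
      case True
      then show ?thesis using old(1)[of "Suc s"] by (simp add: N'_new N'_old mean_op_LE)
    next
      case False
      then have "t \<in> {1..Suc s}" "t - 1 \<noteq> ?s" using t by auto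
      then show ?thesis
        using old(1,3) i j unfolding N'_old[OF False] N'_old[OF \<open>t - 1 \<noteq> ?s\<close>] by metis
    qed
  qed
  moreover have "iwn_order N' \<le> k"
    unfolding iwn_order_def N'_new(1)
  proof (rule Max.boundedI)
    fix a assume "a \<in> tdim N' ` {1..?s}"
    then obtain t where t: "t \<in> {1..?s}" "a = tdim N' t" by blast
    show "a \<le> k"
    proof (cases "t = ?s")
      case False
      then show ?thesis using t old(1)[of t] N'_old(1)[OF False] by auto
    qed (simp add: t N'_new)
  qed auto
  moreover have "iwn_features \<rho> N' (inp b) (depth N') 0 (\<lambda>_. undefined) = (\<integral>x. \<rho> (U b x) \<partial>cube k)" for b
  proof -
    have "iwn_features \<rho> N' (inp b) (Suc s) = iwn_features \<rho> N (inp b) (Suc s)"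
      by (rule iwn_features_cong) (use N'_old in auto)
    then have "iwn_features \<rho> N' (inp b) (Suc s) 0 = U b" by (simp only: NU)
    then have "iwn_features \<rho> N' (inp b) ?s 0 (\<lambda>_. undefined) =
        mean_op 1 k (\<rho> \<circ> U b) (\<lambda>_. undefined)"
      unfolding iwn_features.simps(2)[of \<rho> N' "inp b" "Suc s"] layer_def
      by (simp add: N'_new N'_old N0 mean_op_zero del: iwn_features.simps)
    then show ?thesis unfolding N'_new(1) by (simp add: averaging_def del: iwn_features.simps)
  qed
  ultimately show ?thesis by blast
qed

end


section \<open>The algebra of features\<close>

text \<open>Lipschitz functions preserve square integrability, so ridge sums may be applied to
  features that are not known to be bounded.\<close>

lemma ridge_sum_lipschitz:
  assumes lip: "L-lipschitz_on UNIV \<rho>" and q: "ridge_sum \<rho> q"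
  shows "\<exists>C. C-lipschitz_on UNIV q"
  using q
proof (induction rule: ridge_sum.induct)
  case (unit c a b)
  have "(\<bar>c\<bar> * L * \<bar>a\<bar>)-lipschitz_on UNIV (\<lambda>t. c * \<rho> (a * t + b))"
  proof (rule lipschitz_onI)
    fix x y :: real
    have "\<bar>\<rho> (a * x + b) - \<rho> (a * y + b)\<bar> \<le> L * \<bar>a * x + b - (a * y + b)\<bar>"
      by (rule lipschitz_bound[OF lip])
    also have "\<bar>a * x + b - (a * y + b)\<bar> = \<bar>a\<bar> * \<bar>x - y\<bar>"
      by (simp add: abs_mult[symmetric] right_diff_distrib)
    finally have "\<bar>c\<bar> * \<bar>\<rho> (a * x + b) - \<rho> (a * y + b)\<bar> \<le> \<bar>c\<bar> * (L * (\<bar>a\<bar> * \<bar>x - y\<bar>))"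
      by (rule mult_left_mono) simp
    then show "dist (c * \<rho> (a * x + b)) (c * \<rho> (a * y + b)) \<le> \<bar>c\<bar> * L * \<bar>a\<bar> * dist x y"
      by (simp add: dist_real_def abs_mult[symmetric] right_diff_distrib mult.assoc)
  qed (use lipschitz_on_nonneg[OF lip] in simp)
  then show ?case by blast
next
  case (add p q)
  then obtain C D where "C-lipschitz_on UNIV p" "D-lipschitz_on UNIV q" by blast
  then show ?case using lipschitz_on_add by blast
qed

context tensor_network
begin

abbreviation feat_closure :: "nat \<Rightarrow> (bool \<Rightarrow> tensor) set" where
  "feat_closure s \<equiv> l2_closure k (feat s)"

lemma all_feat_sq: "\<forall>F\<in>feat s. \<forall>b. F b \<in> sq_integrable k"
  using feat_sq by blast

lemma all_feat_affine: "\<forall>F\<in>feat s. \<forall>c d. (\<lambda>b x. c * F b x + d) \<in> feat s"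
  using feat_affine by blast

lemma all_feat_add: "\<forall>F\<in>feat (Suc s). \<forall>G\<in>feat (Suc s). (\<lambda>b x. F b x + G b x) \<in> feat (Suc s)"
  using feat_add by blast

lemmas feat_closure_closed = l2_closure_closed[OF all_feat_sq]
  and feat_closure_AE = l2_closure_AE[OF all_feat_sq]
  and feat_closure_affine = l2_closure_affine[OF all_feat_sq all_feat_affine]
  and feat_closure_add = l2_closure_add[OF all_feat_sq all_feat_add]

text \<open>Composing with \<open>\<rho>\<close> and then applying \<open>T\<close> is Lipschitz on
  L2, with squared constant at most \<open>K\<close>, so approximants of \<open>U\<close> give
  approximants one layer higher.\<close>

lemma feat_closure_step:
  assumes U: "U \<in> feat_closure s" and T: "T \<in> LE k k"
  shows "(\<lambda>b. T (\<lambda>z. \<rho> (U b z))) \<in> feat_closure (Suc s)"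
proof (rule l2_closureI)
  note sq = sq_integrable_lipschitz[OF lip]
  show "T (\<lambda>z. \<rho> (U b z)) \<in> sq_integrable k" for b
    by (rule LE_sq[OF T sq[OF l2_closure_sq[OF U]]])
  fix \<epsilon> :: real assume e: "\<epsilon> > 0"
  obtain C where C: "C > 0" "\<And>U V. U \<in> sq_integrable k \<Longrightarrow> V \<in> sq_integrable k \<Longrightarrow>
      sqdist k (T U) (T V) \<le> C * sqdist k U V" using LE_sqdist[OF T] by blast
  define K where "K = C * (L\<^sup>2 + 1)"
  have L1: "L\<^sup>2 + 1 > 0" by (simp add: add_nonneg_pos)
  then have K: "K > 0" using C(1) by (simp add: K_def)
  then have "\<epsilon> / K > 0" using e by simp
  then obtain F where F: "F \<in> feat s" "\<And>b. sqdist k (U b) (F b) \<le> \<epsilon> / K"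
    using l2_closure_approx[OF U] by blast
  have "sqdist k (T (\<lambda>z. \<rho> (U b z))) (T (\<lambda>z. \<rho> (F b z))) \<le> \<epsilon>" for b
  proof -
    have "sqdist k (T (\<lambda>z. \<rho> (U b z))) (T (\<lambda>z. \<rho> (F b z)))
        \<le> C * sqdist k (\<lambda>z. \<rho> (U b z)) (\<lambda>z. \<rho> (F b z))"
      by (rule C(2)[OF sq[OF l2_closure_sq[OF U]] sq[OF feat_sq[OF F(1)]]])
    also have "\<dots> \<le> C * (L\<^sup>2 * sqdist k (U b) (F b))"
      using C(1) sqdist_lipschitz[OF lip l2_closure_sq[OF U] feat_sq[OF F(1)]]
      by (intro mult_left_mono) auto
    also have "\<dots> \<le> C * ((L\<^sup>2 + 1) * (\<epsilon> / K))"
      using C(1) F(2)[of b] sqdist_nonneg by (intro mult_left_mono mult_mono) auto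
    also have "\<dots> = \<epsilon>" using L1 C(1) by (simp add: K_def less_imp_neq[THEN not_sym])
    finally show ?thesis .
  qed
  then show "\<exists>F\<in>feat (Suc s). \<forall>b. sqdist k (T (\<lambda>z. \<rho> (U b z))) (F b) \<le> \<epsilon>"
    using feat_step[OF F(1) T] by (intro bexI[of _ "\<lambda>b x. T (\<lambda>z. \<rho> (F b z)) x"]) auto
qed

text \<open>The inner affine maps are absorbed by the layer of \<open>U\<close>, the outer
  coefficients and the sum by the next one, using linearity of \<open>T\<close>. A ridge sum
  followed by an operator thus costs one layer in total.\<close>

lemma feat_closure_ridge_sum:
  assumes U: "U \<in> feat_closure s" and T: "T \<in> LE k k" and q: "ridge_sum \<rho> q"
  shows "(\<lambda>b. T (\<lambda>z. q (U b z))) \<in> feat_closure (Suc s)"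
  using q
proof (induction rule: ridge_sum.induct)
  case (unit c a d)
  have Ua: "(\<lambda>b x. a * U b x + d) \<in> feat_closure s" by (rule feat_closure_affine[OF U])
  have sq: "(\<lambda>z. \<rho> (a * U b z + d)) \<in> sq_integrable k" for b
    by (rule sq_integrable_lipschitz[OF lip l2_closure_sq[OF Ua]])
  have "(\<lambda>b x. c * T (\<lambda>z. \<rho> (a * U b z + d)) x + 0) \<in> feat_closure (Suc s)"
    by (rule feat_closure_affine[OF feat_closure_step[OF Ua T]])
  then show ?case
  proof (rule feat_closure_AE)
    fix b
    show "T (\<lambda>z. c * \<rho> (a * U b z + d)) \<in> sq_integrable k"
      by (rule LE_sq[OF T sq_integrable_scale[OF sq]])
    show "AE x in cube k. T (\<lambda>z. c * \<rho> (a * U b z + d)) x = c * T (\<lambda>z. \<rho> (a * U b z + d)) x + 0"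
      using LE_scale[OF T sq, of c b] by simp
  qed
next
  case (add p q)
  obtain C D where "C-lipschitz_on UNIV p" "D-lipschitz_on UNIV q"
    using ridge_sum_lipschitz[OF lip] add.hyps by blast
  then have sq: "(\<lambda>z. p (U b z)) \<in> sq_integrable k" "(\<lambda>z. q (U b z)) \<in> sq_integrable k" for b
    using sq_integrable_lipschitz l2_closure_sq[OF U] by blast+
  from feat_closure_add[OF add.IH] show ?case
  proof (rule feat_closure_AE)
    fix b
    show "T (\<lambda>z. p (U b z) + q (U b z)) \<in> sq_integrable k"
      by (rule LE_sq[OF T sq_integrable_add[OF sq]])
    show "AE x in cube k. T (\<lambda>z. p (U b z) + q (U b z)) x = T (\<lambda>z. p (U b z)) x + T (\<lambda>z. q (U b z)) x"
      by (rule LE_add[OF T sq])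
  qed
qed

text \<open>\<open>ridge_approximable\<close> controls functions only on bounded intervals, so it
  can be exploited only for tensors with values in such an interval.\<close>

definition bounded_pair :: "(bool \<Rightarrow> tensor) \<Rightarrow> bool" where
  "bounded_pair U \<longleftrightarrow> (\<forall>b. U b \<in> borel_measurable (cube k)) \<and>
     (\<exists>B. \<forall>b. \<forall>x\<in>space (cube k). \<bar>U b x\<bar> \<le> B)"

lemma bounded_pair_sq: "bounded_pair U \<Longrightarrow> U b \<in> sq_integrable k"
  unfolding bounded_pair_def using sq_integrable_bounded by blast

lemma bounded_pairD:
  assumes "bounded_pair U"
  shows "\<exists>B>0. \<forall>b. \<forall>x\<in>space (cube k). \<bar>U b x\<bar> \<le> B"
proof -
  obtain B where B: "\<And>b x. x \<in> space (cube k) \<Longrightarrow> \<bar>U b x\<bar> \<le> B"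
    using assms unfolding bounded_pair_def by blast
  show ?thesis
  proof (intro exI[of _ "\<bar>B\<bar> + 1"] conjI allI ballI)
    show "\<bar>B\<bar> + 1 > 0" by simp
    show "\<bar>U b x\<bar> \<le> \<bar>B\<bar> + 1" if "x \<in> space (cube k)" for b x
      using B[OF that, of b] by linarith
  qed
qed

lemma bounded_pairI:
  assumes "\<And>b. U b \<in> borel_measurable (cube k)" "\<And>b x. x \<in> space (cube k) \<Longrightarrow> \<bar>U b x\<bar> \<le> B"
  shows "bounded_pair U"
  using assms unfolding bounded_pair_def by blast

lemma bounded_pair_comp:
  assumes U: "bounded_pair U" and q: "continuous_on UNIV (q :: real \<Rightarrow> real)"
  shows "bounded_pair (\<lambda>b x. q (U b x))"
proof -
  obtain B where B: "B > 0" "\<And>b x. x \<in> space (cube k) \<Longrightarrow> \<bar>U b x\<bar> \<le> B" using bounded_pairD[OF U] by blast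
  have "bounded (q ` {-B..B})"
    using q by (intro compact_imp_bounded compact_continuous_image) (auto intro: continuous_on_subset)
  then obtain C where C: "\<And>t. t \<in> {-B..B} \<Longrightarrow> \<bar>q t\<bar> \<le> C"
    unfolding bounded_iff real_norm_def by blast
  show ?thesis
  proof (rule bounded_pairI)
    show "(\<lambda>x. q (U b x)) \<in> borel_measurable (cube k)" for b
      using U borel_measurable_continuous_onI[OF q]
      by (intro measurable_compose[of "U b" _ borel q]) (auto simp: bounded_pair_def)
    show "\<bar>q (U b x)\<bar> \<le> C" if "x \<in> space (cube k)" for b x
      using B(2)[OF that, of b] by (intro C) auto
  qed
qed

lemma bounded_pair_add:
  assumes "bounded_pair U" "bounded_pair V"
  shows "bounded_pair (\<lambda>b x. U b x + V b x)"
proof -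
  obtain B where B: "\<And>b x. x \<in> space (cube k) \<Longrightarrow> \<bar>U b x\<bar> \<le> B" using bounded_pairD[OF assms(1)] by blast
  obtain C where C: "\<And>b x. x \<in> space (cube k) \<Longrightarrow> \<bar>V b x\<bar> \<le> C" using bounded_pairD[OF assms(2)] by blast
  show ?thesis
  proof (rule bounded_pairI)
    show "(\<lambda>x. U b x + V b x) \<in> borel_measurable (cube k)" for b
      using assms by (intro borel_measurable_add) (auto simp: bounded_pair_def)
    show "\<bar>U b x + V b x\<bar> \<le> B + C" if "x \<in> space (cube k)" for b x
      using B[OF that, of b] C[OF that, of b] by linarith
  qed
qed

lemma feat_closure_ridge_approximable:
  assumes U: "U \<in> feat_closure s" "bounded_pair U" and T: "T \<in> LE k k"
    and q: "ridge_approximable \<rho> q" "continuous_on UNIV q"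
  shows "(\<lambda>b. T (\<lambda>z. q (U b z))) \<in> feat_closure (Suc s)"
proof (rule feat_closure_closed)
  have sq: "(\<lambda>z. q (U b z)) \<in> sq_integrable k" for b
    by (rule bounded_pair_sq[OF bounded_pair_comp[OF U(2) q(2)]])
  then show "T (\<lambda>z. q (U b z)) \<in> sq_integrable k" for b by (rule LE_sq[OF T])
  fix \<epsilon> :: real assume e: "\<epsilon> > 0"
  obtain C where C: "C > 0" "\<And>U V. U \<in> sq_integrable k \<Longrightarrow> V \<in> sq_integrable k \<Longrightarrow>
      sqdist k (T U) (T V) \<le> C * sqdist k U V" using LE_sqdist[OF T] by blast
  obtain B where B: "B > 0" "\<And>b x. x \<in> space (cube k) \<Longrightarrow> \<bar>U b x\<bar> \<le> B" using bounded_pairD[OF U(2)] by blast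
  \<comment> \<open>A uniform error is squared in \<open>sqdist\<close> and then multiplied by the
    operator constant \<open>C\<close>.\<close>
  have "sqrt (\<epsilon> / C) > 0" using e C(1) by simp
  then obtain p where p: "ridge_sum \<rho> p" "\<And>t. \<bar>t\<bar> \<le> B \<Longrightarrow> \<bar>q t - p t\<bar> \<le> sqrt (\<epsilon> / C)"
    using ridge_approximableD[OF q(1)] by metis
  obtain D where "D-lipschitz_on UNIV p" using ridge_sum_lipschitz[OF lip p(1)] by blast
  then have sqp: "(\<lambda>z. p (U b z)) \<in> sq_integrable k" for b
    using sq_integrable_lipschitz l2_closure_sq[OF U(1)] by blast
  have "sqdist k (T (\<lambda>z. q (U b z))) (T (\<lambda>z. p (U b z))) \<le> \<epsilon>" for b
  proof -
    have "sqdist k (\<lambda>z. q (U b z)) (\<lambda>z. p (U b z)) \<le> (sqrt (\<epsilon> / C))\<^sup>2"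
      by (rule sqdist_uniform[OF sq sqp]) (rule p(2)[OF B(2)])
    also have "\<dots> = \<epsilon> / C" using e C(1) by simp
    finally have "C * sqdist k (\<lambda>z. q (U b z)) (\<lambda>z. p (U b z)) \<le> \<epsilon>"
      using C(1) by (simp add: field_simps)
    then show ?thesis using C(2)[OF sq[of b] sqp[of b]] by linarith
  qed
  then show "\<exists>V\<in>feat_closure (Suc s). \<forall>b. sqdist k (T (\<lambda>z. q (U b z))) (V b) \<le> \<epsilon>"
    by (intro bexI[OF _ feat_closure_ridge_sum[OF U(1) T p(1)]] allI)
qed

definition feature_algebra :: "(bool \<Rightarrow> tensor) set" where
  "feature_algebra = {U. bounded_pair U \<and> (\<exists>s. U \<in> feat_closure s)}"

lemma id_op: "reindex_op 1 (\<lambda>i. i) k \<in> LE k k"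
  by (rule reindex_op_LE) auto

text \<open>Points of the cube are extensional, so restricting them to \<open>{..<k}\<close> changes
  nothing.\<close>

lemma id_op_apply:
  assumes "x \<in> space (cube k)"
  shows "reindex_op 1 (\<lambda>i. i) k U x = U x"
proof -
  have "restrict x {..<k} = x"
    using assms unfolding space_cube by (rule PiE_restrict)
  then show ?thesis by (simp add: reindex_op_apply)
qed

lemma feat_closure_comp:
  assumes U: "U \<in> feat_closure s" "bounded_pair U" and q: "ridge_approximable \<rho> q" "continuous_on UNIV q"
  shows "(\<lambda>b x. q (U b x)) \<in> feat_closure (Suc s)"
proof (rule feat_closure_AE[OF feat_closure_ridge_approximable[OF U id_op q]])
  show "(\<lambda>x. q (U b x)) \<in> sq_integrable k" for b
    by (rule bounded_pair_sq[OF bounded_pair_comp[OF U(2) q(2)]])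
  show "AE x in cube k. q (U b x) = reindex_op 1 (\<lambda>i. i) k (\<lambda>z. q (U b z)) x" for b
    by (intro AE_I2) (simp only: id_op_apply)
qed

lemma feat_closure_LE:
  assumes U: "U \<in> feat_closure s" "bounded_pair U" and T: "T \<in> LE k k"
  shows "(\<lambda>b. T (U b)) \<in> feat_closure (Suc s)"
  using feat_closure_ridge_approximable[OF U T ridge_approximable_id[OF lip nonpoly]] by simp

text \<open>A further layer can approximate the identity. This brings features of different depths
  to a common depth before they are added.\<close>

lemma feat_closure_Suc:
  assumes "U \<in> feat_closure s" "bounded_pair U"
  shows "U \<in> feat_closure (Suc s)"
  using feat_closure_comp[OF assms ridge_approximable_id[OF lip nonpoly]] by simp

lemma feat_closure_mono:
  assumes "U \<in> feat_closure s" "bounded_pair U" "s \<le> t"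
  shows "U \<in> feat_closure t"
  using assms(3)
proof (induction t rule: dec_induct)
  case (step n)
  then show ?case using feat_closure_Suc assms(2) by blast
qed (fact assms(1))

lemma feature_algebra_LE:
  assumes U: "U \<in> feature_algebra" and T: "T \<in> LE k k" and bd: "bounded_pair (\<lambda>b. T (U b))"
  shows "(\<lambda>b. T (U b)) \<in> feature_algebra"
  using U bd feat_closure_LE[OF _ _ T, of U] unfolding feature_algebra_def by blast

lemma feature_algebra_affine:
  assumes U: "U \<in> feature_algebra"
  shows "(\<lambda>b x. c * U b x + d) \<in> feature_algebra"
proof -
  have "bounded_pair (\<lambda>b x. c * U b x + d)"
    using U by (intro bounded_pair_comp[of U "\<lambda>t. c * t + d"]) (auto simp: feature_algebra_def intro!: continuous_intros)
  then show ?thesis using U feat_closure_affine unfolding feature_algebra_def by blast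
qed

lemma feature_algebra_add:
  assumes U: "U \<in> feature_algebra" and V: "V \<in> feature_algebra"
  shows "(\<lambda>b x. U b x + V b x) \<in> feature_algebra"
proof -
  obtain s t where s: "bounded_pair U" "U \<in> feat_closure s" and t: "bounded_pair V" "V \<in> feat_closure t"
    using U V unfolding feature_algebra_def by blast
  \<comment> \<open>The extra \<open>Suc\<close> is there because closure under addition is
    available only above level 0.\<close>
  have "U \<in> feat_closure (Suc (max s t))" "V \<in> feat_closure (Suc (max s t))"
    by (rule feat_closure_mono[OF s(2,1)], simp, rule feat_closure_mono[OF t(2,1)], simp)
  then show ?thesis
    using feat_closure_add bounded_pair_add[OF s(1) t(1)] unfolding feature_algebra_def by blast
qed

lemma feature_algebra_square:
  assumes U: "U \<in> feature_algebra"
  shows "(\<lambda>b x. (U b x)\<^sup>2) \<in> feature_algebra"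
proof -
  obtain s where s: "bounded_pair U" "U \<in> feat_closure s" using U unfolding feature_algebra_def by blast
  have c: "continuous_on UNIV (\<lambda>t::real. t\<^sup>2)" by (intro continuous_intros)
  show ?thesis
    using feat_closure_comp[OF s(2,1) ridge_approximable_square[OF lip nonpoly] c] bounded_pair_comp[OF s(1) c]
    unfolding feature_algebra_def by blast
qed

lemma feature_algebra_mult:
  assumes U: "U \<in> feature_algebra" and V: "V \<in> feature_algebra"
  shows "(\<lambda>b x. U b x * V b x) \<in> feature_algebra"
proof -
  have nV: "(\<lambda>b x. - 1 * V b x + 0) \<in> feature_algebra" by (rule feature_algebra_affine[OF V])
  \<comment> \<open>Polarisation of the product, spelled with neutral terms so that it has the
    literal form produced by the closure lemmas.\<close>
  have "(\<lambda>b x. (1 / 4) * ((U b x + V b x)\<^sup>2 + (- 1 * (U b x + (- 1 * V b x + 0))\<^sup>2 + 0)) + 0) \<in> feature_algebra"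
    by (rule feature_algebra_affine[OF feature_algebra_add[OF
          feature_algebra_square[OF feature_algebra_add[OF U V]]
          feature_algebra_affine[OF feature_algebra_square[OF feature_algebra_add[OF U nV]]]]])
  moreover have "(1 / 4) * ((u + v)\<^sup>2 + (- 1 * (u + (- 1 * v + 0))\<^sup>2 + 0)) + 0 = u * v" for u v :: real
    by (simp add: power2_eq_square field_simps)
  ultimately show ?thesis by (simp only:)
qed

lemma feature_algebra_polynomial:
  assumes U: "U \<in> feature_algebra" and p: "real_polynomial_function (p :: real \<Rightarrow> real)"
  shows "(\<lambda>b x. p (U b x)) \<in> feature_algebra"
  using p
proof (induction rule: real_polynomial_function.induct)
  case (linear f)
  then have *: "f t = f 1 * t + 0" for t
    using linear_simps(5)[OF linear, of t 1] by (simp add: mult.commute)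
  have "(\<lambda>b x. f (U b x)) = (\<lambda>b x. f 1 * U b x + 0)" by (intro ext) (rule *)
  with feature_algebra_affine[OF U] show ?case by (simp only:)
next
  case (const c)
  then show ?case using feature_algebra_affine[OF U, of 0 c] by simp
next
  case (add f g)
  show ?case by (rule feature_algebra_add[OF add.IH])
next
  case (mult f g)
  show ?case by (rule feature_algebra_mult[OF mult.IH])
qed

end


section \<open>The lattice of limits of features\<close>

context tensor_network
begin

lemma feature_algebra_sq: "U \<in> feature_algebra \<Longrightarrow> U b \<in> sq_integrable k"
  unfolding feature_algebra_def using bounded_pair_sq by blast

text \<open>The second closure: \<open>feature_algebra\<close> contains only bounded tensors, each a
  limit at some fixed depth, whereas limits taken here may use growing depth and lose
  boundedness.\<close>

abbreviation feature_space :: "(bool \<Rightarrow> tensor) set" where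
  "feature_space \<equiv> l2_closure k feature_algebra"

lemma all_feature_algebra:
  "\<forall>F\<in>feature_algebra. \<forall>b. F b \<in> sq_integrable k"
  "\<forall>F\<in>feature_algebra. \<forall>c d. (\<lambda>b x. c * F b x + d) \<in> feature_algebra"
  "\<forall>F\<in>feature_algebra. \<forall>G\<in>feature_algebra. (\<lambda>b x. F b x + G b x) \<in> feature_algebra"
  using feature_algebra_sq feature_algebra_affine feature_algebra_add by blast+

lemmas feature_space_superset = l2_closure_superset[OF all_feature_algebra(1)]
  and feature_space_closed = l2_closure_closed[OF all_feature_algebra(1)]
  and feature_space_AE = l2_closure_AE[OF all_feature_algebra(1)]
  and feature_space_lipschitz = l2_closure_lipschitz[OF all_feature_algebra(1)]
  and feature_space_affine = l2_closure_affine[OF all_feature_algebra(1,2)]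
  and feature_space_add = l2_closure_add[OF all_feature_algebra(1,3)]

lemma feature_space_cong:
  assumes U: "U \<in> feature_space" and eq: "\<And>b x. x \<in> space (cube k) \<Longrightarrow> V b x = U b x"
  shows "V \<in> feature_space"
proof (rule feature_space_AE[OF U])
  fix b
  have "U b \<in> borel_measurable (cube k)" using l2_closure_sq[OF U] by (simp add: sq_integrable_def)
  then have "V b \<in> borel_measurable (cube k)" using eq by (simp cong: measurable_cong)
  then show "V b \<in> sq_integrable k"
    by (rule sq_integrable_dominated[OF l2_closure_sq[OF U, of b]]) (simp add: eq)
  show "AE x in cube k. V b x = U b x" using eq by (intro AE_I2)
qed

text \<open>On a bounded feature the absolute value is a uniform limit of polynomials by
  Weierstrass; it extends to all limits because it is 1-Lipschitz.\<close>

lemma feature_space_abs: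
  assumes U: "U \<in> feature_space"
  shows "(\<lambda>b x. \<bar>U b x\<bar>) \<in> feature_space"
proof (rule feature_space_lipschitz[OF U])
  show "1-lipschitz_on UNIV (abs :: real \<Rightarrow> real)"
    by (rule lipschitz_onI) (simp_all add: dist_real_def abs_triangle_ineq3)
  fix V assume V: "V \<in> feature_algebra"
  then have bd: "bounded_pair V" by (simp add: feature_algebra_def)
  have c: "continuous_on UNIV (abs :: real \<Rightarrow> real)" by (intro continuous_intros)
  obtain B where B: "\<And>b x. x \<in> space (cube k) \<Longrightarrow> \<bar>V b x\<bar> \<le> B" using bounded_pairD[OF bd] by blast
  show "(\<lambda>b x. \<bar>V b x\<bar>) \<in> feature_space"
  proof (rule l2_closureI)
    show sq: "(\<lambda>x. \<bar>V b x\<bar>) \<in> sq_integrable k" for b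
      by (rule bounded_pair_sq[OF bounded_pair_comp[OF bd c]])
    fix \<epsilon> :: real assume e: "\<epsilon> > 0"
    have "compact {-B..B}" "continuous_on {-B..B} (abs :: real \<Rightarrow> real)" "0 < sqrt \<epsilon>"
      using e by (auto intro: continuous_intros)
    then obtain p where p: "real_polynomial_function p" "\<And>t. t \<in> {-B..B} \<Longrightarrow> \<bar>\<bar>t\<bar> - p t\<bar> < sqrt \<epsilon>"
      by (rule Stone_Weierstrass_real_polynomial_function) blast
    have pV: "(\<lambda>b x. p (V b x)) \<in> feature_algebra" by (rule feature_algebra_polynomial[OF V p(1)])
    have "sqdist k (\<lambda>x. \<bar>V b x\<bar>) (\<lambda>x. p (V b x)) \<le> (sqrt \<epsilon>)\<^sup>2" for b
    proof (rule sqdist_uniform[OF sq feature_algebra_sq[OF pV]])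
      fix x assume "x \<in> space (cube k)"
      then have "V b x \<in> {-B..B}" using B[of x b] by (simp add: abs_le_iff)
      from p(2)[OF this] show "\<bar>\<bar>V b x\<bar> - p (V b x)\<bar> \<le> sqrt \<epsilon>" by simp
    qed
    then show "\<exists>F\<in>feature_algebra. \<forall>b. sqdist k (\<lambda>x. \<bar>V b x\<bar>) (F b) \<le> \<epsilon>"
      using e by (intro bexI[OF _ pV] allI) simp
  qed
qed

lemma feature_space_max:
  assumes U: "U \<in> feature_space" and V: "V \<in> feature_space"
  shows "(\<lambda>b x. max (U b x) (V b x)) \<in> feature_space"
proof -
  have nV: "(\<lambda>b x. - 1 * V b x + 0) \<in> feature_space" by (rule feature_space_affine[OF V])
  have "(\<lambda>b x. (1 / 2) * ((U b x + V b x) + \<bar>U b x + (- 1 * V b x + 0)\<bar>) + 0) \<in> feature_space"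
    by (rule feature_space_affine[OF feature_space_add[OF feature_space_add[OF U V]
          feature_space_abs[OF feature_space_add[OF U nV]]]])
  moreover have "(1 / 2) * ((u + v) + \<bar>u + (- 1 * v + 0)\<bar>) + 0 = max u v" for u v :: real
    by (simp add: max_def abs_if field_simps)
  ultimately show ?thesis by (simp only:)
qed

lemma feature_space_limit:
  assumes U: "\<And>n. U n \<in> feature_space"
    and bd: "\<And>n b x. x \<in> space (cube k) \<Longrightarrow> \<bar>U n b x\<bar> \<le> B"
    and lim: "\<And>b x. x \<in> space (cube k) \<Longrightarrow> (\<lambda>n. U n b x) \<longlonglongrightarrow> V b x"
  shows "V \<in> feature_space"
proof (rule feature_space_closed)
  interpret prob_space "cube k" by (rule prob_space_cube)
  have mU: "U n b \<in> borel_measurable (cube k)" for n b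
    using l2_closure_sq[OF U] by (simp add: sq_integrable_def)
  have mV: "V b \<in> borel_measurable (cube k)" for b
    by (rule borel_measurable_LIMSEQ_real[where u = "\<lambda>n. U n b", OF lim mU])
  have bV: "\<bar>V b x\<bar> \<le> B" if "x \<in> space (cube k)" for b x
    by (rule LIMSEQ_le_const2[OF tendsto_rabs[OF lim[OF that]]]) (use bd[OF that] in auto)
  show sV: "V b \<in> sq_integrable k" for b by (rule sq_integrable_bounded[OF mV bV])
  have conv: "(\<lambda>n. sqdist k (V b) (U n b)) \<longlonglongrightarrow> 0" for b
  proof -
    have "(\<lambda>n. \<integral>x. (V b x - U n b x)\<^sup>2 \<partial>cube k) \<longlonglongrightarrow> (\<integral>x. 0 \<partial>cube k)"
    proof (rule integral_dominated_convergence[where w = "\<lambda>_. (2 * B)\<^sup>2"])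
      show "(\<lambda>x. (V b x - U n b x)\<^sup>2) \<in> borel_measurable (cube k)" for n
        using integrable_sqdiff[OF sV l2_closure_sq[OF U]] by blast
      show "AE x in cube k. (\<lambda>n. (V b x - U n b x)\<^sup>2) \<longlonglongrightarrow> 0"
      proof (rule AE_I2)
        fix x assume "x \<in> space (cube k)"
        then have "(\<lambda>n. (V b x - U n b x)\<^sup>2) \<longlonglongrightarrow> (V b x - V b x)\<^sup>2"
          by (intro tendsto_intros lim)
        then show "(\<lambda>n. (V b x - U n b x)\<^sup>2) \<longlonglongrightarrow> 0" by simp
      qed
      show "AE x in cube k. norm ((V b x - U n b x)\<^sup>2) \<le> (2 * B)\<^sup>2" for n
      proof (rule AE_I2)
        fix x assume x: "x \<in> space (cube k)"
        have "\<bar>V b x - U n b x\<bar> \<le> \<bar>2 * B\<bar>" using bV[OF x, of b] bd[OF x, of n b] by linarith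
        then show "norm ((V b x - U n b x)\<^sup>2) \<le> (2 * B)\<^sup>2" by (simp add: abs_le_square_iff)
      qed
    qed simp_all
    then show ?thesis by (simp add: sqdist_def)
  qed
  fix \<epsilon> :: real assume e: "\<epsilon> > 0"
  \<comment> \<open>One index \<open>n\<close> has to serve both inputs, hence the conjunction of
    the two eventualities.\<close>
  have "eventually (\<lambda>n. sqdist k (V True) (U n True) < \<epsilon> \<and> sqdist k (V False) (U n False) < \<epsilon>) sequentially"
    using order_tendstoD(2)[OF conv e, of True] order_tendstoD(2)[OF conv e, of False]
    by (rule eventually_conj)
  then obtain n where "sqdist k (V True) (U n True) < \<epsilon>" "sqdist k (V False) (U n False) < \<epsilon>"
    by (auto simp: eventually_sequentially)
  then have "sqdist k (V b) (U n b) \<le> \<epsilon>" for b by (cases b) auto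
  then show "\<exists>U\<in>feature_space. \<forall>b. sqdist k (V b) (U b) \<le> \<epsilon>" by (intro bexI[OF _ U] allI)
qed

text \<open>\<open>bd\<close> keeps the images of bounded features inside
  \<open>feature_algebra\<close>; an L2 bound on the operator does not provide this.\<close>

lemma feature_space_LE:
  assumes U: "U \<in> feature_space" and T: "T \<in> LE k k"
    and bd: "\<And>V. bounded_pair V \<Longrightarrow> bounded_pair (\<lambda>b. T (V b))"
  shows "(\<lambda>b. T (U b)) \<in> feature_space"
proof (rule l2_closureI)
  show "T (U b) \<in> sq_integrable k" for b by (rule LE_sq[OF T l2_closure_sq[OF U]])
  fix \<epsilon> :: real assume e: "\<epsilon> > 0"
  obtain C where C: "C > 0" "\<And>U V. U \<in> sq_integrable k \<Longrightarrow> V \<in> sq_integrable k \<Longrightarrow>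
      sqdist k (T U) (T V) \<le> C * sqdist k U V" using LE_sqdist[OF T] by blast
  have "\<epsilon> / C > 0" using e C(1) by simp
  then obtain V where V: "V \<in> feature_algebra" "\<And>b. sqdist k (U b) (V b) \<le> \<epsilon> / C"
    using l2_closure_approx[OF U] by blast
  have "bounded_pair V" using V(1) by (simp add: feature_algebra_def)
  then have "bounded_pair (\<lambda>b. T (V b))" by (rule bd)
  then have TV: "(\<lambda>b. T (V b)) \<in> feature_algebra" by (rule feature_algebra_LE[OF V(1) T])
  have "sqdist k (T (U b)) (T (V b)) \<le> \<epsilon>" for b
  proof -
    have "C * sqdist k (U b) (V b) \<le> \<epsilon>" using V(2)[of b] C(1) by (simp add: field_simps)
    then show ?thesis using C(2)[OF l2_closure_sq[OF U] feature_algebra_sq[OF V(1)], of b b] by linarith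
  qed
  then show "\<exists>F\<in>feature_algebra. \<forall>b. sqdist k (T (U b)) (F b) \<le> \<epsilon>"
    by (intro bexI[OF _ TV] allI)
qed

lemma bounded_pair_averaging:
  assumes A: "averaging_map k k Q \<tau>" and V: "bounded_pair V"
  shows "bounded_pair (\<lambda>b. averaging 1 \<tau> Q (V b))"
proof -
  interpret averaging_map k k Q \<tau> by (rule A)
  obtain B where B: "\<And>b x. x \<in> space (cube k) \<Longrightarrow> \<bar>V b x\<bar> \<le> B" using bounded_pairD[OF V] by blast
  show ?thesis
  proof (rule bounded_pairI)
    show "averaging 1 \<tau> Q (V b) \<in> borel_measurable (cube k)" for b
      using V by (intro measurable_averaging) (simp add: bounded_pair_def)
    fix b x assume x: "x \<in> space (cube k)"
    have sp: "\<tau> x y \<in> space (cube k)" if "y \<in> space Q" for y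
      using measurable_space[OF measurable_tau, of "(x, y)"] x that by (simp add: space_pair_measure)
    have "\<bar>\<integral>y. V b (\<tau> x y) \<partial>Q\<bar> \<le> B"
    proof (cases "integrable Q (\<lambda>y. V b (\<tau> x y))")
      case True
      have "\<bar>\<integral>y. V b (\<tau> x y) \<partial>Q\<bar> \<le> (\<integral>y. \<bar>V b (\<tau> x y)\<bar> \<partial>Q)" by (rule integral_abs_bound)
      also have "\<dots> \<le> (\<integral>y. B \<partial>Q)" using True B[OF sp] by (intro integral_mono) auto
      finally show ?thesis by (simp add: Q.prob_space)
    next
      case False
      \<comment> \<open>The default value 0 of a non-integrable integral also satisfies the bound,
        so integrability of the section need not be established.\<close>
      have "0 \<le> B" using B[OF x, of b] by linarith
      then show ?thesis using False by (simp add: not_integrable_integral_eq)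
    qed
    then show "\<bar>averaging 1 \<tau> Q (V b) x\<bar> \<le> B" by (simp add: averaging_def)
  qed
qed

lemma feature_space_update:
  assumes "U \<in> feature_space" "j < k"
  shows "(\<lambda>b x. \<integral>y. U b (x(j := y)) \<partial>I01) \<in> feature_space"
proof -
  have "(\<lambda>b. update_op j (U b)) \<in> feature_space"
    by (rule feature_space_LE[OF assms(1) update_op_LE[OF assms(2)]
          bounded_pair_averaging[OF averaging_map_update[OF assms(2)]]])
  then show ?thesis by (simp add: averaging_def)
qed

text \<open>An input of dimension 2 is placed on any two distinct coordinates of the cube; this
  supplies every edge and vertex value of the initial colour.\<close>

lemma feature_space_input:
  assumes p: "p < 2" and \<pi>: "inj_on \<pi> {..<2}" "\<And>i. i < 2 \<Longrightarrow> \<pi> i < k"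
  shows "(\<lambda>b x. inp b p (\<lambda>i\<in>{..<2}. x (\<pi> i))) \<in> feature_space"
proof (rule feature_space_superset)
  let ?T = "reindex_op 1 \<pi> 2"
  have T: "?T \<in> LE 2 k" by (rule reindex_op_LE[OF \<pi>])
  let ?F = "\<lambda>b x. inp b p (\<lambda>i\<in>{..<2}. x (\<pi> i))"
  have F: "?F = (\<lambda>b x. ?T (inp b p) x + 0)" by (simp add: reindex_op_apply)
  have f0: "?F \<in> feat 0" by (rule feat_0I[OF T p F])
  have "?F \<in> feat_closure 0" by (rule l2_closure_superset[OF all_feat_sq f0])
  moreover have "bounded_pair ?F"
  proof -
    obtain B where B: "\<forall>b. \<forall>p<2. \<forall>x\<in>space (cube 2). \<bar>inp b p x\<bar> \<le> B" using bounded_inp by blast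
    have m: "(\<lambda>x. \<lambda>i\<in>{..<2}. x (\<pi> i)) \<in> measurable (cube k) (cube 2)"
      unfolding cube_def by (intro measurable_restrict) (use \<pi> in \<open>auto intro!: measurable_component_singleton\<close>)
    show ?thesis
    proof (rule bounded_pairI)
      show "(\<lambda>x. inp b p (\<lambda>i\<in>{..<2}. x (\<pi> i))) \<in> borel_measurable (cube k)" for b
        by (rule measurable_compose[OF m measurable_inp[OF p]])
      show "\<bar>inp b p (\<lambda>i\<in>{..<2}. x (\<pi> i))\<bar> \<le> B" if "x \<in> space (cube k)" for b x
        using B p measurable_space[OF m that] by blast
    qed
  qed
  ultimately show "?F \<in> feature_algebra" unfolding feature_algebra_def by blast
qed

end


section \<open>Measurability of the colouring\<close>

text \<open>Measurability into a product is tested factor by factor. \<open>ext\<close> is required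
  because points of the product topology are extensional functions.\<close>

lemma measurable_borel_of_product:
  fixes X :: "'i \<Rightarrow> 'a topology"
  assumes I: "countable I" and X: "\<And>i. i \<in> I \<Longrightarrow> \<exists>\<Phi>. euclidean_pullback (X i) \<Phi>"
    and c: "\<And>i. i \<in> I \<Longrightarrow> (\<lambda>\<omega>. c \<omega> i) \<in> measurable N (borel_of (X i))"
    and ext: "\<And>\<omega>. \<omega> \<in> space N \<Longrightarrow> c \<omega> \<in> extensional I"
  shows "c \<in> measurable N (borel_of (product_topology X I))"
proof -
  obtain \<Phi> where \<Phi>: "\<And>i. i \<in> I \<Longrightarrow> euclidean_pullback (X i) (\<Phi> i)" using X by metis
  show ?thesis
  proof (rule measurable_borel_of_pullback[OF euclidean_pullback_product[OF I \<Phi>]])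
    show "c \<in> space N \<rightarrow> topspace (product_topology X I)"
    proof
      fix \<omega> assume w: "\<omega> \<in> space N"
      have "c \<omega> i \<in> topspace (X i)" if "i \<in> I" for i
        using measurable_space[OF c[OF that] w] by simp
      then show "c \<omega> \<in> topspace (product_topology X I)"
        using ext[OF w] by (simp add: PiE_iff)
    qed
    fix n
    obtain j m where jm: "prod_decode n = (j, m)" by fastforce
    define i where "i = from_nat_into I j"
    show "(\<lambda>\<omega>. let (j, m) = prod_decode n; i = from_nat_into I j in if i \<in> I then \<Phi> i (c \<omega> i) m else 0)
      \<in> borel_measurable N"
    proof (cases "i \<in> I")
      case True
      have "continuous_map (X i) euclideanreal (\<lambda>y. \<Phi> i y m)"
        using \<Phi>[OF True] by (simp add: euclidean_pullback_def continuous_map_euclidean_coordinatewise)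
      then have "(\<lambda>\<omega>. \<Phi> i (c \<omega> i) m) \<in> borel_measurable N"
        by (rule measurable_compose[OF c[OF True] continuous_map_imp_measurable_borel_of])
      then show ?thesis using True by (simp add: jm i_def[symmetric])
    qed (simp add: jm i_def[symmetric])
  qed
qed

lemma wl_color_component: "i \<le> s \<Longrightarrow> wl_color k r W f s x i = wl_color k r W f i x i"
proof (induction s)
  case (Suc s)
  then show ?case by (cases "i = Suc s") auto
qed simp

lemma wl_color_extensional: "wl_color k r W f s x \<in> extensional {..s}"
proof (induction s)
  case 0
  show ?case by (simp only: wl_color.simps restrict_extensional)
next
  case (Suc s)
  then show ?case by (auto simp: extensional_def)
qed

section \<open>Consequences of non-separation\<close>

lemma eq_if_close:
  fixes a b :: real
  assumes "\<And>\<epsilon>. \<epsilon> > 0 \<Longrightarrow> \<exists>c. (a - c)\<^sup>2 \<le> \<epsilon> \<and> (b - c)\<^sup>2 \<le> \<epsilon>"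
  shows "a = b"
proof (rule ccontr)
  assume "a \<noteq> b"
  \<comment> \<open>With an eighth on each side, the doubled triangle inequality gives
    \<open>(a - b)\<^sup>2 \<le> (a - b)\<^sup>2 / 2\<close>.\<close>
  then have "(a - b)\<^sup>2 / 8 > 0" by simp
  then obtain c where c: "(a - c)\<^sup>2 \<le> (a - b)\<^sup>2 / 8" "(b - c)\<^sup>2 \<le> (a - b)\<^sup>2 / 8" using assms by blast
  have "(a - b)\<^sup>2 \<le> 2 * (a - c)\<^sup>2 + 2 * (b - c)\<^sup>2"
    using zero_le_power2[of "(a - c) + (b - c)"] by (simp add: power2_eq_square algebra_simps)
  then have "(a - b)\<^sup>2 \<le> (a - b)\<^sup>2 / 2" using c by linarith
  then show False using \<open>a \<noteq> b\<close> by (simp add: field_simps)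
qed

text \<open>The hypothesis to be refuted: no network of order at most \<open>k\<close> separates the
  two inputs.\<close>

locale agreeing_network = tensor_network +
  assumes k: "k > 1"
    and agree: "\<And>N. is_iwn N \<Longrightarrow> iwn_order N \<le> k \<Longrightarrow>
      iwn_features \<rho> N (inp True) (depth N) 0 (\<lambda>_. undefined) =
      iwn_features \<rho> N (inp False) (depth N) 0 (\<lambda>_. undefined)"
begin

lemma feat_agree:
  assumes "U \<in> feat s"
  shows "(\<integral>x. \<rho> (U True x) \<partial>cube k) = (\<integral>x. \<rho> (U False x) \<partial>cube k)"
  using realize_integral[OF assms] agree by metis

lemma feat_closure_agree:
  assumes U: "U \<in> feat_closure s"
  shows "(\<integral>x. \<rho> (U True x) \<partial>cube k) = (\<integral>x. \<rho> (U False x) \<partial>cube k)"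
proof (rule eq_if_close)
  fix \<epsilon> :: real assume e: "\<epsilon> > 0"
  have K: "L\<^sup>2 + 1 > 0" by (simp add: add_nonneg_pos)
  then have "\<epsilon> / (L\<^sup>2 + 1) > 0" using e by simp
  then obtain F where F: "F \<in> feat s" "\<And>b. sqdist k (U b) (F b) \<le> \<epsilon> / (L\<^sup>2 + 1)"
    using l2_closure_approx[OF U] by blast
  note sq = sq_integrable_lipschitz[OF lip]
  have close: "((\<integral>x. \<rho> (U b x) \<partial>cube k) - (\<integral>x. \<rho> (F b x) \<partial>cube k))\<^sup>2 \<le> \<epsilon>" for b
  proof -
    have "((\<integral>x. \<rho> (U b x) \<partial>cube k) - (\<integral>x. \<rho> (F b x) \<partial>cube k))\<^sup>2
        \<le> sqdist k (\<lambda>x. \<rho> (U b x)) (\<lambda>x. \<rho> (F b x))"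
      by (rule integral_diff_le_sqdist[OF sq[OF l2_closure_sq[OF U]] sq[OF feat_sq[OF F(1)]]])
    also have "\<dots> \<le> L\<^sup>2 * sqdist k (U b) (F b)"
      by (rule sqdist_lipschitz[OF lip l2_closure_sq[OF U] feat_sq[OF F(1)]])
    also have "\<dots> \<le> (L\<^sup>2 + 1) * (\<epsilon> / (L\<^sup>2 + 1))"
      using F(2)[of b] sqdist_nonneg by (intro mult_mono) auto
    finally show ?thesis using K by simp
  qed
  show "\<exists>c. ((\<integral>x. \<rho> (U True x) \<partial>cube k) - c)\<^sup>2 \<le> \<epsilon> \<and> ((\<integral>x. \<rho> (U False x) \<partial>cube k) - c)\<^sup>2 \<le> \<epsilon>"
    using close[of True] close[of False] feat_agree[OF F(1)] by auto
qed

text \<open>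
  The means of \<open>U\<close> over the two inputs are themselves features, so \<open>\<rho>\<close> composed with any affine map
  takes the same value at both of them; as \<open>\<rho>\<close> is not constant, they coincide.
\<close>

lemma feature_algebra_agree:
  assumes U: "U \<in> feature_algebra"
  shows "(\<integral>x. U True x \<partial>cube k) = (\<integral>x. U False x \<partial>cube k)"
proof (rule ccontr)
  interpret prob_space "cube k" by (rule prob_space_cube)
  define c where "c = (\<lambda>b. \<integral>x. U b x \<partial>cube k)"
  assume "(\<integral>x. U True x \<partial>cube k) \<noteq> (\<integral>x. U False x \<partial>cube k)"
  then have ne: "c True - c False \<noteq> 0" by (simp add: c_def)
  have "bounded_pair U" using U by (simp add: feature_algebra_def)
  then have "(\<lambda>b. mean_op 1 k (U b)) \<in> feature_algebra"
    by (intro feature_algebra_LE[OF U mean_op_LE] bounded_pair_averaging[OF averaging_map_const])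
  then have "(\<lambda>b x. c b) \<in> feature_algebra" by (simp add: averaging_def c_def)
  then obtain s where s: "(\<lambda>b x. c b) \<in> feat_closure s" unfolding feature_algebra_def by blast
  have "\<rho> t = \<rho> 0" for t
  proof -
    \<comment> \<open>The affine map with slope \<open>a\<close> that sends \<open>c False\<close>
      to 0 sends \<open>c True\<close> to \<open>t\<close>.\<close>
    define a where "a = t / (c True - c False)"
    have "(\<lambda>b x. a * c b + (- a * c False)) \<in> feat_closure s" by (rule feat_closure_affine[OF s])
    from feat_closure_agree[OF this]
    have "\<rho> (a * c True + (- a * c False)) = \<rho> (a * c False + (- a * c False))" by (simp add: prob_space)
    moreover have "a * c True + (- a * c False) = t"
      using ne by (simp add: a_def right_diff_distrib[symmetric] divide_simps)
    ultimately show ?thesis by simp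
  qed
  then have "\<rho> t = poly [:\<rho> 0:] t" for t by simp
  then show False using nonpoly by blast
qed

lemma feature_space_agree:
  assumes U: "U \<in> feature_space"
  shows "(\<integral>x. U True x \<partial>cube k) = (\<integral>x. U False x \<partial>cube k)"
proof (rule eq_if_close)
  fix \<epsilon> :: real assume e: "\<epsilon> > 0"
  obtain V where V: "V \<in> feature_algebra" "\<And>b. sqdist k (U b) (V b) \<le> \<epsilon>"
    using l2_closure_approx[OF U e] by blast
  have "((\<integral>x. U b x \<partial>cube k) - (\<integral>x. V b x \<partial>cube k))\<^sup>2 \<le> \<epsilon>" for b
    using integral_diff_le_sqdist[OF l2_closure_sq[OF U] feature_algebra_sq[OF V(1)], of b b] V(2)[of b]
    by linarith
  from this[of True] this[of False] feature_algebra_agree[OF V(1)]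
  show "\<exists>c. ((\<integral>x. U True x \<partial>cube k) - c)\<^sup>2 \<le> \<epsilon> \<and> ((\<integral>x. U False x \<partial>cube k) - c)\<^sup>2 \<le> \<epsilon>"
    by auto
qed

lemma feature_space_const: "(\<lambda>b x. d) \<in> feature_space"
proof -
  \<comment> \<open>Constants are affine images with slope 0 of an input tensor; placing it on
    coordinates 0 and 1 uses \<open>k > 1\<close>.\<close>
  have "inj_on (\<lambda>i. i) {..<2::nat}" "\<And>i. i < 2 \<Longrightarrow> i < k" using k by auto
  from feature_space_affine[OF feature_space_input[OF _ this], of 0 0 d] show ?thesis by simp
qed

section \<open>The sigma-algebra of feature sets\<close>

definition doubled_cube :: "(bool \<times> (nat \<Rightarrow> real)) set" where
  "doubled_cube = UNIV \<times> space (cube k)"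

definition feature_sets :: "(bool \<times> (nat \<Rightarrow> real)) set set" where
  "feature_sets = {A. A \<subseteq> doubled_cube \<and> (\<lambda>b x. indicator A (b, x)) \<in> feature_space}"

text \<open>Complements come from affine maps, finite unions from maxima, and countable unions from
  bounded limits.\<close>

lemma feature_sets_algebra: "sigma_algebra doubled_cube feature_sets"
  unfolding sigma_algebra_iff2
proof (intro conjI ballI allI impI)
  show "feature_sets \<subseteq> Pow doubled_cube" by (auto simp: feature_sets_def)
  show "{} \<in> feature_sets" using feature_space_const[of 0] by (simp add: feature_sets_def)
  fix A assume A: "A \<in> feature_sets"
  then have "(\<lambda>b x. - 1 * indicator A (b, x) + 1) \<in> feature_space"
    by (intro feature_space_affine) (simp add: feature_sets_def)
  then have "(\<lambda>b x. indicator (doubled_cube - A) (b, x)) \<in> feature_space"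
    by (rule feature_space_cong) (simp add: doubled_cube_def indicator_def)
  then show "doubled_cube - A \<in> feature_sets" by (simp add: feature_sets_def)
next
  fix A :: "nat \<Rightarrow> (bool \<times> (nat \<Rightarrow> real)) set" assume "range A \<subseteq> feature_sets"
  then have A: "A n \<in> feature_sets" for n by blast
  have fin: "(\<lambda>b x. indicator (\<Union>i<n. A i) (b, x)) \<in> feature_space" for n
  proof (induction n)
    case 0
    show ?case using feature_space_const[of 0] by simp
  next
    case (Suc n)
    have "(\<lambda>b x. max (indicator (\<Union>i<n. A i) (b, x)) (indicator (A n) (b, x))) \<in> feature_space"
      using A[of n] by (intro feature_space_max Suc) (simp add: feature_sets_def)
    then show ?case
      by (rule feature_space_cong) (auto simp: indicator_def lessThan_Suc)
  qed
  have "(\<lambda>b x. indicator (\<Union>i. A i) (b, x)) \<in> feature_space"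
  proof (rule feature_space_limit[where B = 1 and U = "\<lambda>n b x. indicator (\<Union>i<n. A i) (b, x)"])
    show "(\<lambda>n. indicator (\<Union>i<n. A i) (b, x)) \<longlonglongrightarrow> (indicator (\<Union>i. A i) (b, x) :: real)" for b x
      by (rule LIMSEQ_indicator_UN)
    show "\<bar>indicator (\<Union>i<n. A i) (b, x) :: real\<bar> \<le> 1" for n b x by (simp add: indicator_def)
  qed (rule fin)
  moreover have "(\<Union>i. A i) \<subseteq> doubled_cube" using A unfolding feature_sets_def by blast
  ultimately show "(\<Union>i. A i) \<in> feature_sets" by (simp add: feature_sets_def)
qed

definition feature_measure :: "(bool \<times> (nat \<Rightarrow> real)) measure" where
  "feature_measure = sigma doubled_cube feature_sets"

lemma space_feature_measure [simp]: "space feature_measure = doubled_cube"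
  unfolding feature_measure_def by (rule space_measure_of) (auto simp: feature_sets_def)

lemma sets_feature_measure [simp]: "sets feature_measure = feature_sets"
  unfolding feature_measure_def by (rule sigma_algebra.sets_measure_of_eq[OF feature_sets_algebra])

text \<open>Induction over simple functions and monotone limits. The bound sits in an implication,
  with \<open>C\<close> generalised, because the functions met on the way are bounded by other
  constants such as \<open>C / c\<close>.\<close>

lemma measurable_imp_feature_space_nonneg:
  assumes "u \<in> borel_measurable feature_measure" "\<And>\<omega>. 0 \<le> u \<omega>"
  shows "(\<forall>\<omega>\<in>doubled_cube. u \<omega> \<le> C) \<longrightarrow> (\<lambda>b x. u (b, x)) \<in> feature_space"
  using assms
proof (induction arbitrary: C rule: borel_measurable_induct_real)
  case (set A)
  then show ?case by (simp add: feature_sets_def)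
next
  case (mult u c)
  show ?case
  proof
    assume b: "\<forall>\<omega>\<in>doubled_cube. c * u \<omega> \<le> C"
    show "(\<lambda>b x. c * u (b, x)) \<in> feature_space"
    proof (cases "c = 0")
      \<comment> \<open>For \<open>c = 0\<close> the bound on the product says nothing about
        \<open>u\<close>, so the induction hypothesis cannot be applied.\<close>
      case True
      then show ?thesis using feature_space_const[of 0] by simp
    next
      case False
      then have "c > 0" using mult by simp
      then have "\<forall>\<omega>\<in>doubled_cube. u \<omega> \<le> C / c" using b by (simp add: field_simps)
      then have "(\<lambda>b x. u (b, x)) \<in> feature_space" using mult.IH by blast
      from feature_space_affine[OF this, of c 0] show ?thesis by simp
    qed
  qed
next
  case (add u v)
  show ?case
  proof
    assume b: "\<forall>\<omega>\<in>doubled_cube. v \<omega> + u \<omega> \<le> C"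
    have "u \<omega> \<le> C" "v \<omega> \<le> C" if "\<omega> \<in> doubled_cube" for \<omega>
      using bspec[OF b that] add.hyps(2)[of \<omega>] add.hyps(4)[of \<omega>] by linarith+
    then have "(\<lambda>b x. u (b, x)) \<in> feature_space" "(\<lambda>b x. v (b, x)) \<in> feature_space"
      using add.IH by blast+
    then show "(\<lambda>b x. v (b, x) + u (b, x)) \<in> feature_space" by (rule feature_space_add[rotated])
  qed
next
  case (seq U)
  show ?case
  proof
    assume b: "\<forall>\<omega>\<in>doubled_cube. u \<omega> \<le> C"
    have le: "U i \<omega> \<le> u \<omega>" if "\<omega> \<in> doubled_cube" for i \<omega>
    proof (rule incseq_le[of "\<lambda>i. U i \<omega>"])
      show "incseq (\<lambda>i. U i \<omega>)" 
        using \<open>incseq U\<close> unfolding incseq_def le_fun_def by blast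
      show "(\<lambda>i. U i \<omega>) \<longlonglongrightarrow> u \<omega>" using seq.hyps that by simp
    qed
    have le': "U i \<omega> \<le> C" if "\<omega> \<in> doubled_cube" for i \<omega> 
      by (rule order_trans[OF le[OF that] bspec[OF b that]])
    have FU: "(\<lambda>b x. U i (b, x)) \<in> feature_space" for i using seq.IH[of i C] le' by blast
    show "(\<lambda>b x. u (b, x)) \<in> feature_space"
    proof (rule feature_space_limit[where B = C, OF FU])
      fix n b x assume "x \<in> space (cube k)"
      then have w: "(b, x) \<in> doubled_cube" by (simp add: doubled_cube_def)
      show "\<bar>U n (b, x)\<bar> \<le> C" using le'[OF w] seq.hyps(2)[of n "(b, x)"] by simp
    next
      fix b x assume "x \<in> space (cube k)"
      then have w: "(b, x) \<in> doubled_cube" by (simp add: doubled_cube_def)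
      then show "(\<lambda>n. U n (b, x)) \<longlonglongrightarrow> u (b, x)" using seq.hyps by simp
    qed
  qed
qed

lemma measurable_imp_feature_space:
  assumes u: "u \<in> borel_measurable feature_measure" and B: "\<And>\<omega>. \<omega> \<in> doubled_cube \<Longrightarrow> \<bar>u \<omega>\<bar> \<le> B"
  shows "(\<lambda>b x. u (b, x)) \<in> feature_space"
proof -
  \<comment> \<open>The shift makes \<open>u\<close> nonnegative on \<open>doubled_cube\<close>; the
    maximum with 0 does so elsewhere, where no bound on \<open>u\<close> is known but the induction
    rule still demands a sign.\<close>
  define v where "v = (\<lambda>\<omega>. max 0 (u \<omega> + B))"
  have v: "v \<omega> = u \<omega> + B" if "\<omega> \<in> doubled_cube" for \<omega> using B[OF that] by (simp add: v_def)
  have "v \<in> borel_measurable feature_measure" unfolding v_def using u by measurable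
  moreover have "0 \<le> v \<omega>" for \<omega> by (simp add: v_def)
  moreover have "\<forall>\<omega>\<in>doubled_cube. v \<omega> \<le> 2 * B"
  proof
    fix \<omega> assume w: "\<omega> \<in> doubled_cube"
    show "v \<omega> \<le> 2 * B" using B[OF w] v[OF w] by linarith
  qed
  ultimately have "(\<lambda>b x. v (b, x)) \<in> feature_space"
    using measurable_imp_feature_space_nonneg by blast
  then have "(\<lambda>b x. 1 * v (b, x) + (- B)) \<in> feature_space" by (rule feature_space_affine)
  then show ?thesis by (rule feature_space_cong) (simp add: v doubled_cube_def)
qed

lemma feature_space_imp_measurable:
  assumes U: "U \<in> feature_space"
  shows "(\<lambda>\<omega>. U (fst \<omega>) (snd \<omega>)) \<in> borel_measurable feature_measure"
  unfolding borel_measurable_iff_greater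
proof
  fix a :: real
  let ?A = "{\<omega> \<in> space feature_measure. a < U (fst \<omega>) (snd \<omega>)}"
  \<comment> \<open>This is \<open>min 1 (n * max 0 (t - a))\<close> written with maxima and affine
    maps only; it tends to the indicator of \<open>a < t\<close>.\<close>
  define h where "h = (\<lambda>(n::nat) t. - 1 * max 0 (- real n * max 0 (1 * t + (- a)) + 1) + 1)"
  have F: "(\<lambda>b x. h n (U b x)) \<in> feature_space" for n
    unfolding h_def by (rule feature_space_affine[OF feature_space_max[OF feature_space_const
          feature_space_affine[OF feature_space_max[OF feature_space_const feature_space_affine[OF U]]]]])
  have h_bd: "\<bar>h n t\<bar> \<le> 1" for n t
  proof -
    have "real n * max 0 (t - a) \<ge> 0" by simp
    then show ?thesis unfolding h_def by (simp add: max_def)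
  qed
  have h_lim: "(\<lambda>n. h n t) \<longlonglongrightarrow> (if a < t then 1 else 0)" for t
  proof (cases "a < t")
    case True
    obtain m :: nat where m: "1 / (t - a) < m" using reals_Archimedean2 by blast
    have "eventually (\<lambda>n. h n t = 1) sequentially"
      using eventually_ge_at_top[of m]
    proof eventually_elim
      case (elim n)
      have "1 / (t - a) \<le> real n" using m elim by linarith
      then have "1 \<le> real n * (t - a)" using True by (simp add: field_simps)
      then show ?case using True by (simp add: h_def)
    qed
    then show ?thesis using True by (simp add: tendsto_eventually)
  next
    case False
    then have "h n t = 0" for n by (simp add: h_def)
    then show ?thesis using False by simp
  qed
  have "(\<lambda>b x. indicator ?A (b, x)) \<in> feature_space"
  proof (rule feature_space_limit[where B = 1, OF F h_bd])
    fix b x assume "x \<in> space (cube k)"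
    then have "indicator ?A (b, x) = (if a < U b x then 1 else 0 :: real)"
      by (simp add: doubled_cube_def indicator_def)
    then show "(\<lambda>n. h n (U b x)) \<longlonglongrightarrow> indicator ?A (b, x)" using h_lim[of "U b x"] by simp
  qed
  then show "?A \<in> sets feature_measure" by (simp add: feature_sets_def)
qed

text \<open>Connects the sigma-algebra of features with the Borel sets of each copy of the cube, so
  that conditional and overall colour distributions are well-defined pushforwards.\<close>

lemma measurable_slice: "(\<lambda>x. (b, x)) \<in> measurable (cube k) feature_measure"
  unfolding feature_measure_def
proof (rule measurable_measure_of)
  show "feature_sets \<subseteq> Pow doubled_cube" by (auto simp: feature_sets_def)
  show "(\<lambda>x. (b, x)) \<in> space (cube k) \<rightarrow> doubled_cube" by (simp add: doubled_cube_def)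
  fix A assume "A \<in> feature_sets"
  then have "(\<lambda>x. indicator A (b, x) :: real) \<in> borel_measurable (cube k)"
    using l2_closure_sq[of "\<lambda>b x. indicator A (b, x)" k feature_algebra b] by (simp add: feature_sets_def sq_integrable_def)
  from measurable_sets[OF this, of "{1}"]
  have "(\<lambda>x. indicator A (b, x) :: real) -` {1} \<inter> space (cube k) \<in> sets (cube k)" by simp
  moreover have "(\<lambda>x. indicator A (b, x) :: real) -` {1} = (\<lambda>x. (b, x)) -` A"
    by (auto simp: indicator_def split: if_splits)
  ultimately show "(\<lambda>x. (b, x)) -` A \<inter> space (cube k) \<in> sets (cube k)" by simp
qed

text \<open>The induction step of the colour refinement. A code is tested through the integrals of
  the functions \<open>g n\<close> against the measure that it encodes.\<close>

lemma measurable_code_of_conditional: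
  assumes X: "euclidean_pullback X \<Phi>" and C: "C \<in> measurable feature_measure (borel_of X)" and j: "j < k"
  shows "(\<lambda>\<omega>. code_of X (distr I01 (borel_of X) (\<lambda>y. C (fst \<omega>, (snd \<omega>)(j := y)))))
    \<in> measurable feature_measure (borel_of (prob_topology X))"
proof -
  let ?\<mu> = "\<lambda>\<omega>. distr I01 (borel_of X) (\<lambda>y. C (fst \<omega>, (snd \<omega>)(j := y)))"
  obtain g where g: "\<forall>n. continuous_map X euclideanreal (g n)" "\<forall>n. \<exists>B. \<forall>x. \<bar>g n x\<bar> \<le> B"
    and \<Psi>: "euclidean_pullback (prob_topology X)
       (\<lambda>t n. \<integral>x. g n x \<partial>the_inv_into (borel_probs X) (code_of X) t)"
    using euclidean_pullback_prob_topology[OF X] by blast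
  interpret I: prob_space I01 by (rule prob_space_I01)
  have upd: "(\<lambda>y. x(j := y)) \<in> measurable I01 (cube k)" if "x \<in> space (cube k)" for x
    using measurable_compose[OF measurable_Pair1'[OF that] measurable_cube_update[OF j]] by simp
  have mC: "(\<lambda>y. C (b, x(j := y))) \<in> measurable I01 (borel_of X)" if "x \<in> space (cube k)" for b x
    by (rule measurable_compose[OF measurable_compose[OF upd[OF that] measurable_slice] C])
  have probs: "?\<mu> \<omega> \<in> borel_probs X" if "\<omega> \<in> doubled_cube" for \<omega>
    using that mC[of "snd \<omega>" "fst \<omega>"] by (auto simp: borel_probs_def doubled_cube_def intro!: I.prob_space_distr)
  show ?thesis
  proof (rule measurable_borel_of_pullback[OF \<Psi>])
    show "(\<lambda>\<omega>. code_of X (?\<mu> \<omega>)) \<in> space feature_measure \<rightarrow> topspace (prob_topology X)"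
      unfolding topspace_prob_topology[OF X] using probs by simp
    fix n
    have mg: "g n \<in> borel_measurable (borel_of X)" using g(1) continuous_map_imp_measurable_borel_of by blast
    obtain B where B: "\<And>x. \<bar>g n x\<bar> \<le> B" using g(2) by blast
    \<comment> \<open>From measurable functions to features, where the average over coordinate
      \<open>j\<close> is available, and back to measurable functions.\<close>
    have "(\<lambda>b x. g n (C (b, x))) \<in> feature_space"
      by (rule measurable_imp_feature_space[OF measurable_compose[OF C mg] B])
    from feature_space_imp_measurable[OF feature_space_update[OF this j]]
    have m: "(\<lambda>\<omega>. \<integral>y. g n (C (fst \<omega>, (snd \<omega>)(j := y))) \<partial>I01) \<in> borel_measurable feature_measure" .
    have "(\<integral>x. g n x \<partial>the_inv_into (borel_probs X) (code_of X) (code_of X (?\<mu> \<omega>)))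
        = (\<integral>y. g n (C (fst \<omega>, (snd \<omega>)(j := y))) \<partial>I01)" if w: "\<omega> \<in> space feature_measure" for \<omega>
    proof -
      have "\<omega> \<in> doubled_cube" using w by simp
      then have "the_inv_into (borel_probs X) (code_of X) (code_of X (?\<mu> \<omega>)) = ?\<mu> \<omega>"
        by (intro the_inv_into_f_f[OF inj_on_code_of[OF X]] probs)
      moreover have "(\<integral>x. g n x \<partial>?\<mu> \<omega>) = (\<integral>y. g n (C (fst \<omega>, (snd \<omega>)(j := y))) \<partial>I01)"
        using w by (intro integral_distr mC mg) (auto simp: doubled_cube_def)
      ultimately show ?thesis by simp
    qed
    then show "(\<lambda>\<omega>. \<integral>x. g n x \<partial>the_inv_into (borel_probs X) (code_of X) (code_of X (?\<mu> \<omega>)))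
      \<in> borel_measurable feature_measure"
      using m by (subst measurable_cong)
  qed
qed

end

section \<open>Colours as measurable functions and equality of the distributions\<close>

locale agreeing_signals = agreeing_network +
  fixes r :: real and Wb :: "bool \<Rightarrow> real \<Rightarrow> real \<Rightarrow> real" and fb :: "bool \<Rightarrow> real \<Rightarrow> real"
  assumes inp_eq: "\<And>b. inp b = iwn_input (Wb b) (fb b)"
    and signals: "\<And>b. graphon_signal r (Wb b) (fb b)"
begin

lemma measurable_feature_into:
  assumes U: "U \<in> feature_space" and S: "\<And>b x. x \<in> space (cube k) \<Longrightarrow> U b x \<in> S"
  shows "(\<lambda>\<omega>. U (fst \<omega>) (snd \<omega>)) \<in> measurable feature_measure (borel_of (top_of_set S))"
  by (rule measurable_borel_of_pullback[OF euclidean_pullback_top_of_set _ feature_space_imp_measurable[OF U]])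
    (auto simp: doubled_cube_def S)

lemma measurable_initial_coordinate:
  assumes c: "c \<in> edge_coords k \<union> vertex_coords k"
  shows "(\<lambda>\<omega>. case c of Edge e \<Rightarrow> Wb (fst \<omega>) (snd \<omega> (Min e)) (snd \<omega> (Max e)) | Vertex j \<Rightarrow> fb (fst \<omega>) (snd \<omega> j))
    \<in> measurable feature_measure
      (borel_of (case_coord (\<lambda>_. top_of_set {0..1}) (\<lambda>_. top_of_set {-r..r}) c))"
proof (cases c)
  case (Edge e)
  then have e: "e \<subseteq> {..<k}" "card e = 2" using c by (auto simp: edge_coords_def vertex_coords_def)
  then have fin: "finite e" "e \<noteq> {}" using finite_subset by auto
  have lt: "Min e < k" "Max e < k" using Min_in[OF fin] Max_in[OF fin] e(1) by auto
  have ne: "Min e \<noteq> Max e"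
  proof
    assume "Min e = Max e"
    then have "e \<subseteq> {Min e}"
      using fin(1) by (metis Max_ge Min_le antisym singletonI subsetI)
    then have "card e \<le> 1" using card_mono[of "{Min e}" e] by simp
    then show False using e(2) by simp
  qed
  define \<pi> where "\<pi> = (\<lambda>i::nat. if i = 0 then Min e else Max e)"
  have "inj_on \<pi> {..<2}" "\<And>i. i < 2 \<Longrightarrow> \<pi> i < k" using ne lt by (auto simp: \<pi>_def inj_on_def)
  from feature_space_input[OF _ this, of 0]
  have F: "(\<lambda>b x. Wb b (x (Min e)) (x (Max e))) \<in> feature_space"
    by (simp add: inp_eq iwn_input_def \<pi>_def)
  have S: "Wb b (x (Min e)) (x (Max e)) \<in> {0..1}" if "x \<in> space (cube k)" for b x
    using signals[of b] space_cube_component[OF that lt(1)] space_cube_component[OF that lt(2)]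
    unfolding graphon_signal_def by blast
  have "(\<lambda>\<omega>. Wb (fst \<omega>) (snd \<omega> (Min e)) (snd \<omega> (Max e)))
      \<in> measurable feature_measure (borel_of (top_of_set {0..1}))"
    by (rule measurable_feature_into[OF F]) (rule S)
  then show ?thesis by (simp add: Edge)
next
  case (Vertex j)
  then have j: "j < k" using c by (auto simp: edge_coords_def vertex_coords_def)
  \<comment> \<open>The signal enters as a tensor of dimension 2, so a second coordinate different
    from \<open>j\<close> has to be occupied; \<open>k > 1\<close> provides one.\<close>
  define \<pi> where "\<pi> = (\<lambda>i::nat. if i = 0 then j else if j = 0 then 1 else 0 :: nat)"
  have "inj_on \<pi> {..<2}" "\<And>i. i < 2 \<Longrightarrow> \<pi> i < k" using j k by (auto simp: \<pi>_def inj_on_def)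
  from feature_space_input[OF _ this, of 1]
  have F: "(\<lambda>b x. fb b (x j)) \<in> feature_space" by (simp add: inp_eq iwn_input_def \<pi>_def)
  have S: "fb b (x j) \<in> {-r..r}" if "x \<in> space (cube k)" for b x
    using signals[of b] space_cube_component[OF that j] unfolding graphon_signal_def by blast
  have "(\<lambda>\<omega>. fb (fst \<omega>) (snd \<omega> j)) \<in> measurable feature_measure (borel_of (top_of_set {-r..r}))"
    by (rule measurable_feature_into[OF F]) (rule S)
  then show ?thesis by (simp add: Vertex)
qed

text \<open>Strong induction: the colour of round \<open>t\<close> is assembled from the coordinates
  of all rounds up to \<open>t\<close>, and only then passed to the conditional distributions that
  form the next coordinate.\<close>

lemma measurable_wl_coordinate:
  "(\<lambda>\<omega>. wl_color k r (Wb (fst \<omega>)) (fb (fst \<omega>)) s (snd \<omega>) s)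
     \<in> measurable feature_measure (borel_of (P_space k r s))"
proof (induction s rule: less_induct)
  case (less s)
  show ?case
  proof (cases s)
    case 0
    have "\<exists>\<Phi>. euclidean_pullback (case_coord (\<lambda>_. top_of_set {0..1}) (\<lambda>_. top_of_set {-r..r}) c) \<Phi>" for c
      using euclidean_pullback_top_of_set by (cases c) auto
    then have "(\<lambda>\<omega>. \<lambda>c\<in>edge_coords k \<union> vertex_coords k. case c of
          Edge e \<Rightarrow> Wb (fst \<omega>) (snd \<omega> (Min e)) (snd \<omega> (Max e)) | Vertex j \<Rightarrow> fb (fst \<omega>) (snd \<omega> j))
        \<in> measurable feature_measure (borel_of (P_space k r 0))"
      unfolding P_space.simps
    proof (intro measurable_borel_of_product)
      show "countable (edge_coords k \<union> vertex_coords k)" by (simp add: countable_coords)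
      fix c assume c: "c \<in> edge_coords k \<union> vertex_coords k"
      from measurable_initial_coordinate[OF c]
      show "(\<lambda>\<omega>. (\<lambda>c\<in>edge_coords k \<union> vertex_coords k. case c of
          Edge e \<Rightarrow> Wb (fst \<omega>) (snd \<omega> (Min e)) (snd \<omega> (Max e)) | Vertex j \<Rightarrow> fb (fst \<omega>) (snd \<omega> j)) c)
        \<in> measurable feature_measure (borel_of (case_coord (\<lambda>_. top_of_set {0..1}) (\<lambda>_. top_of_set {-r..r}) c))"
        unfolding restrict_apply' [OF c] .
    qed auto
    moreover have "(0::nat) \<in> {..0}" by simp
    ultimately show ?thesis unfolding 0 wl_color.simps by (simp only: restrict_apply')
  next
    case (Suc t)
    let ?C = "\<lambda>\<omega>. wl_color k r (Wb (fst \<omega>)) (fb (fst \<omega>)) t (snd \<omega>)"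
    have M: "M_space k r t = product_topology (P_space k r) {..t}" by (simp add: M_space_def)
    have "\<exists>\<Phi>. euclidean_pullback (M_space k r t) \<Phi>"
    proof -
      obtain \<Phi> where "\<And>i. euclidean_pullback (P_space k r i) (\<Phi> i)"
        using ex_euclidean_pullback_P_space by metis
      then show ?thesis unfolding M by (intro exI) (rule euclidean_pullback_product, simp_all)
    qed
    then obtain \<Phi> where \<Phi>: "euclidean_pullback (M_space k r t) \<Phi>" by blast
    have C: "?C \<in> measurable feature_measure (borel_of (M_space k r t))"
      unfolding M
    proof (rule measurable_borel_of_product)
      fix i assume i: "i \<in> {..t}"
      then have eq: "wl_color k r W f t x i = wl_color k r W f i x i" for W f x
        by (intro wl_color_component) simp
      show "(\<lambda>\<omega>. ?C \<omega> i) \<in> measurable feature_measure (borel_of (P_space k r i))"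
        unfolding eq using i by (intro less.IH) (simp add: Suc)
    qed (simp_all add: ex_euclidean_pullback_P_space wl_color_extensional)
    have "(\<lambda>\<omega>. \<lambda>c\<in>vertex_coords k. case c of Edge e \<Rightarrow> undefined | Vertex j \<Rightarrow> code_of (M_space k r t)
        (distr I01 (borel_of (M_space k r t))
          (\<lambda>y. wl_color k r (Wb (fst \<omega>)) (fb (fst \<omega>)) t ((snd \<omega>)(j := y)))))
      \<in> measurable feature_measure (borel_of (P_space k r (Suc t)))"
      unfolding P_space.simps M[symmetric]
    proof (rule measurable_borel_of_product)
      show "countable (vertex_coords k)" by (rule countable_coords)
      show "\<exists>\<Phi>. euclidean_pullback (prob_topology (M_space k r t)) \<Phi>"
        using euclidean_pullback_prob_topology[OF \<Phi>] by blast
      fix c assume c: "c \<in> vertex_coords k"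
      then obtain j where j: "c = Vertex j" "j < k" by (auto simp: vertex_coords_def)
      from measurable_code_of_conditional[OF \<Phi> C j(2)]
      show "(\<lambda>\<omega>. (\<lambda>c\<in>vertex_coords k. case c of Edge e \<Rightarrow> undefined | Vertex j \<Rightarrow> code_of (M_space k r t)
        (distr I01 (borel_of (M_space k r t))
          (\<lambda>y. wl_color k r (Wb (fst \<omega>)) (fb (fst \<omega>)) t ((snd \<omega>)(j := y))))) c)
        \<in> measurable feature_measure (borel_of (prob_topology (M_space k r t)))"
        unfolding restrict_apply'[OF c] by (simp add: j(1))
    qed auto
    then show ?thesis unfolding Suc wl_color.simps fun_upd_same .
  qed
qed

lemma measurable_wl_color_inf:
  "(\<lambda>\<omega>. wl_color_inf k r (Wb (fst \<omega>)) (fb (fst \<omega>)) (snd \<omega>))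
     \<in> measurable feature_measure (borel_of (M_space_inf k r))"
  unfolding M_space_inf_def
proof (rule measurable_borel_of_product)
  fix i
  show "(\<lambda>\<omega>. wl_color_inf k r (Wb (fst \<omega>)) (fb (fst \<omega>)) (snd \<omega>) i)
      \<in> measurable feature_measure (borel_of (P_space k r i))"
    unfolding wl_color_inf_def by (rule measurable_wl_coordinate)
qed (simp_all add: ex_euclidean_pullback_P_space)

lemma wl_distribution_eq: "wl_distribution k r (Wb True) (fb True) = wl_distribution k r (Wb False) (fb False)"
proof (rule measure_eqI)
  show "sets (wl_distribution k r (Wb True) (fb True)) = sets (wl_distribution k r (Wb False) (fb False))"
    by (simp add: wl_distribution_def)
  interpret prob_space "cube k" by (rule prob_space_cube)
  fix B assume "B \<in> sets (wl_distribution k r (Wb True) (fb True))"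
  then have B: "B \<in> sets (borel_of (M_space_inf k r))" by (simp add: wl_distribution_def)
  let ?c = "\<lambda>\<omega>. wl_color_inf k r (Wb (fst \<omega>)) (fb (fst \<omega>)) (snd \<omega>)"
  \<comment> \<open>The event \<open>B\<close> pulled back to both copies at once. As a feature set
    its two slices have equal measure, which is the whole claim.\<close>
  define A where "A = ?c -` B \<inter> doubled_cube"
  have A: "A \<in> feature_sets" using measurable_sets[OF measurable_wl_color_inf B] by (simp add: A_def)
  have m: "wl_color_inf k r (Wb b) (fb b) \<in> measurable (cube k) (borel_of (M_space_inf k r))" for b
    using measurable_compose[OF measurable_slice[of b] measurable_wl_color_inf] by simp
  have "emeasure (wl_distribution k r (Wb b) (fb b)) B = ennreal (\<integral>x. indicator A (b, x) \<partial>cube k)" for b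
  proof -
    let ?S = "wl_color_inf k r (Wb b) (fb b) -` B \<inter> space (cube k)"
    have S: "?S \<in> sets (cube k)" by (rule measurable_sets[OF m B])
    have "(\<integral>x. indicator A (b, x) \<partial>cube k) = (\<integral>x. indicator ?S x \<partial>cube k :: real)"
      by (rule Bochner_Integration.integral_cong) (auto simp: A_def doubled_cube_def indicator_def)
    also have "\<dots> = measure (cube k) ?S" using S by simp
    finally show ?thesis
      unfolding wl_distribution_def by (simp add: emeasure_distr[OF m B] emeasure_eq_measure)
  qed
  moreover have "(\<integral>x. indicator A (True, x) \<partial>cube k) = (\<integral>x. indicator A (False, x) \<partial>cube k :: real)"
    using A by (intro feature_space_agree[of "\<lambda>b x. indicator A (b, x)"]) (simp add: feature_sets_def)
  ultimately show "emeasure (wl_distribution k r (Wb True) (fb True)) B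
      = emeasure (wl_distribution k r (Wb False) (fb False)) B" by simp
qed

end

theorem corollary4p7:
  fixes r :: real and k :: nat and \<rho> :: "real \<Rightarrow> real"
    and W V :: "real \<Rightarrow> real \<Rightarrow> real" and f g :: "real \<Rightarrow> real"
  assumes "r > 0" and "k > 1"
    and "\<exists>L. L-lipschitz_on UNIV \<rho>"
    and "\<not> (\<exists>p :: real poly. \<forall>t. \<rho> t = poly p t)"
    and "graphon_signal r W f" and "graphon_signal r V g"
    and "wl_distribution k r W f \<noteq> wl_distribution k r V g"
  shows "\<exists>N. is_iwn N \<and> iwn_order N \<le> k \<and> iwn_eval \<rho> N W f \<noteq> iwn_eval \<rho> N V g"
proof (rule ccontr)
  assume no: "\<not> ?thesis"
  obtain L where L: "L-lipschitz_on UNIV \<rho>" using assms(3) by blast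
  define Wb where "Wb = (\<lambda>b. if b then W else V)"
  define fb where "fb = (\<lambda>b. if b then f else g)"
  have gs: "graphon_signal r (Wb b) (fb b)" for b using assms(5,6) by (simp add: Wb_def fb_def)
  have x01: "x 0 \<in> {0..1}" "x 1 \<in> {0..1}" if "x \<in> space (cube 2)" for x
    by (rule space_cube_component[OF that], simp)+
  interpret agreeing_signals \<rho> L k "\<lambda>b. iwn_input (Wb b) (fb b)" r Wb fb
  proof unfold_locales
    show "L-lipschitz_on UNIV \<rho>" by (rule L)
    show "\<not> (\<exists>p :: real poly. \<forall>t. \<rho> t = poly p t)" by (rule assms(4))
    show "k > 1" by (rule assms(2))
    show "graphon_signal r (Wb b) (fb b)" for b by (rule gs)
    show "iwn_features \<rho> N (iwn_input (Wb True) (fb True)) (depth N) 0 (\<lambda>_. undefined) =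
      iwn_features \<rho> N (iwn_input (Wb False) (fb False)) (depth N) 0 (\<lambda>_. undefined)"
      if "is_iwn N" "iwn_order N \<le> k" for N
      using no that unfolding iwn_eval_def Wb_def fb_def by auto
    show "iwn_input (Wb b) (fb b) p \<in> borel_measurable (cube 2)" if "p < 2" for b p
    proof -
      have W: "(\<lambda>(x, y). Wb b x y) \<in> borel_measurable (I01 \<Otimes>\<^sub>M I01)" and f: "fb b \<in> borel_measurable I01"
        using gs[of b] by (simp_all add: graphon_signal_def)
      have c: "(\<lambda>x. x 0) \<in> measurable (cube 2) I01" "(\<lambda>x. x 1) \<in> measurable (cube 2) I01" by auto
      have "(\<lambda>x. Wb b (x 0) (x 1)) \<in> borel_measurable (cube 2)"
        using measurable_compose[OF measurable_Pair[OF c] W] by simp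
      moreover have "(\<lambda>x. fb b (x 0)) \<in> borel_measurable (cube 2)"
        by (rule measurable_compose[OF c(1) f])
      ultimately show ?thesis by (simp add: iwn_input_def)
    qed
    \<comment> \<open>One bound for both channels: the kernel is at most 1 and the signal at most
      \<open>r\<close> in absolute value.\<close>
    have "\<bar>iwn_input (Wb b) (fb b) p x\<bar> \<le> 1 + r" if "x \<in> space (cube 2)" for b p x
    proof -
      have "Wb b (x 0) (x 1) \<in> {0..1}" "fb b (x 0) \<in> {-r..r}"
        using gs[of b] x01[OF that] unfolding graphon_signal_def by blast+
      then show ?thesis using assms(1) by (simp add: iwn_input_def abs_le_iff)
    qed
    then show "\<exists>B. \<forall>b. \<forall>p<2. \<forall>x\<in>space (cube 2). \<bar>iwn_input (Wb b) (fb b) p x\<bar> \<le> B" by blast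
  qed simp
  from wl_distribution_eq assms(7) show False by (simp add: Wb_def fb_def)
qed

end
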